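(* Fix an oriented $(2,3,5)$ distribution $(M,\mathbf D)$, with standard tractor bundle $\mathcal V$ and normal tractor connection $\nabla^{\mathcal V}$. (1) Let $\theta,\hat\theta$ be scales with corresponding Weyl structures $s$ and $\hat s=s\exp\Upsilon_1\exp\Upsilon_2\exp\Upsilon_3$, $\Upsilon_i\in\Gamma(\mathrm{gr}_i(T^*M))$. If a section $t\in\Gamma(\mathcal V)$ has components $(\chi,\phi^\alpha,\upsilon,\tau_\alpha,\sigma)$ in the splitting determined by $\theta$, then its components in the splitting determined by $\hat\theta$ are $$\begin{aligned} \hat\chi&=\chi-\phi^\alpha(\Upsilon_1)_\alpha-\upsilon\Upsilon_2-\tau_\alpha(\Upsilon_3)^\alpha+4\Upsilon_2\mathcal L^{\alpha\beta}(\Upsilon_1)_\alpha\tau_\beta+\tfrac12\sigma\Upsilon_2\Upsilon_2-\sigma(\Upsilon_1)_\alpha(\Upsilon_3)^\alpha,\\ \hat\phi^\alpha&=\phi^\alpha-4\upsilon\mathcal L^{\beta\alpha}(\Upsilon_1)_\beta-2\Upsilon_2\mathcal L^{\beta\alpha}\tau_\beta+8\mathcal L^{\gamma\zeta}(\Upsilon_1)_\gamma\tau_\zeta\mathcal L^{\beta\alpha}(\Upsilon_1)_\beta+\sigma(\Upsilon_3)^\alpha-2\sigma\Upsilon_2\mathcal L^{\beta\alpha}(\Upsilon_1)_\beta,\\ \hat\upsilon&=\upsilon-4\mathcal L^{\alpha\beta}(\Upsilon_1)_\alpha\tau_\beta-\sigma\Upsilon_2,\\ \hat\tau_\alpha&=\tau_\alpha+\sigma(\Upsilon_1)_\alpha,\\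 \hat\sigma&=\sigma. \end{aligned}$$ (2) In terms of the splitting, the Weyl connection $\nabla$ and the Rho tensor $\mathsf P$ determined by a scale $\theta$, the tractor connection on $\mathcal V$ is given by $$\nabla^{\mathcal V}_\beta\begin{pmatrix}\chi\\ \phi^\alpha\\ \upsilon\\ \tau_\alpha\\ \sigma\end{pmatrix}=\begin{pmatrix}\nabla_\beta\chi+\mathsf P_{\beta\zeta}\phi^\zeta+\mathsf P_{\beta\diamond}\upsilon+\mathsf P_\beta{}^\zeta\tau_\zeta\\ \nabla_\beta\phi^\alpha+\chi\delta^\alpha{}_\beta+4\upsilon\mathcal L^{\gamma\alpha}\mathsf P_{\beta\gamma}+2\mathsf P_{\beta\diamond}\mathcal L^{\gamma\alpha}\tau_\gamma-\sigma\mathsf P_\beta{}^\alpha\\ \nabla_\beta\upsilon+\tfrac12\mathcal L_{\beta\gamma}\phi^\gamma+4\mathcal L^{\gamma\zeta}\mathsf P_{\beta\gamma}\tau_\zeta+\sigma\mathsf P_{\beta\diamond}\\ \nabla_\beta\tau_\alpha+\tfrac12\upsilon\mathcal L_{\beta\alpha}-\sigma\mathsf P_{\beta\alpha}\\ \nabla_\beta\sigma-\tau_\beta\end{pmatrix},$$ $$\nabla^{\mathcal V}_\diamond\begin{pmatrix}\chi\\ \phi^\alpha\\ \upsilon\\ \tau_\alpha\\ \sigma\end{pmatrix}=\begin{pmatrix}\nabla_\diamond\chi+\mathsf P_{\diamond\gamma}\phi^\gamma+\mathsf P_{\diamond\diamond}\upsilon+\mathsf P_\diamond{}^\gamma\tau_\gamma\\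 \nabla_\diamond\phi^\alpha+4\upsilon\mathcal L^{\gamma\alpha}\mathsf P_{\diamond\gamma}+2\mathsf P_{\diamond\diamond}\mathcal L^{\gamma\alpha}\tau_\gamma-\sigma\mathsf P_\diamond{}^\alpha\\ \nabla_\diamond\upsilon+\chi+4\mathcal L^{\gamma\zeta}\mathsf P_{\diamond\gamma}\tau_\zeta+\sigma\mathsf P_{\diamond\diamond}\\ \nabla_\diamond\tau_\alpha-\tfrac14\mathcal L_{\gamma\alpha}\phi^\gamma-\sigma\mathsf P_{\diamond\alpha}\\ \nabla_\diamond\sigma+\upsilon\end{pmatrix},$$ $$(\nabla^{\mathcal V})^\beta\begin{pmatrix}\chi\\ \phi^\alpha\\ \upsilon\\ \tau_\alpha\\ \sigma\end{pmatrix}=\begin{pmatrix}\nabla^\beta\chi+\mathsf P^\beta{}_\gamma\phi^\gamma+\mathsf P^\beta{}_\diamond\upsilon+\mathsf P^{\beta\gamma}\tau_\gamma\\ \nabla^\beta\phi^\alpha+4\upsilon\mathcal L^{\gamma\alpha}\mathsf P^\beta{}_\gamma+2\mathsf P^\beta{}_\diamond\mathcal L^{\gamma\alpha}\tau_\gamma-\sigma\mathsf P^{\beta\alpha}\\ \nabla^\beta\upsilon+4\mathcal L^{\gamma\zeta}\mathsf P^\beta{}_\gamma\tau_\zeta+\sigma\mathsf P^\beta{}_\diamond\\ \nabla^\beta\tau_\alpha+\chi\delta^\beta{}_\alpha-\sigma\mathsf P^\beta{}_\alpha\\ \nabla^\beta\sigma-\phi^\beta\end{pmatrix}.$$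
   Context: Distributions. A $(2,3,5)$ distribution on a $5$-manifold $M$ is a rank-$2$ subbundle $\mathbf D\subset TM$ with $[\mathbf D,\mathbf D]$ of rank $3$ and $[\mathbf D,[\mathbf D,\mathbf D]]=TM$; oriented means $\mathbf D\to M$ is oriented. Put $\mathrm{gr}_{-1}(TM)=\mathbf D$, $\mathrm{gr}_{-2}(TM)=[\mathbf D,\mathbf D]/\mathbf D$, $\mathrm{gr}_{-3}(TM)=TM/[\mathbf D,\mathbf D]$, $\mathcal E[1]:=\mathrm{gr}_{-2}(TM)$, $\mathcal E[w]:=\mathcal E[1]^{\otimes w}$, $B[w]:=B\otimes\mathcal E[w]$. The Lie bracket induces isomorphisms (Levi bracket) $\bigwedge^2\mathbf D\cong\mathrm{gr}_{-2}(TM)$ and $\mathbf D\otimes\mathrm{gr}_{-2}(TM)\cong\mathrm{gr}_{-3}(TM)$. A scale is a nowhere vanishing section $\theta$ of $\mathcal E[1]$. Lie algebra. Let $\mathbb J=\begin{pmatrix}0&-1\\ 1&0\end{pmatrix}$, $\mathbb I$ the $2\times2$ identity. The (split) Lie algebra $\mathfrak g_2$ of $\mathrm G_2$ (automorphism group of the split octonions), acting on the $7$-dimensional representation $\mathbb V$, consists of the matrices $$\begin{pmatrix}-\operatorname{tr}A & Z & s & W^\top & 0 \\ X & A-(\operatorname{tr}A)\mathbb I & \sqrt2\,\mathbb JZ^\top & \tfrac1{\sqrt2}s\mathbb J & -W \\ r & -\sqrt2X^\top\mathbb J & 0 & -\sqrt2Z\mathbb J & s \\ Y^\top & -\tfrac1{\sqrt2}r\mathbb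 J & \sqrt2\,\mathbb JX & (\operatorname{tr}A)\mathbb I-A^\top & -Z^\top \\ 0 & -Y & r & -X^\top & \operatorname{tr}A\end{pmatrix},$$ $X,W\in\mathbb R^2$, $r,s\in\mathbb R$, $Y,Z\in(\mathbb R^2)^*$, $A\in\mathfrak{gl}(2,\mathbb R)$. It has the $|3|$-grading with $X,r,Y$ parametrising $\mathfrak g_{-1},\mathfrak g_{-2},\mathfrak g_{-3}$, $A$ parametrising $\mathfrak g_0$, and $Z,s,W$ parametrising $\mathfrak g_1,\mathfrak g_2,\mathfrak g_3$; $\mathfrak g_\pm$ denote the sums of positive/negative parts. $P<\mathrm G_2$ is the stabiliser of the ray spanned by the first basis vector, $G_0<P$ the subgroup preserving the grading, $P_+=\exp\mathfrak g_+$. Elements of $\mathbb V$ are written as columns $(\chi,\phi,\upsilon,\tau^\top,\sigma)$, with $\chi,\upsilon,\sigma\in\mathbb R$, $\phi=(\phi^\alpha)$, $\tau=(\tau_\alpha)$, $\alpha=1,2$. Cartan geometry and Weyl structures. Let $(\mathcal G\to M,\omega)$ be the regular, normal parabolic geometry of type $(\mathrm G_2,P)$ canonically associated with $\mathbf D$, $\mathcal G_0=\mathcal G/P_+$, and $\mathcal V=\mathcal G\times_P\mathbb V$ with the linear connection $\nabla^{\mathcal V}$ induced by $\omega$. A Weyl structure is a $G_0$-equivariant section $s:\mathcal G_0\to\mathcal G$; the pullback $s^*\omega$ decomposes into $s^*\omega_-$ (giving an isomorphism $TM\cong\mathrm{gr}(TM)=\mathcal G_0\times_{G_0}\mathfrak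 g_-$, $\xi\mapsto(\xi_{-3},\xi_{-2},\xi_{-1})$), a principal connection $s^*\omega_0$ on $\mathcal G_0$ (inducing the Weyl connections $\nabla$ on all bundles associated to $\mathcal G_0$), and the Rho tensor $s^*\omega_+$, viewed as $\mathsf P\in\Omega^1(M,\mathrm{gr}(T^*M))$, $\mathrm{gr}_i(T^*M)=\mathcal G_0\times_{G_0}\mathfrak g_i$. A scale $\theta$ determines the unique Weyl structure whose Weyl connection on $\mathcal E[1]$ satisfies $\nabla\theta=0$. Any two Weyl structures are related by $\hat s(u)=s(u)\exp\Upsilon_1(u)\exp\Upsilon_2(u)\exp\Upsilon_3(u)$ for unique $\Upsilon_i\in\Gamma(\mathrm{gr}_i(T^*M))$, regarded as equivariant functions $\mathcal G_0\to\mathfrak g_i$. A Weyl structure $s$ identifies $\mathcal V\cong\mathcal G_0\times_{G_0}\mathbb V$, so a section $t$ has components $(\chi,\phi^\alpha,\upsilon,\tau_\alpha,\sigma)$, sections of $\mathcal E[-1]$, $\mathrm{gr}_{-1}(TM)[-1]$, $\mathrm{gr}_{-2}(TM)[-1]$, $\mathrm{gr}_{-3}(TM)[-1]\cong\mathbf D^*[1]$, $\mathcal E[1]$. Index notation. Components with respect to the coordinates above: $(\xi_{-1})^\alpha$, $\xi_{-2}$, $(\xi_{-3})_\alpha$ correspond to $X,r,Y$; $(\Upsilon_1)_\alpha,\Upsilon_2,(\Upsilon_3)^\alpha$ correspond to $Z,s,W$. (In particular $\mathrm{gr}_{-3}(TM)\cong\mathbf D^*[2]$, the class of $[\xi,\zeta]$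 for $\xi\in\Gamma(\mathbf D)$, $\zeta\in\Gamma([\mathbf D,\mathbf D])$ with class $r\in\Gamma(\mathcal E[1])$ corresponding to $\tfrac34r\mathcal L_{\beta\alpha}\xi^\beta$.) $\mathcal L_{\alpha\beta}\in\Gamma(\bigwedge^2\mathbf D^*[1])$ is the Levi bracket, $\mathcal L_{\alpha\beta}\xi^\alpha\eta^\beta=[\xi,\eta]\bmod\mathbf D$ (in coordinates $\mathcal L_{\alpha\beta}=2\sqrt2\,\epsilon_{\alpha\beta}$, $\epsilon_{12}=1$), and $\mathcal L^{\alpha\beta}\in\Gamma(\bigwedge^2\mathbf D[-1])$ is determined by $\mathcal L^{\gamma\alpha}\mathcal L_{\gamma\beta}=\delta^\alpha{}_\beta$. The operators $\nabla_\beta,\nabla_\diamond,\nabla^\beta$ are defined by $\nabla_\xi=(\xi_{-1})^\beta\nabla_\beta+\xi_{-2}\nabla_\diamond+(\xi_{-3})_\beta\nabla^\beta$, and likewise for $\nabla^{\mathcal V}$. The components of $\mathsf P$ are defined by: the $\mathfrak g_1,\mathfrak g_2,\mathfrak g_3$ components ($Z,s,W$) of $\mathsf P(\xi)$ are, respectively, $(\xi_{-1})^\alpha\mathsf P_{\alpha\beta}+\xi_{-2}\mathsf P_{\diamond\beta}+(\xi_{-3})_\alpha\mathsf P^\alpha{}_\beta$; $(\xi_{-1})^\alpha\mathsf P_{\alpha\diamond}+\xi_{-2}\mathsf P_{\diamond\diamond}+(\xi_{-3})_\alpha\mathsf P^\alpha{}_\diamond$; $(\xi_{-1})^\alpha\mathsf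 P_\alpha{}^\beta+\xi_{-2}\mathsf P_\diamond{}^\beta+(\xi_{-3})_\alpha\mathsf P^{\alpha\beta}$. *)

theory Defs
  imports "HOL-Analysis.Analysis"
begin

section \<open>Smooth manifolds\<close>

text \<open>Only used for open sets, where (in finite dimensions) it says that \<open>f\<close> is of class C^k.\<close>

primrec Ck_on :: "nat \<Rightarrow> 'a::real_normed_vector set \<Rightarrow> ('a \<Rightarrow> 'b::real_normed_vector) \<Rightarrow> bool" where
  "Ck_on 0 S f \<longleftrightarrow> continuous_on S f"
| "Ck_on (Suc k) S f \<longleftrightarrow> (\<forall>x\<in>S. f differentiable at x) \<and>
     (\<forall>v. Ck_on k S (\<lambda>x. frechet_derivative f (at x) v))"

definition smooth_on :: "'a::real_normed_vector set \<Rightarrow> ('a \<Rightarrow> 'b::real_normed_vector) \<Rightarrow> bool" where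
  "smooth_on S f \<longleftrightarrow> (\<forall>k. Ck_on k S f)"

type_synonym ('m, 'e) atlas = "('m set \<times> ('m \<Rightarrow> 'e)) set"

text \<open>A manifold is a whole type carrying an atlas. The Hausdorff property and second countability
  are class constraints on that type.\<close>

definition smooth_atlas ::
  "('m::{t2_space,second_countable_topology}, 'e::euclidean_space) atlas \<Rightarrow> bool" where
  "smooth_atlas A \<longleftrightarrow>
     (\<Union>(U, \<phi>)\<in>A. U) = UNIV \<and>
     (\<forall>(U, \<phi>)\<in>A. open U \<and> open (\<phi> ` U) \<and> homeomorphism U (\<phi> ` U) \<phi> (inv_into U \<phi>)) \<and>
     (\<forall>(U, \<phi>)\<in>A. \<forall>(V, \<psi>)\<in>A. smooth_on (\<phi> ` (U \<inter> V)) (\<psi> \<circ> inv_into U \<phi>))"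

definition std_atlas :: "('e, 'e::euclidean_space) atlas" where
  "std_atlas = {(UNIV, \<lambda>x. x)}"

definition prod_atlas ::
  "('a, 'd::euclidean_space) atlas \<Rightarrow> ('b, 'e::euclidean_space) atlas \<Rightarrow> ('a \<times> 'b, 'd \<times> 'e) atlas" where
  "prod_atlas A B = {(U \<times> V, \<lambda>(x, y). (\<phi> x, \<psi> y)) | U \<phi> V \<psi>. (U, \<phi>) \<in> A \<and> (V, \<psi>) \<in> B}"

text \<open>\<open>f\<close> is smooth on some open neighbourhood of \<open>p\<close>.\<close>

definition smooth_at ::
  "('m::topological_space, 'd::euclidean_space) atlas \<Rightarrow> ('n, 'e::euclidean_space) atlas \<Rightarrow>
   ('m \<Rightarrow> 'n) \<Rightarrow> 'm \<Rightarrow> bool" where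
  "smooth_at A B f p \<longleftrightarrow>
     (\<exists>(U, \<phi>)\<in>A. \<exists>(V, \<psi>)\<in>B. \<exists>N. open N \<and> p \<in> N \<and> N \<subseteq> U \<and> f ` N \<subseteq> V \<and>
        smooth_on (\<phi> ` N) (\<psi> \<circ> f \<circ> inv_into U \<phi>))"

definition smooth_map ::
  "('m::topological_space, 'd::euclidean_space) atlas \<Rightarrow> ('n, 'e::euclidean_space) atlas \<Rightarrow>
   ('m \<Rightarrow> 'n) \<Rightarrow> bool" where
  "smooth_map A B f \<longleftrightarrow> (\<forall>p. smooth_at A B f p)"

text \<open>Smoothness of a map defined on an arbitrary subset: local extendability to a smooth map.\<close>

definition smooth_map_on_subset ::
  "('m::topological_space, 'd::euclidean_space) atlas \<Rightarrow> ('n, 'e::euclidean_space) atlas \<Rightarrow>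
   'm set \<Rightarrow> ('m \<Rightarrow> 'n) \<Rightarrow> bool" where
  "smooth_map_on_subset A B S f \<longleftrightarrow>
     (\<forall>p\<in>S. \<exists>F N. open N \<and> p \<in> N \<and> smooth_at A B F p \<and> (\<forall>y\<in>N \<inter> S. F y = f y))"

text \<open>Tangent vectors at \<open>p\<close> are the operators on germs of real functions at \<open>p\<close> given by
  differentiation along smooth curves. They are set to 0 on functions that are not smooth near \<open>p\<close>,
  so that equality of tangent vectors is equality of operators.\<close>

type_synonym 'm tv = "('m \<Rightarrow> real) \<Rightarrow> real"

definition velocity ::
  "('m::topological_space, 'e::euclidean_space) atlas \<Rightarrow> (real \<Rightarrow> 'm) \<Rightarrow> 'm tv" where
  "velocity A c = (\<lambda>f. if smooth_at A std_atlas f (c 0) then deriv (f \<circ> c) 0 else 0)"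

definition tangent_space ::
  "('m::topological_space, 'e::euclidean_space) atlas \<Rightarrow> 'm \<Rightarrow> 'm tv set" where
  "tangent_space A p = {velocity A c | c. smooth_at std_atlas A c 0 \<and> c 0 = p}"

definition pushforward ::
  "('n::topological_space, 'e::euclidean_space) atlas \<Rightarrow> ('m \<Rightarrow> 'n) \<Rightarrow> 'm \<Rightarrow> 'm tv \<Rightarrow> 'n tv" where
  "pushforward B F p X = (\<lambda>g. if smooth_at B std_atlas g (F p) then X (g \<circ> F) else 0)"

definition tv_comb :: "nat \<Rightarrow> (nat \<Rightarrow> real) \<Rightarrow> (nat \<Rightarrow> 'm tv) \<Rightarrow> 'm tv" where
  "tv_comb n c X = (\<lambda>f. \<Sum>i<n. c i * X i f)"

definition tv_span :: "'m tv set \<Rightarrow> 'm tv set" where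
  "tv_span S = {tv_comb n c X | n c X. \<forall>i<n. X i \<in> S}"

definition tv_basis :: "nat \<Rightarrow> (nat \<Rightarrow> 'm tv) \<Rightarrow> 'm tv set \<Rightarrow> bool" where
  "tv_basis n X W \<longleftrightarrow> W = {tv_comb n c X | c. True} \<and>
     (\<forall>c. tv_comb n c X = (\<lambda>f. 0) \<longrightarrow> (\<forall>i<n. c i = 0))"

definition smooth_vector_field_on ::
  "('m::topological_space, 'e::euclidean_space) atlas \<Rightarrow> 'm set \<Rightarrow> ('m \<Rightarrow> 'm tv) \<Rightarrow> bool" where
  "smooth_vector_field_on A N X \<longleftrightarrow> open N \<and>
     (\<forall>y\<in>N. X y \<in> tangent_space A y \<and>
        (\<forall>f. smooth_at A std_atlas f y \<longrightarrow> smooth_at A std_atlas (\<lambda>z. X z f) y))"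

definition lie_bracket ::
  "('m::topological_space, 'e::euclidean_space) atlas \<Rightarrow> ('m \<Rightarrow> 'm tv) \<Rightarrow> ('m \<Rightarrow> 'm tv) \<Rightarrow> 'm \<Rightarrow> 'm tv" where
  "lie_bracket A X Y p =
     (\<lambda>f. if smooth_at A std_atlas f p then X p (\<lambda>y. Y y f) - Y p (\<lambda>y. X y f) else 0)"


section \<open>Oriented (2,3,5) distributions\<close>

definition local_section ::
  "('m::topological_space, 'e::euclidean_space) atlas \<Rightarrow> ('m \<Rightarrow> 'm tv set) \<Rightarrow> 'm set \<Rightarrow>
   ('m \<Rightarrow> 'm tv) \<Rightarrow> bool" where
  "local_section A D N X \<longleftrightarrow> smooth_vector_field_on A N X \<and> (\<forall>y\<in>N. X y \<in> D y)"

definition subbundle ::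
  "('m::topological_space, 'e::euclidean_space) atlas \<Rightarrow> nat \<Rightarrow> ('m \<Rightarrow> 'm tv set) \<Rightarrow> bool" where
  "subbundle A k D \<longleftrightarrow>
     (\<forall>p. \<exists>N X. p \<in> N \<and> (\<forall>i<k. local_section A D N (X i)) \<and>
        (\<forall>y\<in>N. tv_basis k (\<lambda>i. X i y) (D y)))"

text \<open>Since [X, fY] = f[X,Y] + (Xf)Y, the span of the brackets of local sections of \<open>D\<close> and \<open>E\<close>
  at \<open>p\<close> contains the fibre of \<open>E\<close> as soon as \<open>D\<close> is nonzero at \<open>p\<close>.\<close>

definition bracket_distribution ::
  "('m::topological_space, 'e::euclidean_space) atlas \<Rightarrow> ('m \<Rightarrow> 'm tv set) \<Rightarrow> ('m \<Rightarrow> 'm tv set) \<Rightarrow>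
   'm \<Rightarrow> 'm tv set" where
  "bracket_distribution A D E p =
     tv_span {lie_bracket A X Y p | X Y N. p \<in> N \<and> local_section A D N X \<and> local_section A E N Y}"

abbreviation derived_distribution where
  "derived_distribution A D \<equiv> bracket_distribution A D D"

definition distribution_235 ::
  "('m::topological_space, real^5) atlas \<Rightarrow> ('m \<Rightarrow> 'm tv set) \<Rightarrow> bool" where
  "distribution_235 A D \<longleftrightarrow>
     subbundle A 2 D \<and>
     subbundle A 3 (derived_distribution A D) \<and>
     (\<forall>p. bracket_distribution A D (derived_distribution A D) p = tangent_space A p)"

text \<open>An orientation of a rank 2 bundle: \<open>pos p e1 e2\<close> says that \<open>(e1, e2)\<close> is a positively
  oriented basis of the fibre at \<open>p\<close>.\<close>

definition orientation_of ::
  "('m::topological_space, 'e::euclidean_space) atlas \<Rightarrow> ('m \<Rightarrow> 'm tv set) \<Rightarrow>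
   ('m \<Rightarrow> 'm tv \<Rightarrow> 'm tv \<Rightarrow> bool) \<Rightarrow> bool" where
  "orientation_of A D pos \<longleftrightarrow>
     (\<forall>p e1 e2. pos p e1 e2 \<longrightarrow> tv_basis 2 (\<lambda>i. if i = 0 then e1 else e2) (D p)) \<and>
     (\<forall>p e1 e2. tv_basis 2 (\<lambda>i. if i = 0 then e1 else e2) (D p) \<longrightarrow>
        pos p e1 e2 \<noteq> pos p e2 e1) \<and>
     (\<forall>p e1 e2 a b c d. pos p e1 e2 \<longrightarrow> a * d - b * c > 0 \<longrightarrow>
        pos p (\<lambda>f. a * e1 f + b * e2 f) (\<lambda>f. c * e1 f + d * e2 f)) \<and>
     (\<forall>p. \<exists>N X Y. p \<in> N \<and> local_section A D N X \<and> local_section A D N Y \<and>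
        (\<forall>y\<in>N. pos y (X y) (Y y)))"

definition oriented_distribution_235 ::
  "('m::topological_space, real^5) atlas \<Rightarrow> ('m \<Rightarrow> 'm tv set) \<Rightarrow>
   ('m \<Rightarrow> 'm tv \<Rightarrow> 'm tv \<Rightarrow> bool) \<Rightarrow> bool" where
  "oriented_distribution_235 A D pos \<longleftrightarrow> distribution_235 A D \<and> orientation_of A D pos"

text \<open>A nowhere vanishing section of [D,D]/D. The elements of the fibres are cosets.\<close>

definition is_scale ::
  "('m::topological_space, real^5) atlas \<Rightarrow> ('m \<Rightarrow> 'm tv set) \<Rightarrow> ('m \<Rightarrow> 'm tv set) \<Rightarrow> bool" where
  "is_scale A D \<theta> \<longleftrightarrow>
     (\<forall>p. \<exists>\<zeta>\<in>derived_distribution A D p - D p. \<theta> p = {\<lambda>f. \<zeta> f + \<delta> f | \<delta>. \<delta> \<in> D p}) \<and>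
     (\<forall>p. \<exists>N Z. p \<in> N \<and> smooth_vector_field_on A N Z \<and> (\<forall>y\<in>N. Z y \<in> \<theta> y))"


section \<open>The split Lie algebra and its grading\<close>

type_synonym mat7 = "real^7^7"

text \<open>The block entries are expanded with J = (0, -1; 1, 0): for instance \<open>J Z\<^sup>T = (-Z\<^sub>2, Z\<^sub>1)\<^sup>T\<close> and
  \<open>X\<^sup>T J = (X\<^sub>2, -X\<^sub>1)\<close>.\<close>

definition g2_mat ::
  "real^2^2 \<Rightarrow> real^2 \<Rightarrow> real \<Rightarrow> real^2 \<Rightarrow> real^2 \<Rightarrow> real \<Rightarrow> real^2 \<Rightarrow> mat7" where
  "g2_mat A X r Y Z s W = vector [
     vector [- trace A, Z$1, Z$2, s, W$1, W$2, 0],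
     vector [X$1, A$1$1 - trace A, A$1$2, - sqrt 2 * Z$2, 0, - (s / sqrt 2), - W$1],
     vector [X$2, A$2$1, A$2$2 - trace A, sqrt 2 * Z$1, s / sqrt 2, 0, - W$2],
     vector [r, - sqrt 2 * X$2, sqrt 2 * X$1, 0, - sqrt 2 * Z$2, sqrt 2 * Z$1, s],
     vector [Y$1, 0, r / sqrt 2, - sqrt 2 * X$2, trace A - A$1$1, - A$2$1, - Z$1],
     vector [Y$2, - (r / sqrt 2), 0, sqrt 2 * X$1, - A$1$2, trace A - A$2$2, - Z$2],
     vector [0, - Y$1, - Y$2, r, - X$1, - X$2, trace A]]"

definition g2_algebra :: "mat7 set" where
  "g2_algebra = {g2_mat A X r Y Z s W | A X r Y Z s W. True}"

definition part_A :: "mat7 \<Rightarrow> real^2^2" where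
  "part_A M = vector [vector [M$2$2 - M$1$1, M$2$3], vector [M$3$2, M$3$3 - M$1$1]]"
definition part_X :: "mat7 \<Rightarrow> real^2" where "part_X M = vector [M$2$1, M$3$1]"
definition part_r :: "mat7 \<Rightarrow> real" where "part_r M = M$4$1"
definition part_Y :: "mat7 \<Rightarrow> real^2" where "part_Y M = vector [M$5$1, M$6$1]"
definition part_Z :: "mat7 \<Rightarrow> real^2" where "part_Z M = vector [M$1$2, M$1$3]"
definition part_s :: "mat7 \<Rightarrow> real" where "part_s M = M$1$4"
definition part_W :: "mat7 \<Rightarrow> real^2" where "part_W M = vector [M$1$5, M$1$6]"

definition proj_minus :: "mat7 \<Rightarrow> mat7" where
  "proj_minus M = g2_mat 0 (part_X M) (part_r M) (part_Y M) 0 0 0"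
definition proj_zero :: "mat7 \<Rightarrow> mat7" where
  "proj_zero M = g2_mat (part_A M) 0 0 0 0 0 0"

definition g2_grade :: "int \<Rightarrow> mat7 set" where
  "g2_grade i = {g2_mat A X r Y Z s W | A X r Y Z s W.
     (i \<noteq> -3 \<longrightarrow> Y = 0) \<and> (i \<noteq> -2 \<longrightarrow> r = 0) \<and> (i \<noteq> -1 \<longrightarrow> X = 0) \<and> (i \<noteq> 0 \<longrightarrow> A = 0) \<and>
     (i \<noteq> 1 \<longrightarrow> Z = 0) \<and> (i \<noteq> 2 \<longrightarrow> s = 0) \<and> (i \<noteq> 3 \<longrightarrow> W = 0)}"

definition g2_filtration :: "int \<Rightarrow> mat7 set" where
  "g2_filtration i = {g2_mat A X r Y Z s W | A X r Y Z s W.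
     (i > -3 \<longrightarrow> Y = 0) \<and> (i > -2 \<longrightarrow> r = 0) \<and> (i > -1 \<longrightarrow> X = 0) \<and> (i > 0 \<longrightarrow> A = 0) \<and>
     (i > 1 \<longrightarrow> Z = 0) \<and> (i > 2 \<longrightarrow> s = 0) \<and> (i > 3 \<longrightarrow> W = 0)}"

definition g2_minus :: "mat7 set" where
  "g2_minus = {g2_mat 0 X r Y 0 0 0 | X r Y. True}"

abbreviation "p_algebra \<equiv> g2_filtration 0"
abbreviation "g2_plus \<equiv> g2_filtration 1"

definition lie_mat :: "mat7 \<Rightarrow> mat7 \<Rightarrow> mat7" where
  "lie_mat M N = M ** N - N ** M"

definition matrix_exp :: "mat7 \<Rightarrow> mat7" where
  "matrix_exp M = (\<Sum>n. (1 / fact n) *\<^sub>R (((**) M ^^ n) (mat 1)))"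

definition Ad :: "mat7 \<Rightarrow> mat7 \<Rightarrow> mat7" where
  "Ad g M = g ** M ** matrix_inv g"


section \<open>The group of automorphisms of the split octonions, and its subgroups\<close>

text \<open>Split octonions as Zorn vector matrices \<open>(a, x; y, b)\<close>.\<close>

type_synonym split_octonion = "real \<times> (real^3) \<times> (real^3) \<times> real"

fun oct_mult :: "split_octonion \<Rightarrow> split_octonion \<Rightarrow> split_octonion" where
  "oct_mult (a, x, y, b) (a', x', y', b') =
     (a * a' + x \<bullet> y',
      a *\<^sub>R x' + b' *\<^sub>R x + cross3 y y',
      a' *\<^sub>R y + b *\<^sub>R y' - cross3 x x',
      b * b' + y \<bullet> x')"

definition oct_automorphism :: "(split_octonion \<Rightarrow> split_octonion) \<Rightarrow> bool" where
  "oct_automorphism \<Phi> \<longleftrightarrow> linear \<Phi> \<and> bij \<Phi> \<and> (\<forall>a b. \<Phi> (oct_mult a b) = oct_mult (\<Phi> a) (\<Phi> b))"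

text \<open>The identification of the 7-dimensional representation with the imaginary (trace-free)
  split octonions under which \<open>g2_algebra\<close> becomes the algebra of derivations.\<close>

definition imag_oct :: "real^7 \<Rightarrow> split_octonion" where
  "imag_oct t = (- (t$4) / sqrt 2, vector [t$2, t$3, t$7], vector [- (t$5), - (t$6), - (t$1)],
     t$4 / sqrt 2)"

definition G2_group :: "mat7 set" where
  "G2_group = {g. \<exists>\<Phi>. oct_automorphism \<Phi> \<and> (\<forall>v. \<Phi> (imag_oct v) = imag_oct (g *v v))}"

definition P_group :: "mat7 set" where
  "P_group = {g \<in> G2_group. \<exists>c>0. g *v axis 1 1 = c *\<^sub>R axis 1 1}"

definition G0_group :: "mat7 set" where
  "G0_group = {g \<in> P_group. \<forall>i. Ad g ` g2_grade i = g2_grade i}"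

definition P_plus :: "mat7 set" where
  "P_plus = matrix_exp ` g2_plus"


section \<open>Parabolic geometries\<close>

text \<open>The data: the base \<open>M\<close> with its atlas, the total space of a principal \<open>P\<close>-bundle over \<open>M\<close>
  with its Cartan connection form, and the quotient by \<open>P\<^sub>+\<close>.\<close>

record ('m, 'g, 'h) geometry =
  atlasM :: "('m, real^5) atlas"
  atlasG :: "('g, real^14) atlas"
  proj :: "'g \<Rightarrow> 'm"
  act :: "'g \<Rightarrow> mat7 \<Rightarrow> 'g"
  cartan :: "'g \<Rightarrow> 'g tv \<Rightarrow> mat7"
  atlasG0 :: "('h, real^9) atlas"
  quot :: "'g \<Rightarrow> 'h"
  proj0 :: "'h \<Rightarrow> 'm"
  act0 :: "'h \<Rightarrow> mat7 \<Rightarrow> 'h"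

text \<open>In the local triviality clause, \<open>u \<mapsto> (\<pi> u, \<psi> u)\<close> and \<open>(y, h) \<mapsto> \<sigma>(y) h\<close> are mutually inverse.\<close>

definition principal_bundle ::
  "('m::topological_space, 'd::euclidean_space) atlas \<Rightarrow>
   ('g::topological_space, 'e::euclidean_space) atlas \<Rightarrow>
   mat7 set \<Rightarrow> ('g \<Rightarrow> 'm) \<Rightarrow> ('g \<Rightarrow> mat7 \<Rightarrow> 'g) \<Rightarrow> bool" where
  "principal_bundle AM AG H \<pi> R \<longleftrightarrow>
     smooth_map AG AM \<pi> \<and>
     (\<forall>u. R u (mat 1) = u) \<and>
     (\<forall>u. \<forall>g\<in>H. \<forall>h\<in>H. R (R u g) h = R u (g ** h)) \<and>
     (\<forall>u. \<forall>g\<in>H. \<pi> (R u g) = \<pi> u) \<and>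
     smooth_map_on_subset (prod_atlas AG std_atlas) AG (UNIV \<times> H) (\<lambda>(u, g). R u g) \<and>
     (\<forall>x. \<exists>N \<sigma> \<psi>. open N \<and> x \<in> N \<and>
        (\<forall>y\<in>N. \<pi> (\<sigma> y) = y \<and> smooth_at AM AG \<sigma> y) \<and>
        (\<forall>u. \<pi> u \<in> N \<longrightarrow> \<psi> u \<in> H \<and> smooth_at AG std_atlas \<psi> u \<and> R (\<sigma> (\<pi> u)) (\<psi> u) = u) \<and>
        (\<forall>y\<in>N. \<forall>h\<in>H. \<psi> (R (\<sigma> y) h) = h))"

definition fundamental_vector ::
  "('g::topological_space, 'e::euclidean_space) atlas \<Rightarrow> ('g \<Rightarrow> mat7 \<Rightarrow> 'g) \<Rightarrow> mat7 \<Rightarrow> 'g \<Rightarrow> 'g tv" where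
  "fundamental_vector AG R B u = velocity AG (\<lambda>t. R u (matrix_exp (t *\<^sub>R B)))"

definition cartan_connection ::
  "('m::topological_space, 'g::topological_space, 'h) geometry \<Rightarrow> bool" where
  "cartan_connection G \<longleftrightarrow>
     (\<forall>u. bij_betw (cartan G u) (tangent_space (atlasG G) u) g2_algebra) \<and>
     (\<forall>u a b. \<forall>X\<in>tangent_space (atlasG G) u. \<forall>Y\<in>tangent_space (atlasG G) u.
        cartan G u (\<lambda>f. a * X f + b * Y f) = a *\<^sub>R cartan G u X + b *\<^sub>R cartan G u Y) \<and>
     (\<forall>N X. smooth_vector_field_on (atlasG G) N X \<longrightarrow>
        (\<forall>u\<in>N. smooth_at (atlasG G) std_atlas (\<lambda>v. cartan G v (X v)) u)) \<and>
     (\<forall>u. \<forall>g\<in>P_group. \<forall>X\<in>tangent_space (atlasG G) u.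
        cartan G (act G u g) (pushforward (atlasG G) (\<lambda>v. act G v g) u X)
          = Ad (matrix_inv g) (cartan G u X)) \<and>
     (\<forall>u. \<forall>B\<in>p_algebra. cartan G u (fundamental_vector (atlasG G) (act G) B u) = B)"

definition parabolic_geometry ::
  "('m::{t2_space,second_countable_topology}, 'g::{t2_space,second_countable_topology}, 'h) geometry \<Rightarrow> bool" where
  "parabolic_geometry G \<longleftrightarrow>
     smooth_atlas (atlasM G) \<and> smooth_atlas (atlasG G) \<and>
     principal_bundle (atlasM G) (atlasG G) P_group (proj G) (act G) \<and>
     cartan_connection G"

definition constant_field ::
  "('m, 'g::topological_space, 'h) geometry \<Rightarrow> mat7 \<Rightarrow> 'g \<Rightarrow> 'g tv" where
  "constant_field G B u = inv_into (tangent_space (atlasG G) u) (cartan G u) B"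

text \<open>The curvature form d\<omega>(\<xi>,\<eta>) + [\<omega>(\<xi>),\<omega>(\<eta>)], evaluated on constant fields.\<close>

definition curvature ::
  "('m, 'g::topological_space, 'h) geometry \<Rightarrow> 'g \<Rightarrow> mat7 \<Rightarrow> mat7 \<Rightarrow> mat7" where
  "curvature G u B C =
     lie_mat B C - cartan G u (lie_bracket (atlasG G) (constant_field G B) (constant_field G C) u)"

definition regular_geometry :: "('m, 'g::topological_space, 'h) geometry \<Rightarrow> bool" where
  "regular_geometry G \<longleftrightarrow> (\<forall>u. \<forall>i<0. \<forall>j<0. \<forall>B\<in>g2_filtration i. \<forall>C\<in>g2_filtration j.
     curvature G u B C \<in> g2_filtration (i + j + 1))"

text \<open>Vanishing of the Kostant codifferential of the curvature function, written with a basis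
  \<open>E\<close> of \<open>g\<^sub>-\<close> and the dual basis \<open>F\<close> of \<open>g\<^sub>+\<close>. The duality is taken with respect to the trace form
  of the 7-dimensional representation, a nonzero multiple of the Killing form; the multiple only
  rescales the whole expression.\<close>

definition normal_geometry :: "('m, 'g::topological_space, 'h) geometry \<Rightarrow> bool" where
  "normal_geometry G \<longleftrightarrow>
     (\<forall>E F :: nat \<Rightarrow> mat7.
        (\<forall>a<5. E a \<in> g2_minus \<and> F a \<in> g2_plus) \<and>
        (\<forall>a<5. \<forall>b<5. trace (F a ** E b) = (if a = b then 1 else 0)) \<longrightarrow>
        (\<forall>u. \<forall>B\<in>g2_minus.
           (\<Sum>a<5. lie_mat (F a) (curvature G u B (E a)))
           - (1/2) *\<^sub>R (\<Sum>a<5. curvature G u (proj_minus (lie_mat (F a) B)) (E a)) = 0))"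

text \<open>The underlying oriented rank 2 distribution. By the equivalence between oriented (2,3,5)
  distributions and regular normal geometries, the geometry with this property is unique up to
  isomorphism.\<close>

definition induces_distribution ::
  "('m::topological_space, 'g::topological_space, 'h) geometry \<Rightarrow> ('m \<Rightarrow> 'm tv set) \<Rightarrow>
   ('m \<Rightarrow> 'm tv \<Rightarrow> 'm tv \<Rightarrow> bool) \<Rightarrow> bool" where
  "induces_distribution G D pos \<longleftrightarrow>
     (\<forall>u. D (proj G u) = {pushforward (atlasM G) (proj G) u X | X.
        X \<in> tangent_space (atlasG G) u \<and> cartan G u X \<in> g2_filtration (-1)}) \<and>
     (\<forall>u. pos (proj G u)
        (pushforward (atlasM G) (proj G) u (constant_field G (g2_mat 0 (axis 1 1) 0 0 0 0 0) u))
        (pushforward (atlasM G) (proj G) u (constant_field G (g2_mat 0 (axis 2 1) 0 0 0 0 0) u)))"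

text \<open>The quotient manifold by \<open>P\<^sub>+\<close>, with the induced projection and \<open>G\<^sub>0\<close>-action. A surjective
  submersion with the orbits as fibres determines the quotient up to diffeomorphism.\<close>

definition quotient_by_P_plus ::
  "('m::topological_space, 'g::topological_space, 'h::{t2_space,second_countable_topology}) geometry \<Rightarrow> bool" where
  "quotient_by_P_plus G \<longleftrightarrow>
     smooth_atlas (atlasG0 G) \<and> smooth_map (atlasG G) (atlasG0 G) (quot G) \<and> surj (quot G) \<and>
     (\<forall>u. pushforward (atlasG0 G) (quot G) u ` tangent_space (atlasG G) u
        = tangent_space (atlasG0 G) (quot G u)) \<and>
     (\<forall>u v. quot G u = quot G v \<longleftrightarrow> (\<exists>g\<in>P_plus. v = act G u g)) \<and>
     (\<forall>u. proj0 G (quot G u) = proj G u) \<and>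
     (\<forall>u. \<forall>g\<in>G0_group. act0 G (quot G u) g = quot G (act G u g))"

definition canonical_geometry ::
  "('m::{t2_space,second_countable_topology}, 'g::{t2_space,second_countable_topology},
    'h::{t2_space,second_countable_topology}) geometry \<Rightarrow> ('m \<Rightarrow> 'm tv set) \<Rightarrow>
   ('m \<Rightarrow> 'm tv \<Rightarrow> 'm tv \<Rightarrow> bool) \<Rightarrow> bool" where
  "canonical_geometry G D pos \<longleftrightarrow>
     parabolic_geometry G \<and> regular_geometry G \<and> normal_geometry G \<and> induces_distribution G D pos \<and>
     quotient_by_P_plus G"


section \<open>The tractor bundle and its connection\<close>

text \<open>Sections of bundles associated to a principal bundle are written as equivariant functions on
  its total space.\<close>

definition tractor_section ::
  "('m, 'g::topological_space, 'h) geometry \<Rightarrow> ('g \<Rightarrow> real^7) \<Rightarrow> bool" where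
  "tractor_section G t \<longleftrightarrow> smooth_map (atlasG G) std_atlas t \<and>
     (\<forall>u. \<forall>g\<in>P_group. t (act G u g) = matrix_inv g *v t u)"

definition tangent_lift ::
  "('m::topological_space, 'g::topological_space, 'h) geometry \<Rightarrow> 'g \<Rightarrow> 'm tv \<Rightarrow> 'g tv" where
  "tangent_lift G u \<xi> = (SOME \<eta>. \<eta> \<in> tangent_space (atlasG G) u \<and> pushforward (atlasM G) (proj G) u \<eta> = \<xi>)"

text \<open>\<open>\<eta> \<cdot> t + \<omega>(\<eta>) t\<close> does not depend on the choice of the lift \<open>\<eta>\<close> of \<open>\<xi>\<close>.\<close>

definition tractor_nabla ::
  "('m::topological_space, 'g::topological_space, 'h) geometry \<Rightarrow> 'm tv \<Rightarrow> ('g \<Rightarrow> real^7) \<Rightarrow> 'g \<Rightarrow> real^7" where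
  "tractor_nabla G \<xi> t u =
     (let \<eta> = tangent_lift G u \<xi> in (\<chi> i. \<eta> (\<lambda>v. t v $ i)) + cartan G u \<eta> *v t u)"

definition t_chi :: "real^7 \<Rightarrow> real" where "t_chi v = v$1"
definition t_phi :: "real^7 \<Rightarrow> real^2" where "t_phi v = vector [v$2, v$3]"
definition t_ups :: "real^7 \<Rightarrow> real" where "t_ups v = v$4"
definition t_tau :: "real^7 \<Rightarrow> real^2" where "t_tau v = vector [v$5, v$6]"
definition t_sig :: "real^7 \<Rightarrow> real" where "t_sig v = v$7"


section \<open>The Levi bracket\<close>

text \<open>Components of vectors in \<open>D\<close> and of classes in [D,D]/D with respect to \<open>w\<close>, a point of the
  \<open>G\<^sub>0\<close>-bundle. They depend neither on the chosen point over \<open>w\<close> nor on the lift.\<close>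

definition gr1_coord ::
  "('m::topological_space, 'g::topological_space, 'h) geometry \<Rightarrow> 'h \<Rightarrow> 'm tv \<Rightarrow> real^2" where
  "gr1_coord G w \<xi> = (let u = (SOME u. quot G u = w) in part_X (cartan G u (tangent_lift G u \<xi>)))"

definition gr2_coord ::
  "('m::topological_space, 'g::topological_space, 'h) geometry \<Rightarrow> 'h \<Rightarrow> 'm tv \<Rightarrow> real" where
  "gr2_coord G w \<xi> = (let u = (SOME u. quot G u = w) in part_r (cartan G u (tangent_lift G u \<xi>)))"

definition levi ::
  "('m::topological_space, 'g::topological_space, 'h) geometry \<Rightarrow> ('m \<Rightarrow> 'm tv set) \<Rightarrow> 'h \<Rightarrow> real^2^2" where
  "levi G D w = (\<chi> \<alpha> \<beta>. THE r. \<exists>N \<xi> \<eta>. proj0 G w \<in> N \<and>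
     local_section (atlasM G) D N \<xi> \<and> local_section (atlasM G) D N \<eta> \<and>
     gr1_coord G w (\<xi> (proj0 G w)) = axis \<alpha> 1 \<and> gr1_coord G w (\<eta> (proj0 G w)) = axis \<beta> 1 \<and>
     r = gr2_coord G w (lie_bracket (atlasM G) \<xi> \<eta> (proj0 G w)))"

definition levi_inv ::
  "('m::topological_space, 'g::topological_space, 'h) geometry \<Rightarrow> ('m \<Rightarrow> 'm tv set) \<Rightarrow> 'h \<Rightarrow> real^2^2" where
  "levi_inv G D w = (THE K. \<forall>\<alpha> \<beta>. (\<Sum>\<gamma>\<in>UNIV. K$\<gamma>$\<alpha> * levi G D w$\<gamma>$\<beta>) = (if \<alpha> = \<beta> then 1 else 0))"


section \<open>Weyl structures\<close>

definition weyl_structure ::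
  "('m, 'g::topological_space, 'h::topological_space) geometry \<Rightarrow> ('h \<Rightarrow> 'g) \<Rightarrow> bool" where
  "weyl_structure G s \<longleftrightarrow> smooth_map (atlasG0 G) (atlasG G) s \<and>
     (\<forall>w. quot G (s w) = w) \<and>
     (\<forall>w. \<forall>g\<in>G0_group. s (act0 G w g) = act G (s w) g)"

definition pullback_cartan ::
  "('m, 'g::topological_space, 'h) geometry \<Rightarrow> ('h \<Rightarrow> 'g) \<Rightarrow> 'h \<Rightarrow> 'h tv \<Rightarrow> mat7" where
  "pullback_cartan G s w \<eta> = cartan G (s w) (pushforward (atlasG G) s w \<eta>)"

text \<open>The horizontal lift with respect to the principal connection s*\<omega>_0.\<close>

definition weyl_lift ::
  "('m::topological_space, 'g::topological_space, 'h::topological_space) geometry \<Rightarrow> ('h \<Rightarrow> 'g) \<Rightarrow>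
   'h \<Rightarrow> 'm tv \<Rightarrow> 'h tv" where
  "weyl_lift G s w \<xi> = (SOME \<eta>. \<eta> \<in> tangent_space (atlasG0 G) w \<and>
     pushforward (atlasM G) (proj0 G) w \<eta> = \<xi> \<and> proj_zero (pullback_cartan G s w \<eta>) = 0)"

text \<open>The forms s*\<omega>_- and s*\<omega>_+ vanish on vertical vectors, so they descend to \<open>M\<close> and
  may be evaluated on horizontal lifts. The following is s*\<omega>_- + s*\<omega>_+ as a form on \<open>M\<close>: its
  \<open>g\<^sub>-\<close> part is the isomorphism \<open>TM \<cong> gr(TM)\<close> and its \<open>g\<^sub>+\<close> part is the Rho tensor.\<close>

definition weyl_form ::
  "('m::topological_space, 'g::topological_space, 'h::topological_space) geometry \<Rightarrow> ('h \<Rightarrow> 'g) \<Rightarrow>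
   'h \<Rightarrow> 'm tv \<Rightarrow> mat7" where
  "weyl_form G s w \<xi> = pullback_cartan G s w (weyl_lift G s w \<xi>)"

text \<open>The tangent vector whose components with respect to \<open>s\<close> and \<open>w\<close> are those of \<open>B \<in> g\<^sub>-\<close>.\<close>

definition weyl_frame ::
  "('m::topological_space, 'g::topological_space, 'h::topological_space) geometry \<Rightarrow> ('h \<Rightarrow> 'g) \<Rightarrow>
   'h \<Rightarrow> mat7 \<Rightarrow> 'm tv" where
  "weyl_frame G s w B = (SOME \<xi>. \<xi> \<in> tangent_space (atlasM G) (proj0 G w) \<and>
     proj_minus (weyl_form G s w \<xi>) = B)"

text \<open>The Weyl connection on any bundle associated to the \<open>G\<^sub>0\<close>-bundle: the derivative of (a
  component of) the equivariant function along the horizontal lift.\<close>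

definition weyl_nabla ::
  "('m::topological_space, 'g::topological_space, 'h::topological_space) geometry \<Rightarrow> ('h \<Rightarrow> 'g) \<Rightarrow>
   'm tv \<Rightarrow> ('h \<Rightarrow> real) \<Rightarrow> 'h \<Rightarrow> real" where
  "weyl_nabla G s \<xi> f w = weyl_lift G s w \<xi> f"

definition scale_function ::
  "('m::topological_space, 'g::topological_space, 'h) geometry \<Rightarrow> ('m \<Rightarrow> 'm tv set) \<Rightarrow> 'h \<Rightarrow> real" where
  "scale_function G \<theta> w = gr2_coord G w (SOME \<zeta>. \<zeta> \<in> \<theta> (proj0 G w))"

definition weyl_structure_of_scale ::
  "('m::topological_space, 'g::topological_space, 'h::topological_space) geometry \<Rightarrow>
   ('m \<Rightarrow> 'm tv set) \<Rightarrow> ('h \<Rightarrow> 'g) \<Rightarrow> bool" where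
  "weyl_structure_of_scale G \<theta> s \<longleftrightarrow> weyl_structure G s \<and>
     (\<forall>w. \<forall>\<xi>\<in>tangent_space (atlasM G) (proj0 G w). weyl_nabla G s \<xi> (scale_function G \<theta>) w = 0)"

definition gr_cotangent_section ::
  "('m, 'g, 'h::topological_space) geometry \<Rightarrow> int \<Rightarrow> ('h \<Rightarrow> mat7) \<Rightarrow> bool" where
  "gr_cotangent_section G i \<Upsilon> \<longleftrightarrow> smooth_map (atlasG0 G) std_atlas \<Upsilon> \<and>
     (\<forall>w. \<Upsilon> w \<in> g2_grade i) \<and>
     (\<forall>w. \<forall>g\<in>G0_group. \<Upsilon> (act0 G w g) = Ad (matrix_inv g) (\<Upsilon> w))"

text \<open>The elements of \<open>g\<^sub>-\<close> corresponding to a lower index \<open>\<beta>\<close>, the diamond, and an upper index \<open>\<beta>\<close>.\<close>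

definition dlow :: "2 \<Rightarrow> mat7" where "dlow \<beta> = g2_mat 0 (axis \<beta> 1) 0 0 0 0 0"
definition ddia :: mat7 where "ddia = g2_mat 0 0 1 0 0 0 0"
definition dup :: "2 \<Rightarrow> mat7" where "dup \<beta> = g2_mat 0 0 0 (axis \<beta> 1) 0 0 0"

definition nabla_dir ::
  "('m::topological_space, 'g::topological_space, 'h::topological_space) geometry \<Rightarrow> ('h \<Rightarrow> 'g) \<Rightarrow>
   mat7 \<Rightarrow> ('h \<Rightarrow> real) \<Rightarrow> 'h \<Rightarrow> real" where
  "nabla_dir G s B f w = weyl_nabla G s (weyl_frame G s w B) f w"

definition tractor_nabla_dir ::
  "('m::topological_space, 'g::topological_space, 'h::topological_space) geometry \<Rightarrow> ('h \<Rightarrow> 'g) \<Rightarrow>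
   mat7 \<Rightarrow> ('g \<Rightarrow> real^7) \<Rightarrow> 'h \<Rightarrow> real^7" where
  "tractor_nabla_dir G s B t w = tractor_nabla G (weyl_frame G s w B) t (s w)"

text \<open>The components of the Rho tensor: \<open>rho_Z G s w (dlow \<alpha>) $ \<beta>\<close> is \<open>P\<^sub>\<alpha>\<^sub>\<beta>\<close>,
  \<open>rho_s G s w (dlow \<alpha>)\<close> is \<open>P\<^sub>\<alpha>\<^sub>\<diamond>\<close>, \<open>rho_W G s w (dlow \<alpha>) $ \<beta>\<close> is \<open>P\<^sub>\<alpha>\<^sup>\<beta>\<close>, and similarly for the
  directions \<open>ddia\<close> and \<open>dup \<alpha>\<close>.\<close>

definition rho_Z ::
  "('m::topological_space, 'g::topological_space, 'h::topological_space) geometry \<Rightarrow> ('h \<Rightarrow> 'g) \<Rightarrow>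
   'h \<Rightarrow> mat7 \<Rightarrow> real^2" where
  "rho_Z G s w B = part_Z (weyl_form G s w (weyl_frame G s w B))"

definition rho_s ::
  "('m::topological_space, 'g::topological_space, 'h::topological_space) geometry \<Rightarrow> ('h \<Rightarrow> 'g) \<Rightarrow>
   'h \<Rightarrow> mat7 \<Rightarrow> real" where
  "rho_s G s w B = part_s (weyl_form G s w (weyl_frame G s w B))"

definition rho_W ::
  "('m::topological_space, 'g::topological_space, 'h::topological_space) geometry \<Rightarrow> ('h \<Rightarrow> 'g) \<Rightarrow>
   'h \<Rightarrow> mat7 \<Rightarrow> real^2" where
  "rho_W G s w B = part_W (weyl_form G s w (weyl_frame G s w B))"

end

theory Submission
  imports Defs
begin

text \<open>
  Up to three facts about the geometry, both parts are matrix identities.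

  For the change of splitting, a section of the tractor bundle is a \<open>P\<close>-equivariant function, so
  passing from \<open>s\<close> to \<open>s exp \<Upsilon>1 exp \<Upsilon>2 exp \<Upsilon>3\<close> multiplies its value by
  \<open>exp (-\<Upsilon>3) exp (-\<Upsilon>2) exp (-\<Upsilon>1)\<close>. On the 7-dimensional representation the exponentials of elements
  of the graded pieces are polynomials of degree at most two (\<open>matrix_exp_grade_1\<close> and its
  companions), and their product is the stated formula.

  For the tractor connection, \<open>\<eta> \<cdot> t + \<omega>(\<eta>) t\<close> may be computed with any lift \<open>\<eta>\<close> of a tangent vector
  of the base. The convenient lift is the image under \<open>s\<close> of the horizontal lift for the Weyl
  connection: then \<open>\<eta> \<cdot> t\<close> is by definition the Weyl derivative of \<open>t \<circ> s\<close>, while \<open>\<omega>(\<eta>)\<close> has no \<open>g\<^sub>0\<close> part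
  and therefore consists of the direction in \<open>g\<^sub>-\<close> and the components of the Rho tensor
  (\<open>tractor_nabla_dir_eq\<close>). Multiplying this matrix with \<open>t\<close> gives the formulas.

  The three facts are these. First, a vector is vertical for \<open>G \<rightarrow> M\<close> exactly if the Cartan connection
  maps it to \<open>p\<close>, and vertical for \<open>G \<rightarrow> G\<^sub>0\<close> exactly if it is mapped to \<open>g\<^sub>+\<close>
  (\<open>projD_kernel\<close>, \<open>quotD_kernel\<close>). One inclusion holds because fundamental vectors are velocities of
  orbits, and the other by counting dimensions. This requires that \<open>exp B\<close> lies in \<open>P\<close> for \<open>B\<close> in \<open>p\<close>,
  which comes from the fact that derivations of the split octonions exponentiate to automorphisms.
  Second, horizontal lifts and frames exist; this follows from the first fact
  (\<open>weyl_lift_spec\<close>, \<open>weyl_frame_spec\<close>). Third, the Levi bracket is the constant matrix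
  \<open>2 sqrt 2 \<epsilon>\<close> (\<open>levi_eq\<close>). To see this, sections of the distribution are lifted to combinations
  \<open>a\<^sub>1 E\<^sub>1 + a\<^sub>2 E\<^sub>2\<close> of constant vector fields on the bundle with smooth coefficients. The bracket of the
  lifts projects to the bracket of the sections; the derivatives of the coefficients only contribute
  combinations of the \<open>E\<^sub>k\<close>, which have no \<open>g\<^sub>-\<^sub>2\<close> part, and regularity says that the curvature does not
  contribute to \<open>g\<^sub>-\<^sub>2\<close> either, so only the bracket of the Lie algebra is left.

  The groundwork is calculus on manifolds in the form of operators on functions: smooth maps can be
  tested in prescribed charts (\<open>smooth_at_chart\<close>), a tangent space is isomorphic to the model space
  (\<open>tangent_space_eq_chart_vec\<close>), and brackets are tangent vectors by the symmetry of second
  derivatives (\<open>lie_bracket_in_tangent_space\<close>).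
\<close>

section \<open>Functions of class C^k on open sets\<close>

lemma Ck_on_cong:
  assumes "open S" "\<And>x. x \<in> S \<Longrightarrow> f x = g x"
  shows "Ck_on k S f \<longleftrightarrow> Ck_on k S g"
proof -
  have imp: "Ck_on k S g" if "\<And>x. x \<in> S \<Longrightarrow> f x = g x" "Ck_on k S f" for f g :: "'a \<Rightarrow> 'b"
    using that
  proof (induction k arbitrary: f g)
    case 0
    then show ?case using continuous_on_cong[of S S f g] by simp
  next
    case (Suc k)
    have D: "(g has_derivative frechet_derivative f (at x)) (at x)" if "x \<in> S" for x
      using has_derivative_transform_within_open[OF _ \<open>open S\<close> that, of f "frechet_derivative f (at x)" UNIV g]
        Suc.prems that frechet_derivative_works by auto
    have E: "frechet_derivative g (at x) = frechet_derivative f (at x)" if "x \<in> S" for x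
      using D[OF that] frechet_derivative_at by metis
    have "Ck_on k S (\<lambda>x. frechet_derivative g (at x) v)" for v
      by (rule Suc.IH[of "\<lambda>x. frechet_derivative f (at x) v"]) (use Suc.prems E in auto)
    then show ?case using D by (auto simp: differentiable_def)
  qed
  show ?thesis using imp[of f g] imp[of g f] assms(2) by auto
qed

lemma Ck_on_subset: "Ck_on k S f \<Longrightarrow> T \<subseteq> S \<Longrightarrow> Ck_on k T f"
  by (induction k arbitrary: f) (auto intro: continuous_on_subset)

lemma Ck_on_SucD: "Ck_on (Suc k) S f \<Longrightarrow> Ck_on k S f"
proof (induction k arbitrary: f)
  case 0
  then show ?case
    by (auto intro!: continuous_at_imp_continuous_on differentiable_imp_continuous_within)
next
  case (Suc k)
  then show ?case by simp
qed

text \<open>It suffices to know some formula for the derivative: the inductive definition speaks of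
  \<open>frechet_derivative\<close>, which agrees with it on the open set.\<close>

lemma Ck_on_SucI:
  assumes "open S" "\<And>x. x \<in> S \<Longrightarrow> (f has_derivative f' x) (at x)" "\<And>v. Ck_on k S (\<lambda>x. f' x v)"
  shows "Ck_on (Suc k) S f"
proof -
  have "frechet_derivative f (at x) = f' x" if "x \<in> S" for x
    using assms(2)[OF that] frechet_derivative_at by metis
  then show ?thesis
    using assms Ck_on_cong[OF assms(1), of "\<lambda>x. frechet_derivative f (at x) _" "\<lambda>x. f' x _"]
    by (auto simp: differentiable_def)
qed

lemma Ck_on_SucE:
  assumes "Ck_on (Suc k) S f"
  shows "x \<in> S \<Longrightarrow> (f has_derivative frechet_derivative f (at x)) (at x)"
    "Ck_on k S (\<lambda>x. frechet_derivative f (at x) v)"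
  using assms frechet_derivative_works by auto

lemma Ck_on_const: "open S \<Longrightarrow> Ck_on k S (\<lambda>x. c)"
proof (induction k arbitrary: c)
  case (Suc k)
  show ?case by (rule Ck_on_SucI[OF Suc.prems has_derivative_const Suc.IH[OF Suc.prems]])
qed simp

lemma Ck_on_linear:
  assumes "open S" "bounded_linear h"
  shows "Ck_on k S h"
proof (cases k)
  case 0
  then show ?thesis using assms by (simp add: linear_continuous_on)
next
  case (Suc j)
  show ?thesis unfolding Suc
    by (rule Ck_on_SucI[OF assms(1) bounded_linear_imp_has_derivative[OF assms(2)] Ck_on_const[OF assms(1)]])
qed

lemma Ck_on_linear_comp:
  assumes "open S" "bounded_linear h"
  shows "Ck_on k S f \<Longrightarrow> Ck_on k S (\<lambda>x. h (f x))"
proof (induction k arbitrary: f)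
  case 0
  then show ?case using assms bounded_linear.continuous_on by auto
next
  case (Suc k)
  show ?case
    by (rule Ck_on_SucI[where f' = "\<lambda>x v. h (frechet_derivative f (at x) v)", OF assms(1)
         bounded_linear.has_derivative[OF assms(2) Ck_on_SucE(1)[OF Suc.prems]]
         Suc.IH[OF Ck_on_SucE(2)[OF Suc.prems]]])
qed

lemma Ck_on_add:
  assumes "open S"
  shows "Ck_on k S f \<Longrightarrow> Ck_on k S g \<Longrightarrow> Ck_on k S (\<lambda>x. f x + g x)"
proof (induction k arbitrary: f g)
  case 0
  then show ?case using continuous_on_add by auto
next
  case (Suc k)
  show ?case
    by (rule Ck_on_SucI[OF assms(1) has_derivative_add[OF Ck_on_SucE(1)[OF Suc.prems(1)] Ck_on_SucE(1)[OF Suc.prems(2)]]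
         Suc.IH[OF Ck_on_SucE(2)[OF Suc.prems(1)] Ck_on_SucE(2)[OF Suc.prems(2)]]])
qed

lemma Ck_on_sum:
  assumes "open S" "\<And>i. i \<in> I \<Longrightarrow> Ck_on k S (f i)"
  shows "Ck_on k S (\<lambda>x. \<Sum>i\<in>I. f i x)"
  using assms(2)
  by (induction I rule: infinite_finite_induct) (auto intro: Ck_on_const Ck_on_add assms(1))

lemma Ck_on_bilinear:
  assumes "open S" "bounded_bilinear h"
  shows "Ck_on k S f \<Longrightarrow> Ck_on k S g \<Longrightarrow> Ck_on k S (\<lambda>x. h (f x) (g x))"
proof (induction k arbitrary: f g)
  case 0
  then show ?case using bounded_bilinear.continuous_on[OF assms(2)] by auto
next
  case (Suc k)
  show ?case
    by (rule Ck_on_SucI[OF assms(1)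
          bounded_bilinear.FDERIV[OF assms(2) Ck_on_SucE(1)[OF Suc.prems(1)] Ck_on_SucE(1)[OF Suc.prems(2)]]
          Ck_on_add[OF assms(1) Suc.IH[OF Ck_on_SucD[OF Suc.prems(1)] Ck_on_SucE(2)[OF Suc.prems(2)]]
            Suc.IH[OF Ck_on_SucE(2)[OF Suc.prems(1)] Ck_on_SucD[OF Suc.prems(2)]]]])
qed

text \<open>Expanding in a basis turns a direction that depends on the point into coefficients that do, so that
  only directional derivatives in fixed directions remain. These are what the definition of C^k
  controls.\<close>

lemma has_derivative_euclidean_expand:
  fixes x :: "'a::euclidean_space"
  assumes "(f has_derivative f') F"
  shows "f' x = (\<Sum>b\<in>Basis. (x \<bullet> b) *\<^sub>R f' b)"
proof -
  interpret linear f' using assms has_derivative_linear by auto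
  have "f' x = f' (\<Sum>b\<in>Basis. (x \<bullet> b) *\<^sub>R b)" by (simp add: euclidean_representation)
  then show ?thesis by (simp add: sum scale)
qed

lemma Ck_on_compose:
  fixes g :: "'b::euclidean_space \<Rightarrow> 'c::real_normed_vector"
  assumes "open S" "open T" "f ` S \<subseteq> T"
  shows "Ck_on k S f \<Longrightarrow> Ck_on k T g \<Longrightarrow> Ck_on k S (\<lambda>x. g (f x))"
proof (induction k arbitrary: g)
  case 0
  then show ?case using assms continuous_on_compose2 by (metis Ck_on.simps(1))
next
  case (Suc k)
  let ?f' = "\<lambda>x. frechet_derivative f (at x)" and ?g' = "\<lambda>x. frechet_derivative g (at x)"
  have fk: "Ck_on k S f" using Suc.prems Ck_on_SucD by blast
  show ?case
  proof (rule Ck_on_SucI[OF assms(1), where f' = "\<lambda>x v. \<Sum>b\<in>Basis. (?f' x v \<bullet> b) *\<^sub>R ?g' (f x) b"])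
    fix x assume x: "x \<in> S"
    have g: "(g has_derivative ?g' (f x)) (at (f x))"
      using Ck_on_SucE(1)[OF Suc.prems(2), of "f x"] x assms(3) by auto
    have "((\<lambda>x. g (f x)) has_derivative (\<lambda>v. ?g' (f x) (?f' x v))) (at x)"
      using diff_chain_at[OF Ck_on_SucE(1)[OF Suc.prems(1) x] g] by (simp add: o_def)
    then show "((\<lambda>x. g (f x)) has_derivative (\<lambda>v. \<Sum>b\<in>Basis. (?f' x v \<bullet> b) *\<^sub>R ?g' (f x) b)) (at x)"
      by (simp only: has_derivative_euclidean_expand[OF g, symmetric])
  next
    fix v
    have "Ck_on k S (\<lambda>x. ?f' x v \<bullet> b)" for b
      by (rule Ck_on_linear_comp[OF assms(1) bounded_linear_inner_left Ck_on_SucE(2)[OF Suc.prems(1)]])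
    moreover have "Ck_on k S (\<lambda>x. ?g' (f x) b)" for b
      using Suc.IH[OF fk Ck_on_SucE(2)[OF Suc.prems(2)]] .
    ultimately show "Ck_on k S (\<lambda>x. \<Sum>b\<in>Basis. (?f' x v \<bullet> b) *\<^sub>R ?g' (f x) b)"
      by (intro Ck_on_sum assms(1) Ck_on_bilinear[OF assms(1) bounded_bilinear_scaleR])
  qed
qed

text \<open>The derivative \<open>- f' / f\<^sup>2\<close> is built from \<open>f'\<close> and the reciprocal itself, so the induction on the order
  of differentiability closes.\<close>

lemma Ck_on_inverse:
  fixes f :: "'a::real_normed_vector \<Rightarrow> real"
  assumes "open S" "\<And>x. x \<in> S \<Longrightarrow> f x \<noteq> 0"
  shows "Ck_on k S f \<Longrightarrow> Ck_on k S (\<lambda>x. inverse (f x))"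
proof (induction k)
  case 0
  then show ?case using assms by (auto intro!: continuous_on_inverse)
next
  case (Suc k)
  have i: "Ck_on k S (\<lambda>x. inverse (f x))" using Suc Ck_on_SucD by blast
  have m: "Ck_on k S (\<lambda>x. g x * h x)" if "Ck_on k S g" "Ck_on k S h" for g h :: "'a \<Rightarrow> real"
    by (rule Ck_on_bilinear[OF assms(1) bounded_bilinear_mult that])
  show ?case
    by (rule Ck_on_SucI[OF assms(1) Deriv.has_derivative_inverse[OF assms(2) Ck_on_SucE(1)[OF Suc.prems]]
          Ck_on_linear_comp[OF assms(1) bounded_linear_minus[OF bounded_linear_ident]
            m[OF m[OF i Ck_on_SucE(2)[OF Suc.prems]] i]]])
qed

lemma smooth_on_cong:
  "open S \<Longrightarrow> (\<And>x. x \<in> S \<Longrightarrow> f x = g x) \<Longrightarrow> smooth_on S f \<longleftrightarrow> smooth_on S g"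
  unfolding smooth_on_def using Ck_on_cong by blast

lemma smooth_on_subset: "smooth_on S f \<Longrightarrow> T \<subseteq> S \<Longrightarrow> smooth_on T f"
  unfolding smooth_on_def using Ck_on_subset by blast

lemma smooth_on_has_derivative:
  "smooth_on S f \<Longrightarrow> x \<in> S \<Longrightarrow> (f has_derivative frechet_derivative f (at x)) (at x)"
  unfolding smooth_on_def using Ck_on_SucE(1) by blast

lemma smooth_on_continuous: "smooth_on S f \<Longrightarrow> continuous_on S f"
  unfolding smooth_on_def by (metis Ck_on.simps(1))

lemma smooth_on_derivative: "smooth_on S f \<Longrightarrow> smooth_on S (\<lambda>x. frechet_derivative f (at x) v)"
  unfolding smooth_on_def using Ck_on_SucE(2) by blast

lemma smooth_on_const: "open S \<Longrightarrow> smooth_on S (\<lambda>x. c)"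
  unfolding smooth_on_def by (auto intro!: Ck_on_const[of S _ c])

lemma smooth_on_linear: "open S \<Longrightarrow> bounded_linear h \<Longrightarrow> smooth_on S h"
  unfolding smooth_on_def by (auto intro!: Ck_on_linear[of S h])

lemma smooth_on_linear_comp:
  "open S \<Longrightarrow> bounded_linear h \<Longrightarrow> smooth_on S f \<Longrightarrow> smooth_on S (\<lambda>x. h (f x))"
  unfolding smooth_on_def by (auto intro!: Ck_on_linear_comp[of S h _ f])

lemma smooth_on_add:
  "open S \<Longrightarrow> smooth_on S f \<Longrightarrow> smooth_on S g \<Longrightarrow> smooth_on S (\<lambda>x. f x + g x)"
  unfolding smooth_on_def by (auto intro!: Ck_on_add[of S _ f g])

lemma smooth_on_bilinear:
  "open S \<Longrightarrow> bounded_bilinear h \<Longrightarrow> smooth_on S f \<Longrightarrow> smooth_on S g \<Longrightarrow> smooth_on S (\<lambda>x. h (f x) (g x))"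
  unfolding smooth_on_def by (auto intro!: Ck_on_bilinear[of S h _ f g])

lemma smooth_on_compose:
  fixes g :: "'b::euclidean_space \<Rightarrow> 'c::real_normed_vector"
  shows "open S \<Longrightarrow> open T \<Longrightarrow> f ` S \<subseteq> T \<Longrightarrow> smooth_on S f \<Longrightarrow> smooth_on T g \<Longrightarrow>
    smooth_on S (\<lambda>x. g (f x))"
  unfolding smooth_on_def by (auto intro!: Ck_on_compose[of S T f _ g])

lemma smooth_on_inverse:
  fixes f :: "'a::real_normed_vector \<Rightarrow> real"
  shows "open S \<Longrightarrow> (\<And>x. x \<in> S \<Longrightarrow> f x \<noteq> 0) \<Longrightarrow> smooth_on S f \<Longrightarrow> smooth_on S (\<lambda>x. inverse (f x))"
  unfolding smooth_on_def by (auto intro!: Ck_on_inverse[of S f])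

lemma has_real_derivative_along_curve:
  fixes f :: "'a::real_normed_vector \<Rightarrow> real"
  assumes "(l has_derivative (\<lambda>s. s *\<^sub>R v)) (at a)" "(f has_derivative f') (at (l a))"
  shows "((\<lambda>s. f (l s)) has_real_derivative f' v) (at a)"
proof -
  have "(\<lambda>s. f' (s *\<^sub>R v)) = (*) (f' v)"
    using linear_scale[OF has_derivative_linear[OF assms(2)]] by (auto simp: fun_eq_iff)
  then show ?thesis
    using diff_chain_at[OF assms] unfolding has_field_derivative_def o_def by simp
qed

text \<open>The mean value theorem is applied first to \<open>s \<mapsto> f (z + s v + t w) - f (z + s v)\<close> and then to the
  \<open>v\<close>-derivative of \<open>f\<close> in direction \<open>w\<close>.\<close>

lemma second_difference_mean_value:
  fixes f :: "'a::real_normed_vector \<Rightarrow> real"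
  assumes "t > 0" and S: "\<And>a b. 0 \<le> a \<Longrightarrow> a \<le> t \<Longrightarrow> 0 \<le> b \<Longrightarrow> b \<le> t \<Longrightarrow> z + a *\<^sub>R v + b *\<^sub>R w \<in> S"
    and f: "Ck_on 2 S f"
  obtains a b where "0 \<le> a" "a \<le> t" "0 \<le> b" "b \<le> t" and
    "f (z + t *\<^sub>R v + t *\<^sub>R w) - f (z + t *\<^sub>R v) - f (z + t *\<^sub>R w) + f z =
      t * t * frechet_derivative (\<lambda>y. frechet_derivative f (at y) v) (at (z + a *\<^sub>R v + b *\<^sub>R w)) w"
proof -
  let ?Dv = "\<lambda>y. frechet_derivative f (at y) v"
  have f2: "Ck_on (Suc (Suc 0)) S f" using f by (simp add: numeral_2_eq_2)
  have d1: "((\<lambda>s. f (z + s *\<^sub>R v + b *\<^sub>R w)) has_real_derivative ?Dv (z + a *\<^sub>R v + b *\<^sub>R w)) (at a)"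
    if "0 \<le> a" "a \<le> t" "0 \<le> b" "b \<le> t" for a b
  proof -
    have l: "((\<lambda>s. z + s *\<^sub>R v + b *\<^sub>R w) has_derivative (\<lambda>s. s *\<^sub>R v)) (at a)"
      by (auto intro!: derivative_eq_intros)
    have D: "(f has_derivative frechet_derivative f (at (z + a *\<^sub>R v + b *\<^sub>R w))) (at (z + a *\<^sub>R v + b *\<^sub>R w))"
      using Ck_on_SucE(1)[OF f2 S[OF that]] .
    show ?thesis
      by (rule has_real_derivative_along_curve[OF l D])
  qed
  have d2: "((\<lambda>s. ?Dv (z + a *\<^sub>R v + s *\<^sub>R w)) has_real_derivative
      frechet_derivative ?Dv (at (z + a *\<^sub>R v + b *\<^sub>R w)) w) (at b)"
    if "0 \<le> a" "a \<le> t" "0 \<le> b" "b \<le> t" for a b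
  proof -
    have l: "((\<lambda>s. z + a *\<^sub>R v + s *\<^sub>R w) has_derivative (\<lambda>s. s *\<^sub>R w)) (at b)"
      by (auto intro!: derivative_eq_intros)
    have D: "(?Dv has_derivative frechet_derivative ?Dv (at (z + a *\<^sub>R v + b *\<^sub>R w))) (at (z + a *\<^sub>R v + b *\<^sub>R w))"
      using Ck_on_SucE(1)[OF Ck_on_SucE(2)[OF f2] S[OF that]] .
    show ?thesis
      by (rule has_real_derivative_along_curve[OF l D])
  qed
  \<comment> \<open>The summand \<open>0 *\<^sub>R w\<close> keeps both terms in the form for which \<open>d1\<close> is stated.\<close>
  define h where "h s = f (z + s *\<^sub>R v + t *\<^sub>R w) - f (z + s *\<^sub>R v + 0 *\<^sub>R w)" for s
  have "(h has_real_derivative ?Dv (z + s *\<^sub>R v + t *\<^sub>R w) - ?Dv (z + s *\<^sub>R v + 0 *\<^sub>R w)) (at s)"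
    if "0 \<le> s" "s \<le> t" for s
    unfolding h_def using d1[of s t] d1[of s 0] that \<open>t > 0\<close> by (intro DERIV_diff) auto
  from MVT2[of 0 t h, OF \<open>t > 0\<close> this] obtain a where a: "0 < a" "a < t"
    "h t - h 0 = t * (?Dv (z + a *\<^sub>R v + t *\<^sub>R w) - ?Dv (z + a *\<^sub>R v + 0 *\<^sub>R w))"
    by auto
  from MVT2[of 0 t "\<lambda>s. ?Dv (z + a *\<^sub>R v + s *\<^sub>R w)", OF \<open>t > 0\<close> d2[of a]] a obtain b where b: "0 < b" "b < t"
    "?Dv (z + a *\<^sub>R v + t *\<^sub>R w) - ?Dv (z + a *\<^sub>R v + 0 *\<^sub>R w) =
     t * frechet_derivative ?Dv (at (z + a *\<^sub>R v + b *\<^sub>R w)) w"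
    by auto
  show ?thesis
    by (rule that[of a b]) (use a b in \<open>auto simp: h_def\<close>)
qed

text \<open>The second difference is symmetric in \<open>v\<close> and \<open>w\<close>. Divided by \<open>t\<^sup>2\<close>, it is close to either of the two
  mixed derivatives at \<open>z\<close>, because these are continuous.\<close>

lemma second_derivative_symmetric:
  fixes f :: "'a::real_normed_vector \<Rightarrow> real"
  assumes "open S" "z \<in> S" and f: "Ck_on 2 S f"
  shows "frechet_derivative (\<lambda>y. frechet_derivative f (at y) v) (at z) w =
         frechet_derivative (\<lambda>y. frechet_derivative f (at y) w) (at z) v"
proof -
  define A where "A y = frechet_derivative (\<lambda>y. frechet_derivative f (at y) v) (at y) w" for y
  define B where "B y = frechet_derivative (\<lambda>y. frechet_derivative f (at y) w) (at y) v" for y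
  have f2: "Ck_on (Suc (Suc 0)) S f" using f by (simp add: numeral_2_eq_2)
  have "continuous_on S A" "continuous_on S B"
    unfolding A_def B_def using Ck_on_SucE(2)[OF Ck_on_SucE(2)[OF f2]] by auto
  then have AB: "isCont A z" "isCont B z" using assms(1,2) continuous_on_eq_continuous_at by auto
  have "\<bar>A z - B z\<bar> < e" if "e > 0" for e
  proof -
    have "e / 2 > 0" using that by simp
    obtain d1 where d1: "d1 > 0" "\<And>y. dist y z < d1 \<Longrightarrow> \<bar>A y - A z\<bar> < e/2"
      using AB(1) \<open>e/2 > 0\<close> unfolding continuous_at_eps_delta by (metis dist_real_def)
    obtain d2 where d2: "d2 > 0" "\<And>y. dist y z < d2 \<Longrightarrow> \<bar>B y - B z\<bar> < e/2"
      using AB(2) \<open>e/2 > 0\<close> unfolding continuous_at_eps_delta by (metis dist_real_def)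
    obtain d3 where d3: "d3 > 0" "\<And>y. dist y z < d3 \<Longrightarrow> y \<in> S"
      using assms(1,2) unfolding open_dist by (metis dist_commute)
    define d where "d = min d1 (min d2 d3)"
    \<comment> \<open>This choice keeps the parallelogram with edges \<open>t v\<close> and \<open>t w\<close> inside the ball of radius \<open>d\<close>.\<close>
    define t where "t = d / (2 * (norm v + norm w + 1))"
    have "norm v + norm w + 1 > 0" by (smt (verit) norm_ge_zero)
    then have t: "t > 0" unfolding t_def d_def using d1 d2 d3 by auto
    have near: "dist (z + a *\<^sub>R v + b *\<^sub>R w) z < d" if "0 \<le> a" "a \<le> t" "0 \<le> b" "b \<le> t" for a b
    proof -
      have "dist (z + a *\<^sub>R v + b *\<^sub>R w) z \<le> a * norm v + b * norm w"
        unfolding dist_norm using norm_triangle_ineq[of "a *\<^sub>R v" "b *\<^sub>R w"] that by (simp add: algebra_simps)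
      also have "\<dots> \<le> t * norm v + t * norm w" using that by (intro add_mono mult_right_mono) auto
      also have "\<dots> < t * (2 * (norm v + norm w + 1))" using t by (simp add: algebra_simps) (smt (verit) mult_nonneg_nonneg norm_ge_zero)
      also have "\<dots> = d" unfolding t_def using \<open>norm v + norm w + 1 > 0\<close> by simp
      finally show ?thesis .
    qed
    have inS: "z + a *\<^sub>R v + b *\<^sub>R w \<in> S" if "0 \<le> a" "a \<le> t" "0 \<le> b" "b \<le> t" for a b
      using near[OF that] d3(2) d_def by simp
    obtain a b where ab: "0 \<le> a" "a \<le> t" "0 \<le> b" "b \<le> t"
       "f (z + t *\<^sub>R v + t *\<^sub>R w) - f (z + t *\<^sub>R v) - f (z + t *\<^sub>R w) + f z = t * t * A (z + a *\<^sub>R v + b *\<^sub>R w)"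
      by (rule second_difference_mean_value[OF t inS f, folded A_def]) (assumption | rule that)+
    have inS': "z + a *\<^sub>R w + b *\<^sub>R v \<in> S" if "0 \<le> a" "a \<le> t" "0 \<le> b" "b \<le> t" for a b
      using inS[of b a] that by (simp add: add_ac)
    obtain a' b' where ab': "0 \<le> a'" "a' \<le> t" "0 \<le> b'" "b' \<le> t"
       "f (z + t *\<^sub>R w + t *\<^sub>R v) - f (z + t *\<^sub>R w) - f (z + t *\<^sub>R v) + f z = t * t * B (z + a' *\<^sub>R w + b' *\<^sub>R v)"
      by (rule second_difference_mean_value[OF t inS' f, folded B_def]) (assumption | rule that)+
    have "t * t * A (z + a *\<^sub>R v + b *\<^sub>R w) = t * t * B (z + a' *\<^sub>R w + b' *\<^sub>R v)"
      using ab(5) ab'(5) by (simp add: algebra_simps)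
    then have eq: "A (z + a *\<^sub>R v + b *\<^sub>R w) = B (z + a' *\<^sub>R w + b' *\<^sub>R v)" using t by simp
    have "\<bar>A (z + a *\<^sub>R v + b *\<^sub>R w) - A z\<bar> < e/2" using d1(2) near[OF ab(1-4)] d_def by simp
    moreover have "\<bar>B (z + a' *\<^sub>R w + b' *\<^sub>R v) - B z\<bar> < e/2"
      using d2(2) near[of b' a'] ab' d_def by (simp add: add_ac)
    ultimately show ?thesis using eq by linarith
  qed
  then have "A z = B z" by (metis abs_ge_zero diff_self eq_iff_diff_eq_0 less_irrefl zero_less_abs_iff)
  then show ?thesis unfolding A_def B_def .
qed

section \<open>Smooth maps between manifolds\<close>

lemma smooth_atlas_std: "smooth_atlas (std_atlas :: ('e::euclidean_space, 'e) atlas)"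
proof -
  have "inv_into UNIV (\<lambda>x. x) = (\<lambda>x::'e. x)" by (simp add: fun_eq_iff inv_into_f_eq)
  moreover have "smooth_on UNIV (\<lambda>x::'e. x)" by (rule smooth_on_linear) auto
  ultimately show ?thesis
    unfolding smooth_atlas_def std_atlas_def by (auto simp: o_def homeomorphism_def)
qed

lemma chart_properties:
  assumes "smooth_atlas A" "(U, \<phi>) \<in> A"
  shows "open U" "open (\<phi> ` U)" "continuous_on U \<phi>" "continuous_on (\<phi> ` U) (inv_into U \<phi>)"
    "inj_on \<phi> U" "N \<subseteq> U \<Longrightarrow> open N \<Longrightarrow> open (\<phi> ` N)"
proof -
  have *: "open U \<and> open (\<phi> ` U) \<and> homeomorphism U (\<phi> ` U) \<phi> (inv_into U \<phi>)"
    using assms unfolding smooth_atlas_def by blast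
  then show "open U" "open (\<phi> ` U)" "continuous_on U \<phi>" "continuous_on (\<phi> ` U) (inv_into U \<phi>)"
    by (auto simp: homeomorphism_def)
  show "inj_on \<phi> U"
    by (rule inj_on_inverseI[of _ "inv_into U \<phi>"]) (use * homeomorphism_apply1 in blast)
  show "open (\<phi> ` N)" if "N \<subseteq> U" "open N"
  proof -
    have "openin (top_of_set (\<phi> ` U)) (\<phi> ` N)"
      using homeomorphism_imp_open_map[of U "\<phi> ` U" \<phi> "inv_into U \<phi>" N] * that
        open_subset by blast
    then show ?thesis using * openin_open_trans by blast
  qed
qed

lemma chart_at:
  assumes "smooth_atlas A" obtains U \<phi> where "(U, \<phi>) \<in> A" "p \<in> U"
proof -
  have "(\<Union>(U, \<phi>)\<in>A. U) = UNIV" using assms unfolding smooth_atlas_def by (elim conjE)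
  then have "p \<in> (\<Union>(U, \<phi>)\<in>A. U)" by simp
  then show ?thesis using that by auto
qed

lemma chart_transition:
  assumes "smooth_atlas A" "(U, \<phi>) \<in> A" "(V, \<psi>) \<in> A"
  shows "smooth_on (\<phi> ` (U \<inter> V)) (\<psi> \<circ> inv_into U \<phi>)"
proof -
  have *: "\<forall>(U, \<phi>)\<in>A. \<forall>(V, \<psi>)\<in>A. smooth_on (\<phi> ` (U \<inter> V)) (\<psi> \<circ> inv_into U \<phi>)"
    using assms(1) unfolding smooth_atlas_def by (elim conjE)
  show ?thesis using bspec[OF bspec[OF * assms(2), simplified] assms(3)] by simp
qed

text \<open>Smoothness at a point is defined by the existence of one suitable pair of charts. Because the
  transition maps are smooth, the charts can be prescribed.\<close>

lemma smooth_at_chart: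
  assumes A: "smooth_atlas A" and B: "smooth_atlas B" and f: "smooth_at A B f p"
    and U: "(U, \<phi>) \<in> A" "p \<in> U" and V: "(V, \<psi>) \<in> B" "f p \<in> V"
  obtains N where "open N" "p \<in> N" "N \<subseteq> U" "f ` N \<subseteq> V" "smooth_on (\<phi> ` N) (\<psi> \<circ> f \<circ> inv_into U \<phi>)"
proof -
  obtain U' \<phi>' V' \<psi>' N' where U': "(U', \<phi>') \<in> A" and V': "(V', \<psi>') \<in> B" and N': "open N'" "p \<in> N'" "N' \<subseteq> U'" "f ` N' \<subseteq> V'"
    and sm: "smooth_on (\<phi>' ` N') (\<psi>' \<circ> f \<circ> inv_into U' \<phi>')"
    using f unfolding smooth_at_def by blast
  note cU = chart_properties[OF A U(1)] and cU' = chart_properties[OF A U']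
  note cV = chart_properties[OF B V(1)] and cV' = chart_properties[OF B V']
  have "continuous_on N' (\<lambda>q. inv_into V' \<psi>' ((\<psi>' \<circ> f \<circ> inv_into U' \<phi>') (\<phi>' q)))"
    by (rule continuous_on_compose2[OF cV'(4) continuous_on_compose2[OF smooth_on_continuous[OF sm] continuous_on_subset[OF cU'(3) N'(3)]]])
       (use N' cU'(5) in \<open>auto simp: inv_into_f_f subset_iff\<close>)
  moreover have "inv_into V' \<psi>' ((\<psi>' \<circ> f \<circ> inv_into U' \<phi>') (\<phi>' q)) = f q" if "q \<in> N'" for q
    using that N' cU'(5) cV'(5) by (auto simp: inv_into_f_f subset_iff)
  ultimately have "continuous_on N' f" using continuous_on_cong[OF refl, of N' _ f] by auto
  then have o: "open (f -` V \<inter> N')" using continuous_on_open_vimage[OF N'(1)] cV(1) by blast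
  define N where "N = f -` V \<inter> N' \<inter> U"
  have N: "open N" "p \<in> N" "N \<subseteq> U" "f ` N \<subseteq> V" "N \<subseteq> N'" "N \<subseteq> U'"
    unfolding N_def using o cU(1) N' U V by auto
  have oN: "open (\<phi> ` N)" "open (\<phi>' ` N)" using cU(6) cU'(6) N by auto
  have NV: "f ` N \<subseteq> V \<inter> V'" using N N' by blast
  have 1: "smooth_on (\<phi> ` N) (\<phi>' \<circ> inv_into U \<phi>)"
    by (rule smooth_on_subset[OF chart_transition[OF A U(1) U']]) (use N in auto)
  have 2: "smooth_on (\<phi>' ` N) (\<psi>' \<circ> f \<circ> inv_into U' \<phi>')"
    by (rule smooth_on_subset[OF sm]) (use N in auto)
  have 3: "smooth_on (\<psi>' ` (V' \<inter> V)) (\<psi> \<circ> inv_into V' \<psi>')"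
    by (rule chart_transition[OF B V' V(1)])
  have 12: "smooth_on (\<phi> ` N) (\<lambda>z. (\<psi>' \<circ> f \<circ> inv_into U' \<phi>') ((\<phi>' \<circ> inv_into U \<phi>) z))"
    by (rule smooth_on_compose[OF oN _ 1 2]) (use N cU(5) in \<open>auto simp: inv_into_f_f subset_iff\<close>)
  have "smooth_on (\<phi> ` N) (\<lambda>z. (\<psi> \<circ> inv_into V' \<psi>') ((\<psi>' \<circ> f \<circ> inv_into U' \<phi>') ((\<phi>' \<circ> inv_into U \<phi>) z)))"
    by (rule smooth_on_compose[OF oN(1) _ _ 12 3])
       (use N NV cU(5) cU'(5) cV'(6)[of "V' \<inter> V"] cV(1) cV'(1) in \<open>auto simp: inv_into_f_f subset_iff image_subset_iff\<close>)
  moreover have "(\<psi> \<circ> inv_into V' \<psi>') ((\<psi>' \<circ> f \<circ> inv_into U' \<phi>') ((\<phi>' \<circ> inv_into U \<phi>) z)) = (\<psi> \<circ> f \<circ> inv_into U \<phi>) z"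
    if "z \<in> \<phi> ` N" for z
    using that N NV cU(5) cU'(5) cV'(5) by (auto simp: inv_into_f_f subset_iff image_subset_iff)
  ultimately have "smooth_on (\<phi> ` N) (\<psi> \<circ> f \<circ> inv_into U \<phi>)"
    using smooth_on_cong[OF oN(1)] by (metis (no_types, lifting))
  then show ?thesis using that N by blast
qed

lemma smooth_at_continuous_vimage:
  assumes "smooth_atlas A" "smooth_atlas B" "smooth_at A B f p" "open W" "f p \<in> W"
  obtains N where "open N" "p \<in> N" "f ` N \<subseteq> W"
proof -
  obtain U \<phi> where U: "(U, \<phi>) \<in> A" "p \<in> U" using chart_at[OF assms(1)] .
  obtain V \<psi> where V: "(V, \<psi>) \<in> B" "f p \<in> V" using chart_at[OF assms(2)] .
  obtain N where N: "open N" "p \<in> N" "N \<subseteq> U" "f ` N \<subseteq> V" and sm: "smooth_on (\<phi> ` N) (\<psi> \<circ> f \<circ> inv_into U \<phi>)"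
    using smooth_at_chart[OF assms(1-3) U V] .
  note cU = chart_properties[OF assms(1) U(1)] and cV = chart_properties[OF assms(2) V(1)]
  have "continuous_on N (\<lambda>q. inv_into V \<psi> ((\<psi> \<circ> f \<circ> inv_into U \<phi>) (\<phi> q)))"
    by (rule continuous_on_compose2[OF cV(4) continuous_on_compose2[OF smooth_on_continuous[OF sm] continuous_on_subset[OF cU(3) N(3)]]])
       (use N cU(5) in \<open>auto simp: inv_into_f_f subset_iff\<close>)
  moreover have "inv_into V \<psi> ((\<psi> \<circ> f \<circ> inv_into U \<phi>) (\<phi> q)) = f q" if "q \<in> N" for q
    using that N cU(5) cV(5) by (auto simp: inv_into_f_f subset_iff)
  ultimately have "continuous_on N f" using continuous_on_cong[OF refl, of N _ f] by auto
  then have "open (f -` W \<inter> N)" using continuous_on_open_vimage[OF N(1)] assms(4) by blast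
  then show ?thesis using that[of "f -` W \<inter> N"] N assms(5) by blast
qed

lemma smooth_at_compose:
  assumes A: "smooth_atlas A" and B: "smooth_atlas B" and C: "smooth_atlas C"
    and f: "smooth_at A B f p" and g: "smooth_at B C g (f p)"
  shows "smooth_at A C (\<lambda>x. g (f x)) p"
proof -
  obtain U \<phi> where U: "(U, \<phi>) \<in> A" "p \<in> U" using chart_at[OF A] .
  obtain V \<psi> where V: "(V, \<psi>) \<in> B" "f p \<in> V" using chart_at[OF B] .
  obtain W \<kappa> where W: "(W, \<kappa>) \<in> C" "g (f p) \<in> W" using chart_at[OF C] .
  obtain N' where N': "open N'" "f p \<in> N'" "N' \<subseteq> V" "g ` N' \<subseteq> W" and sg: "smooth_on (\<psi> ` N') (\<kappa> \<circ> g \<circ> inv_into V \<psi>)"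
    using smooth_at_chart[OF B C g V W] .
  obtain N1 where N1: "open N1" "p \<in> N1" "N1 \<subseteq> U" "f ` N1 \<subseteq> V" and sf: "smooth_on (\<phi> ` N1) (\<psi> \<circ> f \<circ> inv_into U \<phi>)"
    using smooth_at_chart[OF A B f U V] .
  obtain N2 where N2: "open N2" "p \<in> N2" "f ` N2 \<subseteq> N'"
    using smooth_at_continuous_vimage[OF A B f N'(1,2)] .
  define N where "N = N1 \<inter> N2"
  have N: "open N" "p \<in> N" "N \<subseteq> U" "f ` N \<subseteq> N'" "N \<subseteq> N1" unfolding N_def using N1 N2 by auto
  note cU = chart_properties[OF A U(1)] and cV = chart_properties[OF B V(1)]
  have oN: "open (\<phi> ` N)" using cU(6) N by auto
  have "smooth_on (\<phi> ` N) (\<lambda>z. (\<kappa> \<circ> g \<circ> inv_into V \<psi>) ((\<psi> \<circ> f \<circ> inv_into U \<phi>) z))"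
    by (rule smooth_on_compose[OF oN cV(6)[OF N'(3,1)] _ smooth_on_subset[OF sf] sg])
       (use N cU(5) in \<open>auto simp: inv_into_f_f subset_iff image_subset_iff\<close>)
  moreover have "(\<kappa> \<circ> g \<circ> inv_into V \<psi>) ((\<psi> \<circ> f \<circ> inv_into U \<phi>) z) = (\<kappa> \<circ> (\<lambda>x. g (f x)) \<circ> inv_into U \<phi>) z"
    if "z \<in> \<phi> ` N" for z
    using that N N' cU(5) cV(5) by (auto simp: inv_into_f_f subset_iff image_subset_iff)
  ultimately have "smooth_on (\<phi> ` N) (\<kappa> \<circ> (\<lambda>x. g (f x)) \<circ> inv_into U \<phi>)"
    using smooth_on_cong[OF oN] by (metis (no_types, lifting))
  moreover have "(\<lambda>x. g (f x)) ` N \<subseteq> W" using N N' by blast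
  ultimately show ?thesis unfolding smooth_at_def using U(1) W(1) N(1-3) by blast
qed

lemma smooth_at_neighbourhood:
  assumes "smooth_at A B f p"
  obtains N where "open N" "p \<in> N" "\<And>q. q \<in> N \<Longrightarrow> smooth_at A B f q"
proof -
  obtain U \<phi> V \<psi> N where N: "(U, \<phi>) \<in> A" "(V, \<psi>) \<in> B" "open N" "p \<in> N" "N \<subseteq> U" "f ` N \<subseteq> V"
    "smooth_on (\<phi> ` N) (\<psi> \<circ> f \<circ> inv_into U \<phi>)"
    using assms unfolding smooth_at_def by blast
  show ?thesis
    by (rule that[OF N(3,4)]) (use N in \<open>unfold smooth_at_def, blast\<close>)
qed

lemma smooth_at_cong:
  assumes A: "smooth_atlas A" and f: "smooth_at A B f p" and M: "open M" "p \<in> M" "\<And>q. q \<in> M \<Longrightarrow> g q = f q"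
  shows "smooth_at A B g p"
proof -
  obtain U \<phi> V \<psi> N where N: "(U, \<phi>) \<in> A" "(V, \<psi>) \<in> B" "open N" "p \<in> N" "N \<subseteq> U" "f ` N \<subseteq> V"
    "smooth_on (\<phi> ` N) (\<psi> \<circ> f \<circ> inv_into U \<phi>)"
    using f unfolding smooth_at_def by blast
  note cU = chart_properties[OF A N(1)]
  have o: "open (\<phi> ` (N \<inter> M))" by (rule cU(6)) (use N M in auto)
  have "smooth_on (\<phi> ` (N \<inter> M)) (\<psi> \<circ> f \<circ> inv_into U \<phi>)"
    by (rule smooth_on_subset[OF N(7)]) auto
  moreover have "(\<psi> \<circ> f \<circ> inv_into U \<phi>) z = (\<psi> \<circ> g \<circ> inv_into U \<phi>) z" if "z \<in> \<phi> ` (N \<inter> M)" for z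
    using that M(3) N cU(5) by (auto simp: inv_into_f_f subset_iff)
  ultimately have "smooth_on (\<phi> ` (N \<inter> M)) (\<psi> \<circ> g \<circ> inv_into U \<phi>)"
    using smooth_on_cong[OF o] by (metis (no_types, lifting))
  moreover have "open (N \<inter> M)" "p \<in> N \<inter> M" "N \<inter> M \<subseteq> U" "g ` (N \<inter> M) \<subseteq> V" using N M by auto
  ultimately show ?thesis unfolding smooth_at_def using N(1,2) by blast
qed

lemma smooth_at_std_iff:
  assumes A: "smooth_atlas A" and U: "(U, \<phi>) \<in> A" "p \<in> U"
  shows "smooth_at A std_atlas f p \<longleftrightarrow>
    (\<exists>N. open N \<and> p \<in> N \<and> N \<subseteq> U \<and> smooth_on (\<phi> ` N) (\<lambda>z. f (inv_into U \<phi> z)))"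
proof
  assume f: "smooth_at A std_atlas f p"
  have *: "(UNIV, \<lambda>x. x) \<in> std_atlas" "f p \<in> UNIV" by (auto simp: std_atlas_def)
  obtain N where "open N" "p \<in> N" "N \<subseteq> U" "f ` N \<subseteq> UNIV" "smooth_on (\<phi> ` N) ((\<lambda>x. x) \<circ> f \<circ> inv_into U \<phi>)"
    using smooth_at_chart[OF A smooth_atlas_std f U *] .
  then show "\<exists>N. open N \<and> p \<in> N \<and> N \<subseteq> U \<and> smooth_on (\<phi> ` N) (\<lambda>z. f (inv_into U \<phi> z))"
    by (auto simp: o_def)
next
  assume "\<exists>N. open N \<and> p \<in> N \<and> N \<subseteq> U \<and> smooth_on (\<phi> ` N) (\<lambda>z. f (inv_into U \<phi> z))"
  then obtain N where N: "open N" "p \<in> N" "N \<subseteq> U" "smooth_on (\<phi> ` N) (\<lambda>z. f (inv_into U \<phi> z))" by blast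
  have "smooth_on (\<phi> ` N) ((\<lambda>x. x) \<circ> f \<circ> inv_into U \<phi>)" using N(4) by (simp add: o_def)
  moreover have "(UNIV, \<lambda>x. x) \<in> std_atlas" by (simp add: std_atlas_def)
  ultimately show "smooth_at A std_atlas f p"
    unfolding smooth_at_def using U(1) N(1-3) by blast
qed

lemma smooth_at_std_obtain:
  assumes "smooth_atlas A" "(U, \<phi>) \<in> A" "p \<in> U" "smooth_at A std_atlas f p"
  obtains N where "open N" "p \<in> N" "N \<subseteq> U" "open (\<phi> ` N)" "smooth_on (\<phi> ` N) (\<lambda>z. f (inv_into U \<phi> z))"
proof -
  obtain N where N: "open N" "p \<in> N" "N \<subseteq> U" "smooth_on (\<phi> ` N) (\<lambda>z. f (inv_into U \<phi> z))"
    using smooth_at_std_iff[OF assms(1-3), of f] assms(4) by blast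
  show ?thesis using that[OF N(1-3) chart_properties(6)[OF assms(1,2) N(3,1)] N(4)] .
qed

lemma smooth_at_const: "smooth_atlas A \<Longrightarrow> smooth_at A std_atlas (\<lambda>x. c) p"
proof -
  assume A: "smooth_atlas A"
  obtain U \<phi> where U: "(U, \<phi>) \<in> A" "p \<in> U" using chart_at[OF A] .
  note cU = chart_properties[OF A U(1)]
  show ?thesis
    unfolding smooth_at_std_iff[OF A U] using cU(1) U(2) smooth_on_const[OF cU(2), of c] by blast
qed

lemma smooth_at_linear_comp:
  assumes A: "smooth_atlas A" and h: "bounded_linear h" and f: "smooth_at A std_atlas f p"
  shows "smooth_at A std_atlas (\<lambda>x. h (f x)) p"
proof -
  obtain U \<phi> where U: "(U, \<phi>) \<in> A" "p \<in> U" using chart_at[OF A] .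
  obtain N where "open N" "p \<in> N" "N \<subseteq> U" "open (\<phi> ` N)" "smooth_on (\<phi> ` N) (\<lambda>z. f (inv_into U \<phi> z))"
    using smooth_at_std_obtain[OF A U f] .
  then show ?thesis
    using smooth_at_std_iff[OF A U, of "\<lambda>x. h (f x)"] smooth_on_linear_comp[OF _ h] by blast
qed

lemma smooth_at_bilinear:
  assumes A: "smooth_atlas A" and h: "bounded_bilinear h"
    and f: "smooth_at A std_atlas f p" and g: "smooth_at A std_atlas g p"
  shows "smooth_at A std_atlas (\<lambda>x. h (f x) (g x)) p"
proof -
  obtain U \<phi> where U: "(U, \<phi>) \<in> A" "p \<in> U" using chart_at[OF A] .
  obtain N where N: "open N" "p \<in> N" "N \<subseteq> U" "open (\<phi> ` N)" "smooth_on (\<phi> ` N) (\<lambda>z. f (inv_into U \<phi> z))"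
    using smooth_at_std_obtain[OF A U f] .
  obtain M where M: "open M" "p \<in> M" "M \<subseteq> U" "open (\<phi> ` M)" "smooth_on (\<phi> ` M) (\<lambda>z. g (inv_into U \<phi> z))"
    using smooth_at_std_obtain[OF A U g] .
  have o: "open (\<phi> ` (N \<inter> M))" by (rule chart_properties(6)[OF A U(1)]) (use N M in auto)
  have "smooth_on (\<phi> ` (N \<inter> M)) (\<lambda>z. h (f (inv_into U \<phi> z)) (g (inv_into U \<phi> z)))"
    by (rule smooth_on_bilinear[OF o h smooth_on_subset[OF N(5)] smooth_on_subset[OF M(5)]]) auto
  then show ?thesis
    using smooth_at_std_iff[OF A U, of "\<lambda>x. h (f x) (g x)"] N M by blast
qed

lemma smooth_at_add:
  assumes A: "smooth_atlas A"
    and f: "smooth_at A std_atlas f p" and g: "smooth_at A std_atlas g p"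
  shows "smooth_at A std_atlas (\<lambda>x. f x + g x) p"
proof -
  obtain U \<phi> where U: "(U, \<phi>) \<in> A" "p \<in> U" using chart_at[OF A] .
  obtain N where N: "open N" "p \<in> N" "N \<subseteq> U" "open (\<phi> ` N)" "smooth_on (\<phi> ` N) (\<lambda>z. f (inv_into U \<phi> z))"
    using smooth_at_std_obtain[OF A U f] .
  obtain M where M: "open M" "p \<in> M" "M \<subseteq> U" "open (\<phi> ` M)" "smooth_on (\<phi> ` M) (\<lambda>z. g (inv_into U \<phi> z))"
    using smooth_at_std_obtain[OF A U g] .
  have o: "open (\<phi> ` (N \<inter> M))" by (rule chart_properties(6)[OF A U(1)]) (use N M in auto)
  have "smooth_on (\<phi> ` (N \<inter> M)) (\<lambda>z. f (inv_into U \<phi> z) + g (inv_into U \<phi> z))"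
    by (rule smooth_on_add[OF o smooth_on_subset[OF N(5)] smooth_on_subset[OF M(5)]]) auto
  then show ?thesis
    using smooth_at_std_iff[OF A U, of "\<lambda>x. f x + g x"] N M by blast
qed

lemma smooth_at_mult:
  fixes f g :: "'a::{t2_space,second_countable_topology} \<Rightarrow> real"
  shows "smooth_atlas A \<Longrightarrow> smooth_at A std_atlas f p \<Longrightarrow> smooth_at A std_atlas g p \<Longrightarrow>
    smooth_at A std_atlas (\<lambda>x. f x * g x) p"
  by (rule smooth_at_bilinear[OF _ bounded_bilinear_mult])

lemma smooth_at_sum:
  assumes "smooth_atlas A" "\<And>i. i \<in> I \<Longrightarrow> smooth_at A std_atlas (f i) p"
  shows "smooth_at A std_atlas (\<lambda>x. \<Sum>i\<in>I. f i x) p"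
  using assms(2)
  by (induction I rule: infinite_finite_induct) (auto intro: smooth_at_const smooth_at_add assms(1))

lemma smooth_at_prod:
  fixes f :: "'i \<Rightarrow> 'a::{t2_space,second_countable_topology} \<Rightarrow> real"
  assumes "smooth_atlas A" "\<And>i. i \<in> I \<Longrightarrow> smooth_at A std_atlas (f i) p"
  shows "smooth_at A std_atlas (\<lambda>x. \<Prod>i\<in>I. f i x) p"
  using assms(2)
  by (induction I rule: infinite_finite_induct) (auto intro: smooth_at_const smooth_at_mult assms(1))

lemma smooth_at_diff:
  fixes f g :: "'a::{t2_space,second_countable_topology} \<Rightarrow> real"
  assumes "smooth_atlas A" "smooth_at A std_atlas f p" "smooth_at A std_atlas g p"
  shows "smooth_at A std_atlas (\<lambda>x. f x - g x) p"
  using smooth_at_add[OF assms(1,2) smooth_at_linear_comp[OF assms(1) bounded_linear_minus[OF bounded_linear_ident] assms(3)]]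
  by simp

lemma smooth_at_divide:
  fixes f g :: "'a::{t2_space,second_countable_topology} \<Rightarrow> real"
  assumes A: "smooth_atlas A" and f: "smooth_at A std_atlas f p" and g: "smooth_at A std_atlas g p" "g p \<noteq> 0"
  shows "smooth_at A std_atlas (\<lambda>x. f x / g x) p"
proof -
  obtain U \<phi> where U: "(U, \<phi>) \<in> A" "p \<in> U" using chart_at[OF A] .
  obtain M where M: "open M" "p \<in> M" "M \<subseteq> U" "open (\<phi> ` M)" "smooth_on (\<phi> ` M) (\<lambda>z. g (inv_into U \<phi> z))"
    using smooth_at_std_obtain[OF A U g(1)] .
  obtain N where N: "open N" "p \<in> N" "g ` N \<subseteq> - {0}"
  proof (rule smooth_at_continuous_vimage[OF A smooth_atlas_std g(1)])
    show "open (- {0 :: real})" "g p \<in> - {0}" using g(2) by auto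
  qed (rule that)
  have o: "open (\<phi> ` (N \<inter> M))" by (rule chart_properties(6)[OF A U(1)]) (use N M in auto)
  have "smooth_on (\<phi> ` (N \<inter> M)) (\<lambda>z. inverse (g (inv_into U \<phi> z)))"
    by (rule smooth_on_inverse[OF o _ smooth_on_subset[OF M(5)]])
       (use M N chart_properties(5)[OF A U(1)] in \<open>auto simp: inv_into_f_f subset_iff\<close>)
  then have "smooth_at A std_atlas (\<lambda>x. inverse (g x)) p"
    using smooth_at_std_iff[OF A U, of "\<lambda>x. inverse (g x)"] N M by blast
  then show ?thesis using smooth_at_mult[OF A f] by (simp add: divide_inverse)
qed

lemma smooth_at_std_std:
  "smooth_at std_atlas std_atlas f p \<longleftrightarrow> (\<exists>N. open N \<and> p \<in> N \<and> smooth_on N f)"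
proof -
  have i: "inv_into UNIV (\<lambda>x. x) = (\<lambda>x. x)" by (simp add: fun_eq_iff inv_into_f_eq)
  have "(UNIV, \<lambda>x. x) \<in> std_atlas" by (simp add: std_atlas_def)
  from smooth_at_std_iff[OF smooth_atlas_std this, of p f] show ?thesis by (simp add: i)
qed

section \<open>Tangent spaces\<close>

text \<open>The tangent vector with coordinates \<open>v\<close> in a chart. The value 0 on functions that are not smooth is
  the convention for \<open>velocity\<close>, so that equality of operators is preserved.\<close>

definition chart_vec :: "('m::topological_space, 'e::euclidean_space) atlas \<Rightarrow> 'm set \<Rightarrow> ('m \<Rightarrow> 'e) \<Rightarrow> 'm \<Rightarrow> 'e \<Rightarrow> 'm tv" where
  "chart_vec A U \<phi> p v = (\<lambda>f. if smooth_at A std_atlas f p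
     then frechet_derivative (\<lambda>z. f (inv_into U \<phi> z)) (at (\<phi> p)) v else 0)"

lemma chart_representation_has_derivative:
  assumes "smooth_atlas A" "(U, \<phi>) \<in> A" "p \<in> U" "smooth_at A std_atlas f p"
  shows "((\<lambda>z. f (inv_into U \<phi> z)) has_derivative frechet_derivative (\<lambda>z. f (inv_into U \<phi> z)) (at (\<phi> p))) (at (\<phi> p))"
proof -
  obtain N where N: "open N" "p \<in> N" "N \<subseteq> U" "open (\<phi> ` N)" "smooth_on (\<phi> ` N) (\<lambda>z. f (inv_into U \<phi> z))"
    using smooth_at_std_obtain[OF assms] .
  show ?thesis using smooth_on_has_derivative[OF N(5)] N(2) by blast
qed

lemma velocity_eq_chart_vec:
  assumes A: "smooth_atlas A" and U: "(U, \<phi>) \<in> A" "p \<in> U" and p: "c 0 = p"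
    and N: "open N" "0 \<in> N" "c ` N \<subseteq> U" and D: "((\<lambda>t. \<phi> (c t)) has_derivative (\<lambda>s. s *\<^sub>R v)) (at 0)"
  shows "velocity A c = chart_vec A U \<phi> p v"
proof
  fix f
  show "velocity A c f = chart_vec A U \<phi> p v f"
  proof (cases "smooth_at A std_atlas f p")
    case True
    let ?f = "\<lambda>z. f (inv_into U \<phi> z)"
    have Df: "(?f has_derivative frechet_derivative ?f (at (\<phi> p))) (at (\<phi> (c 0)))"
      using chart_representation_has_derivative[OF A U True] p by simp
    have main: "((\<lambda>t. ?f (\<phi> (c t))) has_real_derivative frechet_derivative ?f (at (\<phi> p)) v) (at 0)"
      by (rule has_real_derivative_along_curve[OF D Df])
    moreover have eq: "?f (\<phi> (c t)) = (f \<circ> c) t" if "t \<in> N" for t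
      using that N(3) chart_properties(5)[OF A U(1)] by (auto simp: inv_into_f_f subset_iff)
    ultimately have "(f \<circ> c has_real_derivative frechet_derivative ?f (at (\<phi> p)) v) (at 0)"
      by (intro has_field_derivative_transform_within_open[OF main N(1,2) eq])
    then show ?thesis using True p by (simp add: velocity_def chart_vec_def DERIV_imp_deriv)
  qed (simp add: velocity_def chart_vec_def p)
qed

lemma smooth_curve_chart:
  assumes A: "smooth_atlas A" and U: "(U, \<phi>) \<in> A" "c 0 \<in> U" and c: "smooth_at std_atlas A c 0"
  obtains N where "open N" "0 \<in> N" "c ` N \<subseteq> U" "smooth_on N (\<lambda>t::real. \<phi> (c t))"
proof -
  have i: "inv_into UNIV (\<lambda>x. x) = (\<lambda>x::real. x)" by (simp add: fun_eq_iff inv_into_f_eq)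
  have *: "(UNIV, \<lambda>x. x) \<in> std_atlas" "0 \<in> (UNIV::real set)" by (auto simp: std_atlas_def)
  obtain N where "open N" "0 \<in> N" "N \<subseteq> UNIV" "c ` N \<subseteq> U" "smooth_on ((\<lambda>x. x) ` N) (\<phi> \<circ> c \<circ> inv_into UNIV (\<lambda>x. x))"
    using smooth_at_chart[OF smooth_atlas_std A c * U] .
  then show ?thesis using that by (simp add: i o_def)
qed

lemma velocity_chart:
  assumes A: "smooth_atlas A" and U: "(U, \<phi>) \<in> A" "c 0 \<in> U" and c: "smooth_at std_atlas A c 0"
  shows "velocity A c = chart_vec A U \<phi> (c 0) (frechet_derivative (\<lambda>t. \<phi> (c t)) (at 0) 1)"
proof -
  obtain N where N: "open N" "0 \<in> N" "c ` N \<subseteq> U" "smooth_on N (\<lambda>t::real. \<phi> (c t))"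
    using smooth_curve_chart[OF A U c] .
  let ?D = "frechet_derivative (\<lambda>t. \<phi> (c t)) (at 0)"
  have D: "((\<lambda>t. \<phi> (c t)) has_derivative ?D) (at 0)"
    using smooth_on_has_derivative[OF N(4,2)] .
  have "?D s = s *\<^sub>R ?D 1" for s
    using linear_scale[OF has_derivative_linear[OF D], of s 1] by simp
  then have "((\<lambda>t. \<phi> (c t)) has_derivative (\<lambda>s. s *\<^sub>R ?D 1)) (at 0)"
    by (intro has_derivative_eq_rhs[OF D] ext)
  then show ?thesis by (rule velocity_eq_chart_vec[OF A U refl N(1-3)])
qed

lemma smooth_at_curveI:
  assumes V: "(V, \<psi>) \<in> A" and N: "open N" "0 \<in> N" "c ` N \<subseteq> V" "smooth_on N (\<lambda>t::real. \<psi> (c t))"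
  shows "smooth_at std_atlas A c 0"
proof -
  have i: "inv_into UNIV (\<lambda>x. x) = (\<lambda>x::real. x)" by (simp add: fun_eq_iff inv_into_f_eq)
  have *: "(UNIV, \<lambda>x. x) \<in> std_atlas" by (auto simp: std_atlas_def)
  have "smooth_on ((\<lambda>x. x) ` N) (\<psi> \<circ> c \<circ> inv_into UNIV (\<lambda>x. x))" using N(4) by (simp add: i o_def)
  then show ?thesis unfolding smooth_at_def using * V N(1-3) by blast
qed

lemma chart_vec_in_tangent_space:
  assumes A: "smooth_atlas A" and U: "(U, \<phi>) \<in> A" "p \<in> U"
  shows "chart_vec A U \<phi> p v \<in> tangent_space A p"
proof -
  note cU = chart_properties[OF A U(1)]
  define l where "l t = \<phi> p + t *\<^sub>R v" for t :: real
  define c where "c t = inv_into U \<phi> (l t)" for t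
  define N where "N = l -` (\<phi> ` U)"
  have "continuous_on UNIV l" unfolding l_def by (intro continuous_intros)
  then have N: "open N" unfolding N_def using cU(2) by (simp add: open_vimage)
  have 0: "0 \<in> N" unfolding N_def l_def using U by simp
  have cU': "c ` N \<subseteq> U" unfolding c_def N_def by (auto simp: inv_into_into)
  have lc: "\<phi> (c t) = l t" if "t \<in> N" for t using that unfolding c_def N_def by (auto simp: f_inv_into_f)
  have "smooth_on N l" unfolding l_def
    by (intro smooth_on_add N smooth_on_const smooth_on_linear bounded_linear_scaleR_left)
  then have "smooth_on N (\<lambda>t. \<phi> (c t))" using smooth_on_cong[OF N, of "\<lambda>t. \<phi> (c t)" l] lc by blast
  then have sm: "smooth_at std_atlas A c 0" by (rule smooth_at_curveI[OF U(1) N 0 cU'])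
  have c0: "c 0 = p" unfolding c_def l_def using U cU(5) by simp
  have "(l has_derivative (\<lambda>s. s *\<^sub>R v)) (at 0)" unfolding l_def by (auto intro!: derivative_eq_intros)
  then have "((\<lambda>t. \<phi> (c t)) has_derivative (\<lambda>s. s *\<^sub>R v)) (at 0)"
    by (rule has_derivative_transform_within_open[OF _ N 0]) (simp add: lc)
  from velocity_eq_chart_vec[OF A U c0 N 0 cU' this]
  have "chart_vec A U \<phi> p v = velocity A c" by simp
  then show ?thesis unfolding tangent_space_def using sm c0 by blast
qed

text \<open>The tangent space is defined as a mere set of velocities. Since every velocity is determined by its
  coordinates, and a straight line in the chart realises any coordinates, it is a vector space of the
  dimension of the model.\<close>

lemma tangent_space_eq_chart_vec:
  assumes A: "smooth_atlas A" and U: "(U, \<phi>) \<in> A" "p \<in> U"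
  shows "tangent_space A p = range (chart_vec A U \<phi> p)"
proof
  show "tangent_space A p \<subseteq> range (chart_vec A U \<phi> p)"
    unfolding tangent_space_def using velocity_chart[OF A U(1)] U(2) by auto
  show "range (chart_vec A U \<phi> p) \<subseteq> tangent_space A p"
    using chart_vec_in_tangent_space[OF A U] by auto
qed

lemma chart_vec_linear:
  assumes A: "smooth_atlas A" and U: "(U, \<phi>) \<in> A" "p \<in> U"
  shows "chart_vec A U \<phi> p (a *\<^sub>R v + b *\<^sub>R w) = (\<lambda>f. a * chart_vec A U \<phi> p v f + b * chart_vec A U \<phi> p w f)"
proof
  fix f
  show "chart_vec A U \<phi> p (a *\<^sub>R v + b *\<^sub>R w) f = a * chart_vec A U \<phi> p v f + b * chart_vec A U \<phi> p w f"
  proof (cases "smooth_at A std_atlas f p")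
    case True
    note l = has_derivative_linear[OF chart_representation_has_derivative[OF A U True]]
    show ?thesis using True by (simp add: chart_vec_def linear_add[OF l] linear_scale[OF l])
  qed (simp add: chart_vec_def)
qed

lemma coordinate_function:
  assumes A: "smooth_atlas A" and U: "(U, \<phi>) \<in> A" "p \<in> U"
  shows "smooth_at A std_atlas (\<lambda>q. \<phi> q \<bullet> b) p" "chart_vec A U \<phi> p v (\<lambda>q. \<phi> q \<bullet> b) = v \<bullet> b"
proof -
  note cU = chart_properties[OF A U(1)]
  have eq: "\<phi> (inv_into U \<phi> z) \<bullet> b = z \<bullet> b" if "z \<in> \<phi> ` U" for z using that by (simp add: f_inv_into_f)
  have "smooth_on (\<phi> ` U) (\<lambda>z. \<phi> (inv_into U \<phi> z) \<bullet> b)"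
    using smooth_on_cong[OF cU(2), of "\<lambda>z. \<phi> (inv_into U \<phi> z) \<bullet> b" "\<lambda>z. z \<bullet> b"] eq
      smooth_on_linear[OF cU(2) bounded_linear_inner_left[of b]] by blast
  then show sm: "smooth_at A std_atlas (\<lambda>q. \<phi> q \<bullet> b) p"
    unfolding smooth_at_std_iff[OF A U] using cU(1) U(2) by blast
  have "((\<lambda>z. z \<bullet> b) has_derivative (\<lambda>z. z \<bullet> b)) (at (\<phi> p))" by (auto intro!: derivative_eq_intros)
  then have "((\<lambda>z. \<phi> (inv_into U \<phi> z) \<bullet> b) has_derivative (\<lambda>z. z \<bullet> b)) (at (\<phi> p))"
    by (rule has_derivative_transform_within_open[OF _ cU(2)]) (use U eq in auto)
  then have "frechet_derivative (\<lambda>z. \<phi> (inv_into U \<phi> z) \<bullet> b) (at (\<phi> p)) = (\<lambda>z. z \<bullet> b)"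
    by (rule frechet_derivative_at[symmetric])
  then show "chart_vec A U \<phi> p v (\<lambda>q. \<phi> q \<bullet> b) = v \<bullet> b"
    using sm by (simp add: chart_vec_def)
qed

lemma tangent_comb:
  assumes A: "smooth_atlas A" and "X \<in> tangent_space A p" "Y \<in> tangent_space A p"
  shows "(\<lambda>f. a * X f + b * Y f) \<in> tangent_space A p"
proof -
  obtain U \<phi> where U: "(U, \<phi>) \<in> A" "p \<in> U" using chart_at[OF A] .
  show ?thesis using assms(2,3) chart_vec_linear[OF A U, symmetric]
    unfolding tangent_space_eq_chart_vec[OF A U] by auto
qed

lemma tangent_zero:
  assumes A: "smooth_atlas A" shows "(\<lambda>f. 0) \<in> tangent_space A p"
proof -
  obtain U \<phi> where U: "(U, \<phi>) \<in> A" "p \<in> U" using chart_at[OF A] .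
  show ?thesis using tangent_comb[OF A chart_vec_in_tangent_space[OF A U] chart_vec_in_tangent_space[OF A U], where a=0 and b=0] by simp
qed

lemma tangent_sum:
  assumes A: "smooth_atlas A" and "\<And>i. i \<in> I \<Longrightarrow> X i \<in> tangent_space A p"
  shows "(\<lambda>f. \<Sum>i\<in>I. a i * X i f) \<in> tangent_space A p"
  using assms(2)
proof (induction I rule: infinite_finite_induct)
  case (insert x F)
  then show ?case using tangent_comb[OF A, of "X x" p "\<lambda>f. \<Sum>i\<in>F. a i * X i f" "a x" 1] by simp
qed (auto simp: tangent_zero[OF A])

lemma tangent_nonsmooth:
  assumes "X \<in> tangent_space A p" "\<not> smooth_at A std_atlas f p"
  shows "X f = 0"
  using assms by (auto simp: tangent_space_def velocity_def)

lemma tangent_chartE: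
  assumes A: "smooth_atlas A" and X: "X \<in> tangent_space A p" and U: "(U, \<phi>) \<in> A" "p \<in> U"
  obtains v where "X = chart_vec A U \<phi> p v"
  using X unfolding tangent_space_eq_chart_vec[OF A U] by auto

lemma tangent_local:
  assumes A: "smooth_atlas A" and X: "X \<in> tangent_space A p"
    and M: "open M" "p \<in> M" "\<And>q. q \<in> M \<Longrightarrow> f q = g q"
  shows "X f = X g"
proof (cases "smooth_at A std_atlas f p")
  case True
  then have g: "smooth_at A std_atlas g p" using smooth_at_cong[OF A True M(1,2)] M(3) by simp
  obtain U \<phi> where U: "(U, \<phi>) \<in> A" "p \<in> U" using chart_at[OF A] .
  note cU = chart_properties[OF A U(1)]
  obtain v where v: "X = chart_vec A U \<phi> p v" using tangent_chartE[OF A X U] .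
  have "((\<lambda>z. g (inv_into U \<phi> z)) has_derivative frechet_derivative (\<lambda>z. f (inv_into U \<phi> z)) (at (\<phi> p))) (at (\<phi> p))"
    by (rule has_derivative_transform_within_open[OF chart_representation_has_derivative[OF A U True], of "\<phi> ` (M \<inter> U)"])
       (use M U cU(1,5) cU(6)[of "M \<inter> U"] in \<open>auto simp: inv_into_f_f\<close>)
  then have "frechet_derivative (\<lambda>z. g (inv_into U \<phi> z)) (at (\<phi> p)) = frechet_derivative (\<lambda>z. f (inv_into U \<phi> z)) (at (\<phi> p))"
    by (rule frechet_derivative_at[symmetric])
  then show ?thesis using True g v by (simp add: chart_vec_def)
next
  case False
  then have "\<not> smooth_at A std_atlas g p" using smooth_at_cong[OF A _ M(1,2)] M(3) by metis
  then show ?thesis using tangent_nonsmooth[OF X] False by simp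
qed

lemma tangent_add:
  assumes A: "smooth_atlas A" and X: "X \<in> tangent_space A p"
    and f: "smooth_at A std_atlas f p" and g: "smooth_at A std_atlas g p"
  shows "X (\<lambda>q. f q + g q) = X f + X g"
proof -
  obtain U \<phi> where U: "(U, \<phi>) \<in> A" "p \<in> U" using chart_at[OF A] .
  obtain v where v: "X = chart_vec A U \<phi> p v" using tangent_chartE[OF A X U] .
  note D = has_derivative_add[OF chart_representation_has_derivative[OF A U f] chart_representation_has_derivative[OF A U g]]
  show ?thesis unfolding v chart_vec_def using f g smooth_at_add[OF A f g] frechet_derivative_at[OF D, symmetric]
    by simp
qed

lemma tangent_mult:
  assumes A: "smooth_atlas A" and X: "X \<in> tangent_space A p"
    and f: "smooth_at A std_atlas f p" and g: "smooth_at A std_atlas g p"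
  shows "X (\<lambda>q. f q * g q) = X f * g p + f p * X g"
proof -
  obtain U \<phi> where U: "(U, \<phi>) \<in> A" "p \<in> U" using chart_at[OF A] .
  obtain v where v: "X = chart_vec A U \<phi> p v" using tangent_chartE[OF A X U] .
  note D = has_derivative_mult[OF chart_representation_has_derivative[OF A U f] chart_representation_has_derivative[OF A U g]]
  have "inv_into U \<phi> (\<phi> p) = p" using U chart_properties(5)[OF A U(1)] by simp
  then show ?thesis unfolding v chart_vec_def using f g smooth_at_mult[OF A f g] frechet_derivative_at[OF D, symmetric]
    by simp
qed

lemma tangent_const:
  assumes A: "smooth_atlas A" and X: "X \<in> tangent_space A p"
  shows "X (\<lambda>q. c) = 0"
proof -
  obtain U \<phi> where U: "(U, \<phi>) \<in> A" "p \<in> U" using chart_at[OF A] .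
  obtain v where v: "X = chart_vec A U \<phi> p v" using tangent_chartE[OF A X U] .
  show ?thesis unfolding v chart_vec_def by simp
qed

lemma tangent_sum_fun:
  assumes A: "smooth_atlas A" and X: "X \<in> tangent_space A p"
    and f: "\<And>i. i \<in> I \<Longrightarrow> smooth_at A std_atlas (f i) p"
  shows "X (\<lambda>q. \<Sum>i\<in>I. f i q) = (\<Sum>i\<in>I. X (f i))"
  using f
proof (induction I rule: infinite_finite_induct)
  case (insert x F)
  then show ?case using tangent_add[OF A X, of "f x" "\<lambda>q. \<Sum>i\<in>F. f i q"] smooth_at_sum[OF A, of F f p] by simp
qed (auto simp: tangent_const[OF A X])

text \<open>This is what dimension counts on tangent spaces rest on.\<close>

lemma tangent_coordinates:
  fixes A :: "('m::{t2_space,second_countable_topology}, 'e::euclidean_space) atlas"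
  assumes A: "smooth_atlas A"
  obtains L :: "'m tv \<Rightarrow> 'e" where "bij_betw L (tangent_space A p) UNIV"
    "\<And>X Y a b. X \<in> tangent_space A p \<Longrightarrow> Y \<in> tangent_space A p \<Longrightarrow> L (\<lambda>f. a * X f + b * Y f) = a *\<^sub>R L X + b *\<^sub>R L Y"
proof -
  obtain U \<phi> where U: "(U, \<phi>) \<in> A" "p \<in> U" using chart_at[OF A] .
  define L where "L X = (\<Sum>b\<in>Basis. X (\<lambda>q. \<phi> q \<bullet> b) *\<^sub>R b)" for X
  have L: "L (chart_vec A U \<phi> p v) = v" for v
    unfolding L_def coordinate_function(2)[OF A U] by (rule euclidean_representation)
  have "bij_betw L (tangent_space A p) UNIV"
    by (rule bij_betw_byWitness[where f' = "chart_vec A U \<phi> p"])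
       (auto simp: tangent_space_eq_chart_vec[OF A U] L)
  moreover have "L (\<lambda>f. a * X f + b * Y f) = a *\<^sub>R L X + b *\<^sub>R L Y" for X Y a b
    unfolding L_def by (simp add: sum.distrib scaleR_left_distrib scaleR_sum_right)
  ultimately show ?thesis using that by blast
qed

lemma pushforward_velocity:
  assumes A: "smooth_atlas A" and B: "smooth_atlas B" and F: "smooth_at A B F p"
    and c: "smooth_at std_atlas A c 0" "c 0 = p"
  shows "pushforward B F p (velocity A c) = velocity B (\<lambda>t. F (c t))"
    "smooth_at std_atlas B (\<lambda>t. F (c t)) 0"
proof -
  show "pushforward B F p (velocity A c) = velocity B (\<lambda>t. F (c t))"
    using smooth_at_compose[OF A B smooth_atlas_std F] c
    by (auto simp: pushforward_def velocity_def fun_eq_iff o_def)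
  show "smooth_at std_atlas B (\<lambda>t. F (c t)) 0"
    using smooth_at_compose[OF smooth_atlas_std A B c(1)] F c(2) by simp
qed

lemma pushforward_in_tangent_space:
  assumes A: "smooth_atlas A" and B: "smooth_atlas B" and F: "smooth_at A B F p"
    and X: "X \<in> tangent_space A p"
  shows "pushforward B F p X \<in> tangent_space B (F p)"
proof -
  obtain c where c: "X = velocity A c" "smooth_at std_atlas A c 0" "c 0 = p"
    using X unfolding tangent_space_def by blast
  show ?thesis using pushforward_velocity[OF A B F c(2,3)] c
    unfolding tangent_space_def by (auto intro!: exI[of _ "\<lambda>t. F (c t)"])
qed

lemma pushforward_apply: "smooth_at B std_atlas g (F p) \<Longrightarrow> pushforward B F p X g = X (\<lambda>x. g (F x))"
  by (simp add: pushforward_def o_def)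

lemma pushforward_comb:
  "pushforward B F p (\<lambda>f. a * X f + b * Y f) = (\<lambda>f. a * pushforward B F p X f + b * pushforward B F p Y f)"
  by (auto simp: pushforward_def)

lemma pushforward_compose:
  assumes B: "smooth_atlas B" and C: "smooth_atlas C"
    and H: "smooth_at B C H (F p)"
  shows "pushforward C H (F p) (pushforward B F p X) = pushforward C (\<lambda>x. H (F x)) p X"
  using smooth_at_compose[OF B C smooth_atlas_std H] by (auto simp: pushforward_def o_def fun_eq_iff)

lemma pushforward_id:
  assumes "X \<in> tangent_space A p" shows "pushforward A (\<lambda>x. x) p X = X"
  using tangent_nonsmooth[OF assms] by (auto simp: pushforward_def o_def fun_eq_iff)

lemma pushforward_local:
  assumes A: "smooth_atlas A" and X: "X \<in> tangent_space A p"
    and M: "open M" "p \<in> M" "\<And>q. q \<in> M \<Longrightarrow> F q = F' q"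
  shows "pushforward B F p X = pushforward B F' p X"
proof -
  have "X (g \<circ> F) = X (g \<circ> F')" for g by (rule tangent_local[OF A X M(1,2)]) (simp add: M(3))
  moreover have "F p = F' p" using M by simp
  ultimately show ?thesis unfolding pushforward_def by (simp add: fun_eq_iff)
qed

section \<open>The bracket of smooth vector fields\<close>

lemma smooth_on_second_derivative_symmetric:
  fixes f :: "'a::real_normed_vector \<Rightarrow> real"
  assumes "open S" "z \<in> S" "smooth_on S f"
  shows "frechet_derivative (\<lambda>y. frechet_derivative f (at y) v) (at z) w =
         frechet_derivative (\<lambda>y. frechet_derivative f (at y) w) (at z) v"
  by (rule second_derivative_symmetric[OF assms(1,2)]) (use assms(3) smooth_on_def in blast)

text \<open>The derivative of the function \<open>Y f\<close> has a first order term in which \<open>Y\<close> is differentiated and a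
  second order term. By the symmetry of second derivatives, the latter is unchanged if \<open>Y\<close> and the
  direction of differentiation are exchanged; it cancels from the bracket.\<close>

lemma has_derivative_derivative_along_field:
  fixes f :: "'e::euclidean_space \<Rightarrow> real" and Y :: "'e \<Rightarrow> 'e"
  assumes S: "open S" "z \<in> S" and f: "smooth_on S f" and Y: "smooth_on S Y"
  shows "((\<lambda>y. frechet_derivative f (at y) (Y y)) has_derivative
     (\<lambda>v. frechet_derivative f (at z) (frechet_derivative Y (at z) v)
        + frechet_derivative (\<lambda>y. frechet_derivative f (at y) (Y z)) (at z) v)) (at z)"
proof -
  let ?f' = "\<lambda>y. frechet_derivative f (at y)" and ?Y' = "frechet_derivative Y (at z)"
  define Q where "Q v w = frechet_derivative (\<lambda>y. ?f' y v) (at z) w" for v w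
  have Q: "((\<lambda>y. ?f' y v) has_derivative Q v) (at z)" for v
    using smooth_on_has_derivative[OF smooth_on_derivative[OF f] S(2)] unfolding Q_def[abs_def] .
  have Qs: "Q v w = Q w v" for v w
    unfolding Q_def by (rule smooth_on_second_derivative_symmetric[OF S f])
  have Y': "(Y has_derivative ?Y') (at z)" by (rule smooth_on_has_derivative[OF Y S(2)])
  have f': "(f has_derivative ?f' y) (at y)" if "y \<in> S" for y by (rule smooth_on_has_derivative[OF f that])
  have e: "(\<Sum>b\<in>Basis. (Y y \<bullet> b) * ?f' y b) = ?f' y (Y y)" if "y \<in> S" for y
    using has_derivative_euclidean_expand[OF f'[OF that], of "Y y"] by simp
  have "((\<lambda>y. \<Sum>b\<in>Basis. (Y y \<bullet> b) * ?f' y b) has_derivative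
      (\<lambda>v. \<Sum>b\<in>Basis. (Y z \<bullet> b) * Q b v + (?Y' v \<bullet> b) * ?f' z b)) (at z)"
    by (intro has_derivative_sum has_derivative_mult bounded_linear.has_derivative[OF bounded_linear_inner_left] Y' Q)
  then have "((\<lambda>y. ?f' y (Y y)) has_derivative
      (\<lambda>v. \<Sum>b\<in>Basis. (Y z \<bullet> b) * Q b v + (?Y' v \<bullet> b) * ?f' z b)) (at z)"
    by (rule has_derivative_transform_within_open[OF _ S]) (rule e)
  moreover have "(\<Sum>b\<in>Basis. (Y z \<bullet> b) * Q b v + (?Y' v \<bullet> b) * ?f' z b) = ?f' z (?Y' v) + Q (Y z) v" for v
  proof -
    have "(\<Sum>b\<in>Basis. (Y z \<bullet> b) * Q b v) = (\<Sum>b\<in>Basis. (Y z \<bullet> b) * Q v b)" by (simp add: Qs[of _ v])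
    also have "\<dots> = Q v (Y z)" using has_derivative_euclidean_expand[OF Q[of v], of "Y z"] by simp
    also have "\<dots> = Q (Y z) v" by (rule Qs)
    finally show ?thesis
      using has_derivative_euclidean_expand[OF f'[OF S(2)], of "?Y' v"] by (simp add: sum.distrib)
  qed
  ultimately show ?thesis unfolding Q_def by simp
qed

text \<open>The coordinates of a vector field are its values on the coordinate functions, so they are smooth.\<close>

lemma smooth_vector_field_chart:
  assumes A: "smooth_atlas A" and X: "smooth_vector_field_on A N X" and p: "p \<in> N" and U: "(U, \<phi>) \<in> A" "p \<in> U"
  obtains M x where "open M" "p \<in> M" "M \<subseteq> U" "M \<subseteq> N" "smooth_on (\<phi> ` M) x"
    "\<And>q. q \<in> M \<Longrightarrow> X q = chart_vec A U \<phi> q (x (\<phi> q))"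
proof -
  note cU = chart_properties[OF A U(1)]
  define \<xi> where "\<xi> q = (\<Sum>b\<in>Basis. X q (\<lambda>q. \<phi> q \<bullet> b) *\<^sub>R b)" for q
  have N: "open N" using X by (simp add: smooth_vector_field_on_def)
  have "smooth_at A std_atlas (\<lambda>q. X q (\<lambda>q. \<phi> q \<bullet> b)) p" for b
    using X p coordinate_function(1)[OF A U] unfolding smooth_vector_field_on_def by blast
  then have "smooth_at A std_atlas \<xi> p"
    unfolding \<xi>_def
    by (intro smooth_at_sum A smooth_at_bilinear[OF A bounded_bilinear_scaleR] smooth_at_const)
  from smooth_at_std_obtain[OF A U this] obtain M where M: "open M" "p \<in> M" "M \<subseteq> U"
     "smooth_on (\<phi> ` M) (\<lambda>z. \<xi> (inv_into U \<phi> z))" .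
  show ?thesis
  proof (rule that)
    show "open (M \<inter> N)" "p \<in> M \<inter> N" "M \<inter> N \<subseteq> U" "M \<inter> N \<subseteq> N" using M N p by auto
    show "smooth_on (\<phi> ` (M \<inter> N)) (\<lambda>z. \<xi> (inv_into U \<phi> z))"
      by (rule smooth_on_subset[OF M(4)]) auto
    fix q assume q: "q \<in> M \<inter> N"
    then have qU: "q \<in> U" using M by auto
    have "X q \<in> tangent_space A q" using X q unfolding smooth_vector_field_on_def by blast
    then obtain v where v: "X q = chart_vec A U \<phi> q v" using tangent_chartE[OF A _ U(1) qU] by blast
    have "\<xi> q = v" unfolding \<xi>_def v coordinate_function(2)[OF A U(1) qU] by (rule euclidean_representation)
    then show "X q = chart_vec A U \<phi> q (\<xi> (inv_into U \<phi> (\<phi> q)))" using v qU cU(5) by simp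
  qed
qed

lemma iterated_derivation_chart:
  assumes A: "smooth_atlas A" and U: "(U, \<phi>) \<in> A" and M: "open M" "p \<in> M" "M \<subseteq> U"
    and y: "smooth_on (\<phi> ` M) y" "\<And>q. q \<in> M \<Longrightarrow> Y q = chart_vec A U \<phi> q (y (\<phi> q))"
    and f: "smooth_on (\<phi> ` M) (\<lambda>z. f (inv_into U \<phi> z))"
    and Yf: "smooth_at A std_atlas (\<lambda>q. Y q f) p"
  shows "chart_vec A U \<phi> p v (\<lambda>q. Y q f) =
     frechet_derivative (\<lambda>z. f (inv_into U \<phi> z)) (at (\<phi> p)) (frechet_derivative y (at (\<phi> p)) v)
     + frechet_derivative (\<lambda>z. frechet_derivative (\<lambda>z. f (inv_into U \<phi> z)) (at z) (y (\<phi> p))) (at (\<phi> p)) v"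
proof -
  let ?f = "\<lambda>z. f (inv_into U \<phi> z)"
  note cU = chart_properties[OF A U]
  have o: "open (\<phi> ` M)" by (rule cU(6)[OF M(3,1)])
  have fs: "smooth_at A std_atlas f q" if "q \<in> M" for q
    using smooth_at_std_iff[OF A U, of q f] that M f by blast
  have "frechet_derivative ?f (at z) (y z) = Y (inv_into U \<phi> z) f" if "z \<in> \<phi> ` M" for z
    using that y(2) fs M cU(5) by (auto simp: chart_vec_def inv_into_f_f subset_iff)
  from has_derivative_transform_within_open[OF has_derivative_derivative_along_field[OF o _ f y(1)] o _ this, of "\<phi> p"]
  have "((\<lambda>z. Y (inv_into U \<phi> z) f) has_derivative (\<lambda>v. frechet_derivative ?f (at (\<phi> p)) (frechet_derivative y (at (\<phi> p)) v)
     + frechet_derivative (\<lambda>z. frechet_derivative ?f (at z) (y (\<phi> p))) (at (\<phi> p)) v)) (at (\<phi> p))"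
    using M(2) by simp
  from frechet_derivative_at[OF this, symmetric] show ?thesis
    using Yf by (simp add: chart_vec_def)
qed

text \<open>In a chart the second order terms of \<open>X (Y f)\<close> and \<open>Y (X f)\<close> cancel, and the bracket becomes
  differentiation in the direction \<open>DY(X) - DX(Y)\<close>.\<close>

lemma lie_bracket_in_tangent_space:
  assumes A: "smooth_atlas A" and X: "smooth_vector_field_on A N X" and Y: "smooth_vector_field_on A N' Y"
    and p: "p \<in> N" "p \<in> N'"
  shows "lie_bracket A X Y p \<in> tangent_space A p"
proof -
  obtain U \<phi> where U: "(U, \<phi>) \<in> A" "p \<in> U" using chart_at[OF A] .
  note cU = chart_properties[OF A U(1)]
  obtain M1 x where M1: "open M1" "p \<in> M1" "M1 \<subseteq> U" "M1 \<subseteq> N" and x: "smooth_on (\<phi> ` M1) x"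
    "\<And>q. q \<in> M1 \<Longrightarrow> X q = chart_vec A U \<phi> q (x (\<phi> q))"
    by (rule smooth_vector_field_chart[OF A X p(1) U]) (rule that)
  obtain M2 y where M2: "open M2" "p \<in> M2" "M2 \<subseteq> U" "M2 \<subseteq> N'" and y: "smooth_on (\<phi> ` M2) y"
    "\<And>q. q \<in> M2 \<Longrightarrow> Y q = chart_vec A U \<phi> q (y (\<phi> q))"
    by (rule smooth_vector_field_chart[OF A Y p(2) U]) (rule that)
  define v where "v = frechet_derivative y (at (\<phi> p)) (x (\<phi> p)) - frechet_derivative x (at (\<phi> p)) (y (\<phi> p))"
  have "lie_bracket A X Y p = chart_vec A U \<phi> p v"
  proof
    fix f
    show "lie_bracket A X Y p f = chart_vec A U \<phi> p v f"
    proof (cases "smooth_at A std_atlas f p")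
      case True
      let ?f = "\<lambda>z. f (inv_into U \<phi> z)"
      obtain M3 where M3: "open M3" "p \<in> M3" "M3 \<subseteq> U" "open (\<phi> ` M3)" "smooth_on (\<phi> ` M3) ?f"
        using smooth_at_std_obtain[OF A U True] .
      define M where "M = M1 \<inter> M2 \<inter> M3"
      have M: "open M" "p \<in> M" "M \<subseteq> U" "M \<subseteq> M1" "M \<subseteq> M2" "M \<subseteq> M3" unfolding M_def using M1 M2 M3 by auto
      have x': "smooth_on (\<phi> ` M) x" by (rule smooth_on_subset[OF x(1)]) (use M in auto)
      have y': "smooth_on (\<phi> ` M) y" by (rule smooth_on_subset[OF y(1)]) (use M in auto)
      have f': "smooth_on (\<phi> ` M) ?f" by (rule smooth_on_subset[OF M3(5)]) (use M in auto)
      have Xf: "smooth_at A std_atlas (\<lambda>q. X q f) p" using X p(1) True unfolding smooth_vector_field_on_def by blast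
      have Yf: "smooth_at A std_atlas (\<lambda>q. Y q f) p" using Y p(2) True unfolding smooth_vector_field_on_def by blast
      have xq: "q \<in> M \<Longrightarrow> X q = chart_vec A U \<phi> q (x (\<phi> q))" for q using M x(2) by blast
      have yq: "q \<in> M \<Longrightarrow> Y q = chart_vec A U \<phi> q (y (\<phi> q))" for q using M y(2) by blast
      have l: "linear (frechet_derivative ?f (at (\<phi> p)))"
        by (rule has_derivative_linear[OF chart_representation_has_derivative[OF A U True]])
      have o: "open (\<phi> ` M)" by (rule cU(6)[OF M(3,1)])
      note sym = smooth_on_second_derivative_symmetric[OF o _ f', of "\<phi> p" "x (\<phi> p)" "y (\<phi> p)"]
      have "lie_bracket A X Y p f = chart_vec A U \<phi> p (x (\<phi> p)) (\<lambda>q. Y q f) - chart_vec A U \<phi> p (y (\<phi> p)) (\<lambda>q. X q f)"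
        using True xq[OF M(2)] yq[OF M(2)] by (simp add: lie_bracket_def)
      also have "\<dots> = frechet_derivative ?f (at (\<phi> p)) v"
        using iterated_derivation_chart[where v = "x (\<phi> p)", OF A U(1) M(1-3) y' yq f' Yf]
          iterated_derivation_chart[where v = "y (\<phi> p)", OF A U(1) M(1-3) x' xq f' Xf] sym M(2)
        unfolding v_def linear_diff[OF l] by simp
      finally show ?thesis using True by (simp add: chart_vec_def)
    qed (simp add: lie_bracket_def chart_vec_def)
  qed
  then show ?thesis using chart_vec_in_tangent_space[OF A U] by simp
qed

section \<open>The matrix exponential\<close>

abbreviation mat_power :: "mat7 \<Rightarrow> nat \<Rightarrow> mat7" where
  "mat_power M n \<equiv> ((**) M ^^ n) (mat 1)"

lemma bounded_bilinear_matrix_mult: "bounded_bilinear ((**) :: mat7 \<Rightarrow> mat7 \<Rightarrow> mat7)"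
  unfolding bilinear_conv_bounded_bilinear[symmetric] bilinear_def
  by (auto intro!: linearI simp:
      matrix_matrix_mult_def vec_eq_iff sum_distrib_left algebra_simps sum.distrib)

lemma bounded_bilinear_matrix_vector_mult: "bounded_bilinear ((*v) :: mat7 \<Rightarrow> real^7 \<Rightarrow> real^7)"
  unfolding bilinear_conv_bounded_bilinear[symmetric] bilinear_def
  by (auto intro!: linearI simp: matrix_vector_mult_def vec_eq_iff sum_distrib_left algebra_simps sum.distrib)

lemmas matrix_mult_scaleR_left = bounded_bilinear.scaleR_left[OF bounded_bilinear_matrix_mult]
lemmas matrix_mult_scaleR_right = bounded_bilinear.scaleR_right[OF bounded_bilinear_matrix_mult]

lemma mat_power_scaleR: "mat_power (t *\<^sub>R M) n = t ^ n *\<^sub>R mat_power M n"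
  by (induction n) (simp_all add: matrix_mult_scaleR_left matrix_mult_scaleR_right)

lemma mat_power_commute:
  assumes "M ** N = N ** M" shows "mat_power M n ** N = N ** mat_power M n"
proof (induction n)
  case (Suc n)
  have "mat_power M (Suc n) ** N = M ** (mat_power M n ** N)" by (simp add: matrix_mul_assoc)
  also have "\<dots> = (M ** N) ** mat_power M n" by (simp add: Suc matrix_mul_assoc)
  also have "\<dots> = N ** mat_power M (Suc n)" by (simp add: assms matrix_mul_assoc)
  finally show ?case .
qed simp

lemma mat_power_norm_bound: obtains K where "\<And>n. norm (mat_power M n) \<le> K ^ n * norm (mat 1 :: mat7)"
proof -
  obtain K where K: "K > 0" "\<And>N::mat7. norm (M ** N) \<le> norm N * K"
    using bounded_linear.pos_bounded[OF bounded_bilinear.bounded_linear_right[OF bounded_bilinear_matrix_mult], of M] by blast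
  have "norm (mat_power M n) \<le> K ^ n * norm (mat 1 :: mat7)" for n
  proof (induction n)
    case (Suc n)
    have "norm (mat_power M (Suc n)) \<le> norm (mat_power M n) * K" using K(2) by simp
    also have "\<dots> \<le> (K ^ n * norm (mat 1 :: mat7)) * K" using Suc K(1) by (intro mult_right_mono) auto
    finally show ?case by (simp add: algebra_simps)
  qed simp
  then show ?thesis using that by blast
qed

lemma summable_matrix_exp: "summable (\<lambda>n. (1 / fact n) *\<^sub>R mat_power M n)"
proof -
  obtain K where K: "\<And>n. norm (mat_power M n) \<le> K ^ n * norm (mat 1 :: mat7)" by (rule mat_power_norm_bound[of M]) (rule that)
  have "summable (\<lambda>n. (inverse (fact n) * K ^ n) * norm (mat 1 :: mat7))"
    by (rule summable_mult2[OF summable_exp])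
  then show ?thesis
  proof (rule summable_comparison_test'[of _ 0])
    fix n
    show "norm ((1 / fact n) *\<^sub>R mat_power M n) \<le> inverse (fact n) * K ^ n * norm (mat 1 :: mat7)"
      using mult_left_mono[OF K[of n], of "inverse (fact n)"] by (simp add: field_simps)
  qed
qed

text \<open>Applied to a component, to the product with a fixed matrix and to the evaluation at a vector, this
  describes each of these quantities by a series.\<close>

lemma matrix_exp_bounded_linear:
  assumes "bounded_linear h"
  shows "h (matrix_exp M) = (\<Sum>n. (1 / fact n) *\<^sub>R h (mat_power M n))"
    "summable (\<lambda>n. (1 / fact n) *\<^sub>R h (mat_power M n))"
proof -
  interpret bounded_linear h by fact
  show "h (matrix_exp M) = (\<Sum>n. (1 / fact n) *\<^sub>R h (mat_power M n))"
    unfolding matrix_exp_def suminf[OF summable_matrix_exp] by (simp add: scaleR)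
  show "summable (\<lambda>n. (1 / fact n) *\<^sub>R h (mat_power M n))"
    using summable[OF summable_matrix_exp[of M]] by (simp add: scaleR)
qed

lemma matrix_exp_commute: "M ** N = N ** M \<Longrightarrow> matrix_exp M ** N = N ** matrix_exp M"
  using matrix_exp_bounded_linear(1)[OF bounded_bilinear.bounded_linear_left[OF bounded_bilinear_matrix_mult, of N], of M]
    matrix_exp_bounded_linear(1)[OF bounded_bilinear.bounded_linear_right[OF bounded_bilinear_matrix_mult, of N], of M]
  by (simp add: mat_power_commute)

lemma matrix_exp_0: "matrix_exp 0 = mat 1"
proof -
  have "(1 / fact n) *\<^sub>R mat_power 0 n = (if n = 0 then mat 1 else 0)" for n
    by (cases n) auto
  then show ?thesis unfolding matrix_exp_def using suminf_finite[of "{0}" "\<lambda>n. (1 / fact n) *\<^sub>R mat_power 0 n"] by simp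
qed

text \<open>Every component of \<open>exp (t M)\<close> is an everywhere convergent power series in \<open>t\<close>, which may be
  differentiated termwise.\<close>

lemma matrix_exp_has_vector_derivative:
  "((\<lambda>t. matrix_exp (t *\<^sub>R M)) has_vector_derivative M ** matrix_exp (t *\<^sub>R M)) (at t)"
proof -
  have "((\<lambda>t. matrix_exp (t *\<^sub>R M) \<bullet> b) has_derivative (\<lambda>s. (s *\<^sub>R (M ** matrix_exp (t *\<^sub>R M))) \<bullet> b)) (at t)"
    for b
  proof -
    define a where "a n = inverse (fact n) * (mat_power M n \<bullet> b)" for n
    have e: "matrix_exp (s *\<^sub>R M) \<bullet> b = (\<Sum>n. a n * s ^ n)" "summable (\<lambda>n. a n * s ^ n)" for s
      using matrix_exp_bounded_linear[OF bounded_linear_inner_left[of b], of "s *\<^sub>R M"]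
      unfolding mat_power_scaleR a_def by (simp_all add: divide_inverse mult_ac)
    have d: "diffs a n * t ^ n = (1 / fact n) *\<^sub>R ((M ** mat_power (t *\<^sub>R M) n) \<bullet> b)" for n
    proof -
      have "real (Suc n) * inverse (fact (Suc n)) = inverse (fact n)"
        unfolding fact_Suc by (simp del: of_nat_Suc)
      then have "diffs a n = inverse (fact n) * ((M ** mat_power M n) \<bullet> b)"
        unfolding diffs_def a_def by (simp only: mult.assoc[symmetric] funpow.simps o_apply)
      then show ?thesis
        unfolding mat_power_scaleR by (simp add: matrix_mult_scaleR_right divide_inverse mult_ac)
    qed
    have "(\<Sum>n. diffs a n * t ^ n) = (M ** matrix_exp (t *\<^sub>R M)) \<bullet> b"
      unfolding d
      by (rule matrix_exp_bounded_linear(1)[symmetric, OF bounded_linear_compose[OF bounded_linear_inner_left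
            bounded_bilinear.bounded_linear_right[OF bounded_bilinear_matrix_mult]]])
    moreover have "((\<lambda>x. \<Sum>n. a n * x^n) has_field_derivative (\<Sum>n. diffs a n * t^n)) (at t)"
      by (rule termdiffs_strong_converges_everywhere) (rule e(2))
    ultimately have "((\<lambda>t. matrix_exp (t *\<^sub>R M) \<bullet> b) has_field_derivative (M ** matrix_exp (t *\<^sub>R M)) \<bullet> b) (at t)"
      unfolding e(1) by simp
    then show ?thesis unfolding has_field_derivative_def by (simp add: mult_commute_abs)
  qed
  then show ?thesis
    unfolding has_vector_derivative_def by (subst has_derivative_componentwise_within) (intro ballI)
qed

text \<open>The product \<open>exp (-t M) exp (t M)\<close> has derivative zero.\<close>

lemma matrix_exp_inverse: "matrix_exp (- M) ** matrix_exp M = mat 1"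
proof -
  let ?E = "\<lambda>t. matrix_exp (t *\<^sub>R M)" and ?F = "\<lambda>t. matrix_exp (t *\<^sub>R (- M))"
  have "((\<lambda>t. ?F t ** ?E t) has_vector_derivative 0) (at t within UNIV)" for t
  proof -
    have "((\<lambda>t. ?F t ** ?E t) has_vector_derivative ?F t ** (M ** ?E t) + (- M ** ?F t) ** ?E t) (at t within UNIV)"
      by (rule bounded_bilinear.has_vector_derivative[OF bounded_bilinear_matrix_mult])
         (simp_all only: matrix_exp_has_vector_derivative)
    moreover have "?F t ** M = M ** ?F t"
      by (rule matrix_exp_commute) (simp add: matrix_mult_scaleR_left matrix_mult_scaleR_right
        bounded_bilinear.minus_left[OF bounded_bilinear_matrix_mult] bounded_bilinear.minus_right[OF bounded_bilinear_matrix_mult])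
    then have "?F t ** (M ** ?E t) + (- M ** ?F t) ** ?E t = 0"
      by (simp add: bounded_bilinear.minus_left[OF bounded_bilinear_matrix_mult] matrix_mul_assoc)
    ultimately show ?thesis by simp
  qed
  then obtain c where "\<And>t. t \<in> UNIV \<Longrightarrow> ?F t ** ?E t = c"
    using has_vector_derivative_zero_constant[OF convex_UNIV, of "\<lambda>t. ?F t ** ?E t"] by blast
  from this[of 0] this[of 1] show ?thesis by (simp add: matrix_exp_0)
qed

lemma matrix_inv_matrix_exp: "matrix_inv (matrix_exp M) = matrix_exp (- M)"
proof -
  have e: "matrix_exp M ** matrix_exp (- M) = mat 1" "matrix_exp (- M) ** matrix_exp M = mat 1"
    using matrix_exp_inverse[of M] matrix_exp_inverse[of "- M"] by simp_all
  then have "\<exists>N. matrix_exp M ** N = mat 1 \<and> N ** matrix_exp M = mat 1" by blast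
  then have i: "matrix_inv (matrix_exp M) ** matrix_exp M = mat 1"
    unfolding matrix_inv_def by (rule someI2_ex) simp
  have "matrix_inv (matrix_exp M) = matrix_inv (matrix_exp M) ** (matrix_exp M ** matrix_exp (- M))"
    by (simp add: e)
  also have "\<dots> = matrix_exp (- M)" by (simp add: i matrix_mul_assoc)
  finally show ?thesis .
qed

lemma matrix_exp_nilpotent:
  assumes "((*v) M ^^ k) v = 0"
  shows "matrix_exp M *v v = (\<Sum>n<k. (1 / fact n) *\<^sub>R ((*v) M ^^ n) v)"
proof -
  have e: "mat_power M n *v v = ((*v) M ^^ n) v" for n
    by (induction n) (simp_all add: matrix_vector_mul_assoc[symmetric])
  have z: "((*v) M ^^ n) v = 0" if "n \<ge> k" for n
    using that
  proof (induction n rule: dec_induct)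
    case (step n)
    then show ?case by simp
  qed (rule assms)
  have "matrix_exp M *v v = (\<Sum>n. (1 / fact n) *\<^sub>R ((*v) M ^^ n) v)"
    using matrix_exp_bounded_linear(1)[OF bounded_bilinear.bounded_linear_left[OF bounded_bilinear_matrix_vector_mult]] e by simp
  also have "\<dots> = (\<Sum>n<k. (1 / fact n) *\<^sub>R ((*v) M ^^ n) v)"
    by (rule suminf_finite) (use z in auto)
  finally show ?thesis .
qed

lemma matrix_exp_eigenvector:
  assumes "M *v v = c *\<^sub>R v"
  shows "matrix_exp M *v v = exp c *\<^sub>R v"
proof -
  have e: "mat_power M n *v v = c ^ n *\<^sub>R v" for n
    by (induction n) (simp_all add: matrix_vector_mul_assoc[symmetric] assms matrix_vector_mult_scaleR)
  have "matrix_exp M *v v = (\<Sum>n. (c ^ n /\<^sub>R fact n) *\<^sub>R v)"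
    using matrix_exp_bounded_linear(1)[OF bounded_bilinear.bounded_linear_left[OF bounded_bilinear_matrix_vector_mult], of M v] e
    by (simp add: divide_inverse mult.commute)
  also have "\<dots> = exp c *\<^sub>R v"
    unfolding exp_def by (rule bounded_linear.suminf[OF bounded_linear_scaleR_left summable_exp_generic, symmetric])
  finally show ?thesis .
qed

lemma smooth_on_matrix_exp: "smooth_on UNIV (\<lambda>t. matrix_exp (t *\<^sub>R M))"
proof -
  have "Ck_on k UNIV (\<lambda>t. matrix_exp (t *\<^sub>R M))" for k
  proof (induction k)
    case 0
    show ?case
      unfolding Ck_on.simps
      by (intro continuous_at_imp_continuous_on ballI has_vector_derivative_continuous[OF matrix_exp_has_vector_derivative])
  next
    case (Suc k)
    have "bounded_linear (\<lambda>N::mat7. v *\<^sub>R (M ** N))" for v :: real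
      by (rule bounded_linear_compose[OF bounded_linear_scaleR_right bounded_bilinear.bounded_linear_right[OF bounded_bilinear_matrix_mult]])
    from Ck_on_linear_comp[OF open_UNIV this Suc]
    show ?case
      by (intro Ck_on_SucI[OF open_UNIV, where f' = "\<lambda>t v. v *\<^sub>R (M ** matrix_exp (t *\<^sub>R M))"]
            matrix_exp_has_vector_derivative[unfolded has_vector_derivative_def])
  qed
  then show ?thesis by (simp add: smooth_on_def)
qed

section \<open>The Lie algebra as derivations of the split octonions\<close>

lemma exhaust_7:
  fixes x :: 7
  shows "x = 1 \<or> x = 2 \<or> x = 3 \<or> x = 4 \<or> x = 5 \<or> x = 6 \<or> x = 7"
proof (induct x)
  case (of_int z)
  then have "z = 0 \<or> z = 1 \<or> z = 2 \<or> z = 3 \<or> z = 4 \<or> z = 5 \<or> z = 6" by fastforce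
  then show ?case by auto
qed

lemma forall_7: "(\<forall>i::7. P i) \<longleftrightarrow> P 1 \<and> P 2 \<and> P 3 \<and> P 4 \<and> P 5 \<and> P 6 \<and> P 7"
  by (metis exhaust_7)

lemma UNIV_7: "UNIV = {1, 2, 3, 4, 5, 6, 7::7}"
  using exhaust_7 by auto

lemma sum_7: "sum f (UNIV::7 set) = f 1 + f 2 + f 3 + f 4 + f 5 + f 6 + f 7"
  unfolding UNIV_7 by (simp add: ac_simps)

lemma vector_7 [simp]:
  "(vector [a,b,c,d,e,f,g] :: 'a::zero^7)$1 = a"
  "(vector [a,b,c,d,e,f,g] :: 'a::zero^7)$2 = b"
  "(vector [a,b,c,d,e,f,g] :: 'a::zero^7)$3 = c"
  "(vector [a,b,c,d,e,f,g] :: 'a::zero^7)$4 = d"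
  "(vector [a,b,c,d,e,f,g] :: 'a::zero^7)$5 = e"
  "(vector [a,b,c,d,e,f,g] :: 'a::zero^7)$6 = f"
  "(vector [a,b,c,d,e,f,g] :: 'a::zero^7)$7 = g"
  unfolding vector_def by simp_all

lemma g2_mat_comb:
  "a *\<^sub>R g2_mat A X r Y Z s W + b *\<^sub>R g2_mat A' X' r' Y' Z' s' W' =
   g2_mat (a *\<^sub>R A + b *\<^sub>R A') (a *\<^sub>R X + b *\<^sub>R X') (a * r + b * r') (a *\<^sub>R Y + b *\<^sub>R Y')
     (a *\<^sub>R Z + b *\<^sub>R Z') (a * s + b * s') (a *\<^sub>R W + b *\<^sub>R W')"
  by (simp add: vec_eq_iff forall_7 g2_mat_def trace_def sum_2 algebra_simps add_divide_distrib)

lemma parts_g2_mat [simp]: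
  "part_A (g2_mat A X r Y Z s W) = A" "part_X (g2_mat A X r Y Z s W) = X" "part_r (g2_mat A X r Y Z s W) = r"
  "part_Y (g2_mat A X r Y Z s W) = Y" "part_Z (g2_mat A X r Y Z s W) = Z" "part_s (g2_mat A X r Y Z s W) = s"
  "part_W (g2_mat A X r Y Z s W) = W"
  by (simp_all add: part_A_def part_X_def part_r_def part_Y_def part_Z_def part_s_def part_W_def
      g2_mat_def vec_eq_iff forall_2)

lemma g2_mat_parts: "M \<in> g2_algebra \<Longrightarrow> M = g2_mat (part_A M) (part_X M) (part_r M) (part_Y M) (part_Z M) (part_s M) (part_W M)"
  by (auto simp: g2_algebra_def)

lemma g2_mat_in_algebra [simp]: "g2_mat A X r Y Z s W \<in> g2_algebra"
  unfolding g2_algebra_def by blast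

lemma g2_mat_eq_iff: "g2_mat A X r Y Z s W = g2_mat A' X' r' Y' Z' s' W' \<longleftrightarrow>
   A = A' \<and> X = X' \<and> r = r' \<and> Y = Y' \<and> Z = Z' \<and> s = s' \<and> W = W'"
  by (metis parts_g2_mat)

lemma g2_mat_0: "g2_mat 0 0 0 0 0 0 0 = 0"
  by (simp add: vec_eq_iff forall_7 g2_mat_def trace_def)

lemma g2_mat_vector_mult:
  "g2_mat A X r Y Z s W *v v = vector
    [- trace A * v$1 + Z$1 * v$2 + Z$2 * v$3 + s * v$4 + W$1 * v$5 + W$2 * v$6,
     X$1 * v$1 + (A$1$1 - trace A) * v$2 + A$1$2 * v$3 - sqrt 2 * Z$2 * v$4 - s / sqrt 2 * v$6 - W$1 * v$7,
     X$2 * v$1 + A$2$1 * v$2 + (A$2$2 - trace A) * v$3 + sqrt 2 * Z$1 * v$4 + s / sqrt 2 * v$5 - W$2 * v$7,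
     r * v$1 - sqrt 2 * X$2 * v$2 + sqrt 2 * X$1 * v$3 - sqrt 2 * Z$2 * v$5 + sqrt 2 * Z$1 * v$6 + s * v$7,
     Y$1 * v$1 + r / sqrt 2 * v$3 - sqrt 2 * X$2 * v$4 + (trace A - A$1$1) * v$5 - A$2$1 * v$6 - Z$1 * v$7,
     Y$2 * v$1 - r / sqrt 2 * v$2 + sqrt 2 * X$1 * v$4 - A$1$2 * v$5 + (trace A - A$2$2) * v$6 - Z$2 * v$7,
     - Y$1 * v$2 - Y$2 * v$3 + r * v$4 - X$1 * v$5 - X$2 * v$6 + trace A * v$7]"
  by (simp add: vec_eq_iff forall_7 g2_mat_def matrix_vector_mult_def sum_7)

definition oct_coord :: "split_octonion \<Rightarrow> real^7" where
  "oct_coord = (\<lambda>(a, x, y, b). vector [- (y$3), x$1, x$2, (b - a) / sqrt 2, - (y$1), - (y$2), x$3])"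

definition oct_real :: "split_octonion \<Rightarrow> real" where
  "oct_real = (\<lambda>(a, x, y, b). (a + b) / 2)"

definition oct_one :: split_octonion where "oct_one = (1, 0, 0, 1)"

text \<open>The extension of an endomorphism of the imaginary octonions to all octonions that fixes the unit. It
  is the candidate for an automorphism if the endomorphism comes from the group.\<close>

definition oct_extend :: "mat7 \<Rightarrow> split_octonion \<Rightarrow> split_octonion" where
  "oct_extend g z = oct_real z *\<^sub>R oct_one + imag_oct (g *v oct_coord z)"

lemma linear_imag_oct: "linear imag_oct"
  by (rule linearI) (auto simp: imag_oct_def vec_eq_iff forall_3 add_divide_distrib diff_divide_distrib)

lemma linear_oct_coord: "linear oct_coord"
  by (rule linearI) (auto simp: oct_coord_def vec_eq_iff forall_7 diff_divide_distrib algebra_simps add_divide_distrib)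

lemma linear_oct_real: "linear oct_real"
  by (rule linearI) (auto simp: oct_real_def algebra_simps add_divide_distrib)

lemma oct_coord_imag_oct [simp]: "oct_coord (imag_oct v) = v"
  by (simp add: oct_coord_def imag_oct_def vec_eq_iff forall_7 field_simps)

lemma oct_real_imag_oct [simp]: "oct_real (imag_oct v) = 0"
  by (simp add: oct_real_def imag_oct_def)

lemma oct_coord_one [simp]: "oct_coord oct_one = 0"
  by (simp add: oct_coord_def oct_one_def vec_eq_iff forall_7)

lemma oct_real_one [simp]: "oct_real oct_one = 1"
  by (simp add: oct_real_def oct_one_def)

lemma oct_decomposition: "z = oct_real z *\<^sub>R oct_one + imag_oct (oct_coord z)"
  by (cases z) (simp add: oct_real_def oct_one_def imag_oct_def oct_coord_def vec_eq_iff forall_3 field_simps)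

lemma oct_extend_coord: "oct_coord (oct_extend g z) = g *v oct_coord z" "oct_real (oct_extend g z) = oct_real z"
  by (simp_all add: oct_extend_def linear_add[OF linear_oct_coord] linear_scale[OF linear_oct_coord]
     linear_add[OF linear_oct_real] linear_scale[OF linear_oct_real])

lemma oct_extend_compose: "oct_extend g (oct_extend h z) = oct_extend (g ** h) z"
  unfolding oct_extend_def[of g] oct_extend_coord oct_extend_def[of "g ** h"] by (simp add: matrix_vector_mul_assoc)

lemma oct_extend_id: "oct_extend (mat 1) z = z"
  unfolding oct_extend_def using oct_decomposition by simp

text \<open>Both sides are bilinear in the octonions, and in components the claim is a polynomial identity. To
  let \<open>algebra_simps\<close> decide it, \<open>sqrt 2\<close> is written as \<open>2 q\<close> with \<open>q\<^sup>2 = 1/2\<close>, which removes all divisions by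
  \<open>sqrt 2\<close>.\<close>

lemma g2_algebra_derivation:
  fixes z z' :: split_octonion
  assumes "M \<in> g2_algebra"
  defines "D \<equiv> \<lambda>z. imag_oct (M *v oct_coord z)"
  shows "D (oct_mult z z') = oct_mult (D z) z' + oct_mult z (D z')"
proof -
  obtain A X r Y Z s W where M: "M = g2_mat A X r Y Z s W" using assms by (auto simp: g2_algebra_def)
  obtain a x y b where z: "z = (a, x, y, b)" by (cases z)
  obtain a' x' y' b' where z': "z' = (a', x', y', b')" by (cases z')
  define q :: real where "q = sqrt 2 / 2"
  have q: "q * q = 1 / 2" "q * (q * c) = c / 2" for c by (simp_all add: q_def mult.assoc[symmetric])
  have sq: "sqrt 2 = 2 * q" by (simp add: q_def)
  have div: "c / sqrt 2 = c * q" for c by (simp add: q_def field_simps)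
  show ?thesis unfolding D_def M g2_mat_vector_mult z z' imag_oct_def oct_coord_def div unfolding sq
    by (simp add: vec_eq_iff forall_3 cross3_def inner_vec_def sum_3 trace_def sum_2)
       (simp add: algebra_simps q)
qed

section \<open>One-parameter subgroups\<close>

lemma bounded_bilinear_oct_mult: "bounded_bilinear oct_mult"
  unfolding bilinear_conv_bounded_bilinear[symmetric] bilinear_def
  by (auto intro!: linearI simp: cross3_def inner_vec_def vec_eq_iff forall_3 sum_3 algebra_simps)

lemma oct_extend_derivative:
  assumes "(g has_vector_derivative g') (at t)" "(z has_vector_derivative z') (at t)"
  shows "((\<lambda>t. oct_extend (g t) (z t)) has_vector_derivative
     oct_extend (g t) z' + imag_oct (g' *v oct_coord (z t))) (at t)"
proof -
  have c: "((\<lambda>t. oct_coord (z t)) has_vector_derivative oct_coord z') (at t)"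
    by (rule bounded_linear.has_vector_derivative[OF linear_oct_coord[unfolded linear_conv_bounded_linear] assms(2)])
  have r: "((\<lambda>t. oct_real (z t) *\<^sub>R oct_one) has_vector_derivative oct_real z' *\<^sub>R oct_one) (at t)"
    by (intro bounded_linear.has_vector_derivative[OF bounded_linear_scaleR_left]
        bounded_linear.has_vector_derivative[OF linear_oct_real[unfolded linear_conv_bounded_linear] assms(2)])
  have "((\<lambda>t. imag_oct (g t *v oct_coord (z t))) has_vector_derivative
     imag_oct (g t *v oct_coord z' + g' *v oct_coord (z t))) (at t)"
    by (intro bounded_linear.has_vector_derivative[OF linear_imag_oct[unfolded linear_conv_bounded_linear]]
        bounded_bilinear.has_vector_derivative[OF bounded_bilinear_matrix_vector_mult] assms c)
  from has_vector_derivative_add[OF r this] show ?thesis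
    unfolding oct_extend_def by (simp add: linear_add[OF linear_imag_oct] add.assoc)
qed

text \<open>Let \<open>D\<close> be the derivation given by \<open>B\<close>. The curve \<open>q(t) = exp (t D) z \<cdot> exp (t D) z'\<close> satisfies \<open>q' = D q\<close>
  by the Leibniz rule, so \<open>exp (-t D) q(t)\<close> is constant and equal to its value \<open>z z'\<close> at \<open>t = 0\<close>.\<close>

lemma oct_extend_matrix_exp_mult:
  assumes B: "B \<in> g2_algebra"
  shows "oct_extend (matrix_exp B) (oct_mult z z') = oct_mult (oct_extend (matrix_exp B) z) (oct_extend (matrix_exp B) z')"
proof -
  define E where "E t = matrix_exp (t *\<^sub>R B)" for t
  define F where "F t = matrix_exp (t *\<^sub>R (- B))" for t
  define D where "D z = imag_oct (B *v oct_coord z)" for z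
  define q where "q t = oct_mult (oct_extend (E t) z) (oct_extend (E t) z')" for t
  have E: "(E has_vector_derivative B ** E t) (at t)" for t
    unfolding E_def by (rule matrix_exp_has_vector_derivative)
  have F: "(F has_vector_derivative - B ** F t) (at t)" for t
    unfolding F_def by (rule matrix_exp_has_vector_derivative)
  have FB: "F t ** B = B ** F t" for t
    unfolding F_def by (rule matrix_exp_commute) (simp add: matrix_mult_scaleR_left matrix_mult_scaleR_right
        bounded_bilinear.minus_left[OF bounded_bilinear_matrix_mult] bounded_bilinear.minus_right[OF bounded_bilinear_matrix_mult])
  have e: "((\<lambda>t. oct_extend (E t) z) has_vector_derivative D (oct_extend (E t) z)) (at t)" for t z
    using oct_extend_derivative[OF E has_vector_derivative_const[of z], where t=t]
    by (simp add: D_def oct_extend_coord matrix_vector_mul_assoc)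
       (simp add: oct_extend_def linear_0[OF linear_oct_real] linear_0[OF linear_oct_coord] linear_0[OF linear_imag_oct])
  have q: "(q has_vector_derivative D (q t)) (at t)" for t
  proof -
    have "(q has_vector_derivative oct_mult (oct_extend (E t) z) (D (oct_extend (E t) z')) + oct_mult (D (oct_extend (E t) z)) (oct_extend (E t) z')) (at t)"
      unfolding q_def by (rule bounded_bilinear.has_vector_derivative[OF bounded_bilinear_oct_mult e e])
    then show ?thesis unfolding q_def D_def g2_algebra_derivation[OF B] by (simp add: add.commute)
  qed
  have "((\<lambda>t. oct_extend (F t) (q t)) has_vector_derivative 0) (at t within UNIV)" for t
  proof -
    have "oct_extend (F t) (D (q t)) + imag_oct ((- B ** F t) *v oct_coord (q t)) = 0"
      unfolding oct_extend_def D_def oct_coord_imag_oct oct_real_imag_oct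
      by (simp add: matrix_vector_mul_assoc FB linear_add[OF linear_imag_oct, symmetric]
          bounded_bilinear.minus_left[OF bounded_bilinear_matrix_mult] bounded_bilinear.minus_left[OF bounded_bilinear_matrix_vector_mult]
          linear_0[OF linear_imag_oct])
    then show ?thesis using oct_extend_derivative[OF F q, of t] by simp
  qed
  then obtain c where c: "\<And>t. t \<in> UNIV \<Longrightarrow> oct_extend (F t) (q t) = c"
    using has_vector_derivative_zero_constant[OF convex_UNIV, of "\<lambda>t. oct_extend (F t) (q t)"] by blast
  have "oct_extend (F 1) (q 1) = oct_extend (F 0) (q 0)" using c by simp
  also have "\<dots> = oct_mult z z'" by (simp add: F_def E_def q_def matrix_exp_0 oct_extend_id)
  finally have "oct_extend (E 1) (oct_mult z z') = oct_extend (E 1 ** F 1) (q 1)"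
    by (simp add: oct_extend_compose[symmetric])
  also have "\<dots> = q 1" using matrix_exp_inverse[of "- B"] by (simp add: E_def F_def oct_extend_id)
  finally show ?thesis by (simp add: q_def E_def)
qed

lemma matrix_exp_in_G2_group:
  assumes B: "B \<in> g2_algebra"
  shows "matrix_exp B \<in> G2_group"
proof -
  let ?\<Phi> = "oct_extend (matrix_exp B)"
  have "linear ?\<Phi>"
    unfolding oct_extend_def
    by (intro linear_compose_add linear_compose[OF linear_oct_real, unfolded o_def, of "\<lambda>x. x *\<^sub>R oct_one"]
        linear_compose[OF _ linear_imag_oct, unfolded o_def] linear_compose[OF linear_oct_coord, unfolded o_def]
        matrix_vector_mul_linear bounded_linear.linear bounded_linear_scaleR_left)
  moreover have "bij ?\<Phi>"
    by (rule bij_betw_byWitness[where f' = "oct_extend (matrix_exp (- B))"])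
       (use matrix_exp_inverse[of B] matrix_exp_inverse[of "- B"] in \<open>auto simp: oct_extend_compose oct_extend_id\<close>)
  moreover have "?\<Phi> (imag_oct v) = imag_oct (matrix_exp B *v v)" for v by (simp add: oct_extend_def)
  ultimately show ?thesis
    unfolding G2_group_def oct_automorphism_def using oct_extend_matrix_exp_mult[OF B] by blast
qed

lemma p_algebra_iff: "B \<in> p_algebra \<longleftrightarrow> (\<exists>A Z s W. B = g2_mat A 0 0 0 Z s W)"
  unfolding g2_filtration_def by auto

lemma g2_plus_iff: "B \<in> g2_plus \<longleftrightarrow> (\<exists>Z s W. B = g2_mat 0 0 0 0 Z s W)"
  unfolding g2_filtration_def by auto

lemma p_algebra_parts: "B \<in> p_algebra \<longleftrightarrow> B \<in> g2_algebra \<and> part_X B = 0 \<and> part_r B = 0 \<and> part_Y B = 0"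
proof
  show "B \<in> g2_algebra \<and> part_X B = 0 \<and> part_r B = 0 \<and> part_Y B = 0" if "B \<in> p_algebra"
    using that unfolding p_algebra_iff by force
  show "B \<in> p_algebra" if "B \<in> g2_algebra \<and> part_X B = 0 \<and> part_r B = 0 \<and> part_Y B = 0"
    using that g2_mat_parts[of B] unfolding p_algebra_iff by metis
qed

lemma g2_plus_parts: "B \<in> g2_plus \<longleftrightarrow> B \<in> p_algebra \<and> part_A B = 0"
proof
  show "B \<in> p_algebra \<and> part_A B = 0" if "B \<in> g2_plus"
    using that unfolding g2_plus_iff p_algebra_iff by force
  show "B \<in> g2_plus" if "B \<in> p_algebra \<and> part_A B = 0"
    using that unfolding g2_plus_iff p_algebra_iff by force
qed

lemma p_algebra_scaleR: "B \<in> p_algebra \<Longrightarrow> t *\<^sub>R B \<in> p_algebra"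
proof -
  assume "B \<in> p_algebra"
  then obtain A Z s W where "B = g2_mat A 0 0 0 Z s W" unfolding p_algebra_iff by blast
  then have "t *\<^sub>R B = g2_mat (t *\<^sub>R A) 0 0 0 (t *\<^sub>R Z) (t * s) (t *\<^sub>R W)"
    using g2_mat_comb[of t A 0 0 0 Z s W 0 0 0 0 0 0 0 0] by simp
  then show ?thesis unfolding p_algebra_iff by blast
qed

lemma g2_plus_scaleR: "B \<in> g2_plus \<Longrightarrow> t *\<^sub>R B \<in> g2_plus"
proof -
  assume "B \<in> g2_plus"
  then obtain Z s W where "B = g2_mat 0 0 0 0 Z s W" unfolding g2_plus_iff by blast
  then have "t *\<^sub>R B = g2_mat 0 0 0 0 (t *\<^sub>R Z) (t * s) (t *\<^sub>R W)"
    using g2_mat_comb[of t 0 0 0 0 Z s W 0 0 0 0 0 0 0 0] by simp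
  then show ?thesis unfolding g2_plus_iff by blast
qed

text \<open>The first basis vector is an eigenvector of every element of \<open>p\<close>, so the exponential preserves the ray
  that it spans.\<close>

lemma matrix_exp_in_P_group:
  assumes B: "B \<in> p_algebra"
  shows "matrix_exp B \<in> P_group"
proof -
  obtain A Z s W where B': "B = g2_mat A 0 0 0 Z s W" using B unfolding p_algebra_iff by blast
  have "B *v axis 1 1 = (- trace A) *\<^sub>R axis 1 1"
    unfolding B' g2_mat_vector_mult by (simp add: vec_eq_iff forall_7 axis_def)
  from matrix_exp_eigenvector[OF this] matrix_exp_in_G2_group[of B] B p_algebra_parts
  show ?thesis unfolding P_group_def by (auto intro!: exI[of _ "exp (- trace A)"])
qed

text \<open>The operator has degree one for the grading of the 7-dimensional representation. Although this only
  makes its fifth power vanish, its cube is already zero, so the series ends with the quadratic term.\<close>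

lemma matrix_exp_grade_1:
  "matrix_exp (g2_mat 0 0 0 0 Z 0 0) *v v = (let w = Z$1 * v$6 - Z$2 * v$5 in vector
     [v$1 + Z$1 * v$2 + Z$2 * v$3, v$2 - sqrt 2 * Z$2 * v$4 - Z$2 * w, v$3 + sqrt 2 * Z$1 * v$4 + Z$1 * w,
      v$4 + sqrt 2 * w, v$5 - Z$1 * v$7, v$6 - Z$2 * v$7, v$7])"
proof -
  let ?M = "g2_mat 0 0 0 0 Z 0 0"
  define u :: "real^7" where "u = vector [0, - 2 * Z$2 * (Z$1 * v$6 - Z$2 * v$5), 2 * Z$1 * (Z$1 * v$6 - Z$2 * v$5), 0, 0, 0, 0 :: real]"
  have [simp]: "sqrt 2 * (sqrt 2 * c) = 2 * c" for c by (simp add: mult.assoc[symmetric])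
  have 2: "?M *v (?M *v v) = u"
    unfolding g2_mat_vector_mult u_def by (simp add: vec_eq_iff forall_7 trace_def algebra_simps)
  have "?M *v u = 0" unfolding g2_mat_vector_mult u_def by (simp add: vec_eq_iff forall_7 trace_def algebra_simps)
  then have "((*v) ?M ^^ 3) v = 0" using 2 by (simp add: eval_nat_numeral)
  from matrix_exp_nilpotent[OF this] 2
  have "matrix_exp ?M *v v = v + ?M *v v + (1/2) *\<^sub>R u" by (simp add: eval_nat_numeral)
  then show ?thesis unfolding g2_mat_vector_mult u_def Let_def
    by (simp add: vec_eq_iff forall_7 trace_def algebra_simps add_divide_distrib diff_divide_distrib)
qed

lemma matrix_exp_grade_2:
  "matrix_exp (g2_mat 0 0 0 0 0 s 0) *v v = vector
     [v$1 + s * v$4 + s * s * v$7 / 2, v$2 - s * v$6 / sqrt 2, v$3 + s * v$5 / sqrt 2, v$4 + s * v$7, v$5, v$6, v$7]"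
proof -
  let ?M = "g2_mat 0 0 0 0 0 s 0"
  define u :: "real^7" where "u = vector [s * s * v$7, 0, 0, 0, 0, 0, 0 :: real]"
  have 2: "?M *v (?M *v v) = u"
    unfolding g2_mat_vector_mult u_def by (simp add: vec_eq_iff forall_7 trace_def algebra_simps add_divide_distrib diff_divide_distrib)
  have "?M *v u = 0" unfolding g2_mat_vector_mult u_def by (simp add: vec_eq_iff forall_7 trace_def algebra_simps add_divide_distrib diff_divide_distrib)
  then have "((*v) ?M ^^ 3) v = 0" using 2 by (simp add: eval_nat_numeral)
  from matrix_exp_nilpotent[OF this] 2
  have "matrix_exp ?M *v v = v + ?M *v v + (1/2) *\<^sub>R u" by (simp add: eval_nat_numeral)
  then show ?thesis unfolding g2_mat_vector_mult u_def Let_def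
    by (simp add: vec_eq_iff forall_7 trace_def algebra_simps add_divide_distrib diff_divide_distrib)
qed

lemma matrix_exp_grade_3:
  "matrix_exp (g2_mat 0 0 0 0 0 0 W) *v v = vector
     [v$1 + W$1 * v$5 + W$2 * v$6, v$2 - W$1 * v$7, v$3 - W$2 * v$7, v$4, v$5, v$6, v$7]"
proof -
  let ?M = "g2_mat 0 0 0 0 0 0 W"
  have 2: "?M *v (?M *v v) = 0"
    unfolding g2_mat_vector_mult by (simp add: vec_eq_iff forall_7 trace_def algebra_simps add_divide_distrib diff_divide_distrib)
  then have "((*v) ?M ^^ 2) v = 0" by (simp add: eval_nat_numeral)
  from matrix_exp_nilpotent[OF this] 2
  have "matrix_exp ?M *v v = v + ?M *v v" by (simp add: eval_nat_numeral)
  then show ?thesis unfolding g2_mat_vector_mult Let_def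
    by (simp add: vec_eq_iff forall_7 trace_def algebra_simps add_divide_distrib diff_divide_distrib)
qed

section \<open>Products of manifolds and coordinate vector fields\<close>

lemma smooth_atI:
  assumes "(U, \<phi>) \<in> A" "(V, \<psi>) \<in> B" "open N" "p \<in> N" "N \<subseteq> U" "f ` N \<subseteq> V"
    "smooth_on (\<phi> ` N) (\<psi> \<circ> f \<circ> inv_into U \<phi>)"
  shows "smooth_at A B f p"
  using assms unfolding smooth_at_def by blast

lemma smooth_on_Pair:
  assumes "open S" "smooth_on S f" "smooth_on S g"
  shows "smooth_on S (\<lambda>x. (f x, g x))"
proof -
  have 1: "bounded_linear (\<lambda>x. (x, 0))" by (intro bounded_linear_Pair bounded_linear_ident bounded_linear_zero)
  have 2: "bounded_linear (\<lambda>x. (0, x))" by (intro bounded_linear_Pair bounded_linear_ident bounded_linear_zero)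
  from smooth_on_add[OF assms(1) smooth_on_linear_comp[OF assms(1) 1 assms(2)] smooth_on_linear_comp[OF assms(1) 2 assms(3)]]
  show ?thesis by simp
qed

text \<open>The action of the structure group is smooth as a map on a product, so products of manifolds are
  needed to compose it with curves and sections.\<close>

lemma smooth_atlas_prod:
  fixes A :: "('a::{t2_space,second_countable_topology}, 'd::euclidean_space) atlas"
    and B :: "('b::{t2_space,second_countable_topology}, 'e::euclidean_space) atlas"
  assumes A: "smooth_atlas A" and B: "smooth_atlas B"
  shows "smooth_atlas (prod_atlas A B)"
proof -
  have inv: "inv_into (U \<times> V) (\<lambda>(x, y). (\<phi> x, \<psi> y)) z = (inv_into U \<phi> (fst z), inv_into V \<psi> (snd z))"
    if "(U, \<phi>) \<in> A" "(V, \<psi>) \<in> B" "z \<in> \<phi> ` U \<times> \<psi> ` V" for U \<phi> V \<psi> z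
    using that chart_properties(5)[OF A that(1)] chart_properties(5)[OF B that(2)]
    by (intro inv_into_f_eq) (auto simp: inj_on_def)
  have im: "(\<lambda>(x, y). (\<phi> x, \<psi> y)) ` (U \<times> V) = \<phi> ` U \<times> \<psi> ` V" for U V \<phi> \<psi> by force
  have "(\<Union>(W, \<kappa>)\<in>prod_atlas A B. W) = UNIV"
  proof (intro set_eqI iffI UNIV_I)
    fix z :: "'a \<times> 'b"
    obtain U \<phi> where U: "(U, \<phi>) \<in> A" "fst z \<in> U" using chart_at[OF A] .
    obtain V \<psi> where V: "(V, \<psi>) \<in> B" "snd z \<in> V" using chart_at[OF B] .
    have "(U \<times> V, \<lambda>(x, y). (\<phi> x, \<psi> y)) \<in> prod_atlas A B" unfolding prod_atlas_def using U V by blast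
    moreover have "z \<in> U \<times> V" using U V by (simp add: mem_Times_iff)
    ultimately show "z \<in> (\<Union>(W, \<kappa>)\<in>prod_atlas A B. W)" by blast
  qed
  moreover have "open (U \<times> V) \<and> open ((\<lambda>(x, y). (\<phi> x, \<psi> y)) ` (U \<times> V)) \<and>
      homeomorphism (U \<times> V) ((\<lambda>(x, y). (\<phi> x, \<psi> y)) ` (U \<times> V)) (\<lambda>(x, y). (\<phi> x, \<psi> y)) (inv_into (U \<times> V) (\<lambda>(x, y). (\<phi> x, \<psi> y)))"
    if U: "(U, \<phi>) \<in> A" and V: "(V, \<psi>) \<in> B" for U \<phi> V \<psi>
  proof -
    note cU = chart_properties[OF A U] and cV = chart_properties[OF B V]
    have c1: "continuous_on (U \<times> V) (\<lambda>z. (\<phi> (fst z), \<psi> (snd z)))"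
      by (intro continuous_on_Pair continuous_on_compose2[OF cU(3)] continuous_on_compose2[OF cV(3)] continuous_intros) auto
    have c2: "continuous_on (\<phi> ` U \<times> \<psi> ` V) (\<lambda>z. (inv_into U \<phi> (fst z), inv_into V \<psi> (snd z)))"
      by (intro continuous_on_Pair continuous_on_compose2[OF cU(4)] continuous_on_compose2[OF cV(4)] continuous_intros) auto
    have "homeomorphism (U \<times> V) (\<phi> ` U \<times> \<psi> ` V) (\<lambda>z. (\<phi> (fst z), \<psi> (snd z))) (\<lambda>z. (inv_into U \<phi> (fst z), inv_into V \<psi> (snd z)))"
      by (rule homeomorphismI[OF c1 c2]) (use cU(5) cV(5) in \<open>auto simp: f_inv_into_f inv_into_into\<close>)
    then have "homeomorphism (U \<times> V) (\<phi> ` U \<times> \<psi> ` V) (\<lambda>(x, y). (\<phi> x, \<psi> y)) (inv_into (U \<times> V) (\<lambda>(x, y). (\<phi> x, \<psi> y)))"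
      by (rule homeomorphism_cong) (use inv[OF U V] in auto)
    then show ?thesis unfolding im using cU(1,2) cV(1,2) by (simp add: open_Times)
  qed
  then have "\<forall>(W, \<kappa>)\<in>prod_atlas A B. open W \<and> open (\<kappa> ` W) \<and> homeomorphism W (\<kappa> ` W) \<kappa> (inv_into W \<kappa>)"
    unfolding prod_atlas_def by fast
  moreover have "smooth_on ((\<lambda>(x, y). (\<phi> x, \<psi> y)) ` ((U \<times> V) \<inter> (U' \<times> V')))
      ((\<lambda>(x, y). (\<phi>' x, \<psi>' y)) \<circ> inv_into (U \<times> V) (\<lambda>(x, y). (\<phi> x, \<psi> y)))"
    if U: "(U, \<phi>) \<in> A" and V: "(V, \<psi>) \<in> B" and U': "(U', \<phi>') \<in> A" and V': "(V', \<psi>') \<in> B" for U \<phi> V \<psi> U' \<phi>' V' \<psi>'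
  proof -
    note cU = chart_properties[OF A U] and cV = chart_properties[OF B V]
    note cU' = chart_properties[OF A U'] and cV' = chart_properties[OF B V']
    have o1: "open (\<phi> ` (U \<inter> U'))" by (rule cU(6)) (use cU cU' in auto)
    have o2: "open (\<psi> ` (V \<inter> V'))" by (rule cV(6)) (use cV cV' in auto)
    have o: "open (\<phi> ` (U \<inter> U') \<times> \<psi> ` (V \<inter> V'))" using o1 o2 by (rule open_Times)
    have sm: "smooth_on (\<phi> ` (U \<inter> U') \<times> \<psi> ` (V \<inter> V'))
      (\<lambda>z. ((\<phi>' \<circ> inv_into U \<phi>) (fst z), (\<psi>' \<circ> inv_into V \<psi>) (snd z)))"
      by (rule smooth_on_Pair[OF o smooth_on_compose[OF o o1 _ smooth_on_linear[OF o bounded_linear_fst] chart_transition[OF A U U']]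
             smooth_on_compose[OF o o2 _ smooth_on_linear[OF o bounded_linear_snd] chart_transition[OF B V V']]]) auto
    have eq: "((\<phi>' \<circ> inv_into U \<phi>) (fst z), (\<psi>' \<circ> inv_into V \<psi>) (snd z)) =
        ((\<lambda>(x, y). (\<phi>' x, \<psi>' y)) \<circ> inv_into (U \<times> V) (\<lambda>(x, y). (\<phi> x, \<psi> y))) z"
      if "z \<in> \<phi> ` (U \<inter> U') \<times> \<psi> ` (V \<inter> V')" for z
    proof -
      have "z \<in> \<phi> ` U \<times> \<psi> ` V" using that by auto
      from inv[OF U V this] show ?thesis by simp
    qed
    have "smooth_on (\<phi> ` (U \<inter> U') \<times> \<psi> ` (V \<inter> V'))
       ((\<lambda>(x, y). (\<phi>' x, \<psi>' y)) \<circ> inv_into (U \<times> V) (\<lambda>(x, y). (\<phi> x, \<psi> y)))"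
      by (rule iffD1[OF smooth_on_cong[OF o eq] sm])
    moreover have "(U \<times> V) \<inter> (U' \<times> V') = (U \<inter> U') \<times> (V \<inter> V')" by auto
    ultimately show ?thesis by (simp only: im)
  qed
  then have "\<forall>(W, \<kappa>)\<in>prod_atlas A B. \<forall>(W', \<kappa>')\<in>prod_atlas A B. smooth_on (\<kappa> ` (W \<inter> W')) (\<kappa>' \<circ> inv_into W \<kappa>)"
    unfolding prod_atlas_def by fast
  ultimately show ?thesis unfolding smooth_atlas_def by (intro conjI)
qed

lemma smooth_at_Pair:
  assumes A: "smooth_atlas A" and B: "smooth_atlas B" and C: "smooth_atlas C"
    and f: "smooth_at A B f p" and g: "smooth_at A C g p"
  shows "smooth_at A (prod_atlas B C) (\<lambda>q. (f q, g q)) p"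
proof -
  obtain U \<phi> where U: "(U, \<phi>) \<in> A" "p \<in> U" using chart_at[OF A] .
  obtain V \<psi> where V: "(V, \<psi>) \<in> B" "f p \<in> V" using chart_at[OF B] .
  obtain W \<kappa> where W: "(W, \<kappa>) \<in> C" "g p \<in> W" using chart_at[OF C] .
  obtain N1 where N1: "open N1" "p \<in> N1" "N1 \<subseteq> U" "f ` N1 \<subseteq> V" "smooth_on (\<phi> ` N1) (\<psi> \<circ> f \<circ> inv_into U \<phi>)"
    using smooth_at_chart[OF A B f U V] .
  obtain N2 where N2: "open N2" "p \<in> N2" "N2 \<subseteq> U" "g ` N2 \<subseteq> W" "smooth_on (\<phi> ` N2) (\<kappa> \<circ> g \<circ> inv_into U \<phi>)"
    using smooth_at_chart[OF A C g U W] .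
  define N where "N = N1 \<inter> N2"
  have N: "open N" "p \<in> N" "N \<subseteq> U" "N \<subseteq> N1" "N \<subseteq> N2" unfolding N_def using N1 N2 by auto
  have o: "open (\<phi> ` N)" using chart_properties(6)[OF A U(1)] N by auto
  have "smooth_on (\<phi> ` N) (\<lambda>z. ((\<psi> \<circ> f \<circ> inv_into U \<phi>) z, (\<kappa> \<circ> g \<circ> inv_into U \<phi>) z))"
    by (rule smooth_on_Pair[OF o smooth_on_subset[OF N1(5)] smooth_on_subset[OF N2(5)]]) (use N in auto)
  then have sm: "smooth_on (\<phi> ` N) ((\<lambda>(x, y). (\<psi> x, \<kappa> y)) \<circ> (\<lambda>q. (f q, g q)) \<circ> inv_into U \<phi>)" by (simp add: o_def)
  have W': "(V \<times> W, \<lambda>(x, y). (\<psi> x, \<kappa> y)) \<in> prod_atlas B C" unfolding prod_atlas_def using V W by blast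
  have "f q \<in> V" "g q \<in> W" if "q \<in> N" for q
    using that subsetD[OF N1(4) imageI] subsetD[OF N2(4) imageI] subsetD[OF N(4)] subsetD[OF N(5)] by simp_all
  then have im: "(\<lambda>q. (f q, g q)) ` N \<subseteq> V \<times> W" by auto
  show ?thesis by (rule smooth_atI[OF U(1) W' N(1-3) im sm])
qed

lemma smooth_at_const_manifold:
  assumes A: "smooth_atlas A" and B: "smooth_atlas B"
  shows "smooth_at A B (\<lambda>x. c) p"
proof -
  obtain U \<phi> where U: "(U, \<phi>) \<in> A" "p \<in> U" using chart_at[OF A] .
  obtain V \<psi> where V: "(V, \<psi>) \<in> B" "c \<in> V" using chart_at[OF B] .
  note cU = chart_properties[OF A U(1)]
  have sm: "smooth_on (\<phi> ` U) (\<psi> \<circ> (\<lambda>x. c) \<circ> inv_into U \<phi>)"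
    using smooth_on_const[OF cU(2)] by (simp add: o_def)
  have im: "(\<lambda>x. c) ` U \<subseteq> V" using V by auto
  show ?thesis by (rule smooth_atI[OF U(1) V(1) cU(1) U(2) order_refl im sm])
qed

lemma smooth_coordinate_vector_field:
  assumes A: "smooth_atlas A" and U: "(U, \<phi>) \<in> A"
  shows "smooth_vector_field_on A U (\<lambda>q. chart_vec A U \<phi> q v)"
proof -
  note cU = chart_properties[OF A U(1)]
  have "smooth_at A std_atlas (\<lambda>z. chart_vec A U \<phi> z v f) q" if q: "q \<in> U" and f: "smooth_at A std_atlas f q" for q f
  proof -
    let ?f = "\<lambda>z. f (inv_into U \<phi> z)"
    obtain N where N: "open N" "q \<in> N" "N \<subseteq> U" "open (\<phi> ` N)" "smooth_on (\<phi> ` N) ?f"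
      using smooth_at_std_obtain[OF A U q f] .
    have eq: "chart_vec A U \<phi> (inv_into U \<phi> z) v f = frechet_derivative ?f (at z) v" if z: "z \<in> \<phi> ` N" for z
    proof -
      obtain r where r: "r \<in> N" "z = \<phi> r" using z by blast
      then have rU: "r \<in> U" and i: "inv_into U \<phi> z = r" using N(3) cU(5) by auto
      have "smooth_at A std_atlas f r" unfolding smooth_at_std_iff[OF A U rU] using N r by blast
      then show ?thesis unfolding i by (simp add: chart_vec_def r)
    qed
    have "smooth_on (\<phi> ` N) (\<lambda>z. chart_vec A U \<phi> (inv_into U \<phi> z) v f)"
      by (rule iffD2[OF smooth_on_cong[OF N(4) eq] smooth_on_derivative[OF N(5)]])
    then show ?thesis unfolding smooth_at_std_iff[OF A U q] using N by blast
  qed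
  then show ?thesis
    unfolding smooth_vector_field_on_def using cU(1) chart_vec_in_tangent_space[OF A U] by blast
qed

section \<open>The principal bundle and the Cartan connection\<close>

locale canonical_235_geometry =
  fixes G :: "('m::{t2_space,second_countable_topology}, 'g::{t2_space,second_countable_topology},
               'h::{t2_space,second_countable_topology}) geometry"
    and D :: "'m \<Rightarrow> 'm tv set" and pos :: "'m \<Rightarrow> 'm tv \<Rightarrow> 'm tv \<Rightarrow> bool"
  assumes canonical: "canonical_geometry G D pos"
begin

abbreviation "AG \<equiv> atlasG G"
abbreviation "AM \<equiv> atlasM G"
abbreviation "TG u \<equiv> tangent_space AG u"
abbreviation "TM x \<equiv> tangent_space AM x"
abbreviation "TH w \<equiv> tangent_space (atlasG0 G) w"
abbreviation "projD u \<equiv> pushforward AM (proj G) u"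
abbreviation "quotD u \<equiv> pushforward (atlasG0 G) (quot G) u"

lemma
  shows atlases: "smooth_atlas AM" "smooth_atlas AG" "smooth_atlas (atlasG0 G)"
  and principal: "principal_bundle AM AG P_group (proj G) (act G)"
  and connection: "cartan_connection G"
  and regular: "regular_geometry G"
  and inducesD: "induces_distribution G D pos"
  and quotient: "quotient_by_P_plus G"
  using canonical unfolding canonical_geometry_def parabolic_geometry_def quotient_by_P_plus_def by blast+

lemma bundle_facts:
  "smooth_map AG AM (proj G)" "\<forall>u. act G u (mat 1) = u"
  "\<forall>u. \<forall>g\<in>P_group. proj G (act G u g) = proj G u"
  "smooth_map_on_subset (prod_atlas AG std_atlas) AG (UNIV \<times> P_group) (\<lambda>(u, g). act G u g)"
  "\<forall>u. \<forall>g\<in>P_group. \<forall>h\<in>P_group. act G (act G u g) h = act G u (g ** h)"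
  using principal unfolding principal_bundle_def by - ((elim conjE, assumption)+)

lemma quotient_facts:
  "smooth_map AG (atlasG0 G) (quot G)" "surj (quot G)"
  "\<forall>u. quotD u ` TG u = TH (quot G u)"
  "\<forall>u v. quot G u = quot G v \<longleftrightarrow> (\<exists>g\<in>P_plus. v = act G u g)"
  "\<forall>u. proj0 G (quot G u) = proj G u"
  using quotient unfolding quotient_by_P_plus_def by - ((elim conjE, assumption)+)

lemma smooth_proj: "smooth_at AG AM (proj G) u"
  using bundle_facts(1) unfolding smooth_map_def by simp

lemma smooth_quot: "smooth_at AG (atlasG0 G) (quot G) u"
  using quotient_facts(1) unfolding smooth_map_def by simp

lemma act_one: "act G u (mat 1) = u"
  using bundle_facts(2) by simp

lemma proj_act: "g \<in> P_group \<Longrightarrow> proj G (act G u g) = proj G u"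
  using bundle_facts(3) by simp

lemma proj0_quot: "proj0 G (quot G u) = proj G u"
  using quotient_facts(5) by simp

lemma quot_act: "g \<in> P_plus \<Longrightarrow> quot G (act G u g) = quot G u"
  using quotient_facts(4) by metis

lemma surj_quot: "surj (quot G)"
  by (rule quotient_facts(2))

lemma quotD_surj: "quotD u ` TG u = TH (quot G u)"
  using quotient_facts(3) by simp

text \<open>The group is only a subset of the space of matrices, and the action is smooth in the sense that it
  extends locally to a smooth map. A map into the group may be composed with the extension, where it
  agrees with the action.\<close>

lemma smooth_act:
  assumes A: "smooth_atlas A" and a: "smooth_at A AG a p" and h: "smooth_at A std_atlas h p"
    and P: "\<And>q. h q \<in> P_group"
  shows "smooth_at A AG (\<lambda>q. act G (a q) (h q)) p"
proof -
  note bundle_facts(4)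
  moreover have "(a p, h p) \<in> UNIV \<times> P_group" using P by simp
  ultimately obtain F N where N: "open N" "(a p, h p) \<in> N"
      and F: "smooth_at (prod_atlas AG std_atlas) AG F (a p, h p)"
      and eq: "\<forall>y\<in>N \<inter> (UNIV \<times> P_group). F y = (\<lambda>(u, g). act G u g) y"
    unfolding smooth_map_on_subset_def by blast
  note pr = smooth_atlas_prod[OF atlases(2) smooth_atlas_std]
  have pair: "smooth_at A (prod_atlas AG std_atlas) (\<lambda>q. (a q, h q)) p"
    by (rule smooth_at_Pair[OF A atlases(2) smooth_atlas_std a h])
  have sm: "smooth_at A AG (\<lambda>q. F (a q, h q)) p"
    by (rule smooth_at_compose[OF A pr atlases(2) pair F])
  obtain N' where N': "open N'" "p \<in> N'" "(\<lambda>q. (a q, h q)) ` N' \<subseteq> N"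
    using smooth_at_continuous_vimage[OF A pr pair N] .
  show ?thesis
    by (rule smooth_at_cong[OF A sm N'(1,2)]) (use N'(3) eq P in auto)
qed

lemma cartan_bij: "bij_betw (cartan G u) (TG u) g2_algebra"
  using connection unfolding cartan_connection_def by blast

lemma cartan_comb: "X \<in> TG u \<Longrightarrow> Y \<in> TG u \<Longrightarrow>
   cartan G u (\<lambda>f. a * X f + b * Y f) = a *\<^sub>R cartan G u X + b *\<^sub>R cartan G u Y"
  using connection unfolding cartan_connection_def by blast

lemma cartan_fundamental: "B \<in> p_algebra \<Longrightarrow> cartan G u (fundamental_vector AG (act G) B u) = B"
  using connection unfolding cartan_connection_def by blast

lemma cartan_in_algebra: "X \<in> TG u \<Longrightarrow> cartan G u X \<in> g2_algebra"
  using cartan_bij bij_betwE by blast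

lemma cartan_inj: "X \<in> TG u \<Longrightarrow> Y \<in> TG u \<Longrightarrow> cartan G u X = cartan G u Y \<Longrightarrow> X = Y"
  using cartan_bij[of u] unfolding bij_betw_def inj_on_def by blast

lemma constant_field_in_tangent_space: "B \<in> g2_algebra \<Longrightarrow> constant_field G B u \<in> TG u"
  unfolding constant_field_def using cartan_bij[of u] by (simp add: bij_betw_def inv_into_into)

lemma cartan_constant_field: "B \<in> g2_algebra \<Longrightarrow> cartan G u (constant_field G B u) = B"
  unfolding constant_field_def using cartan_bij[of u] by (simp add: bij_betw_def f_inv_into_f)

lemma constant_field_cartan: "X \<in> TG u \<Longrightarrow> constant_field G (cartan G u X) u = X"
  by (meson cartan_constant_field cartan_in_algebra cartan_inj constant_field_in_tangent_space)

lemma cartan_sum: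
  assumes "\<And>i. i \<in> I \<Longrightarrow> X i \<in> TG u"
  shows "cartan G u (\<lambda>f. \<Sum>i\<in>I. a i * X i f) = (\<Sum>i\<in>I. a i *\<^sub>R cartan G u (X i))"
  using assms
proof (induction I rule: infinite_finite_induct)
  case (insert x F)
  have t: "(\<lambda>f. \<Sum>i\<in>F. a i * X i f) \<in> TG u" by (rule tangent_sum[OF atlases(2)]) (use insert in auto)
  show ?case using cartan_comb[OF _ t, of "X x" "a x" 1] insert by simp
qed (use cartan_comb[OF tangent_zero[OF atlases(2)] tangent_zero[OF atlases(2)], of u 0 0] in auto)

lemma g2_algebra_comb: "B \<in> g2_algebra \<Longrightarrow> C \<in> g2_algebra \<Longrightarrow> a *\<^sub>R B + b *\<^sub>R C \<in> g2_algebra"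
  unfolding g2_algebra_def using g2_mat_comb by (smt (verit) mem_Collect_eq)

text \<open>Constant fields inherit linearity from the Cartan connection because the latter is injective on each
  tangent space.\<close>

lemma constant_field_comb:
  assumes "B \<in> g2_algebra" "C \<in> g2_algebra"
  shows "constant_field G (a *\<^sub>R B + b *\<^sub>R C) u = (\<lambda>f. a * constant_field G B u f + b * constant_field G C u f)"
proof (rule cartan_inj)
  note c = constant_field_in_tangent_space[OF assms(1), of u] constant_field_in_tangent_space[OF assms(2), of u]
  show "(\<lambda>f. a * constant_field G B u f + b * constant_field G C u f) \<in> TG u" by (rule tangent_comb[OF atlases(2) c])
  show "constant_field G (a *\<^sub>R B + b *\<^sub>R C) u \<in> TG u"
    by (rule constant_field_in_tangent_space[OF g2_algebra_comb[OF assms]])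
  show "cartan G u (constant_field G (a *\<^sub>R B + b *\<^sub>R C) u) = cartan G u (\<lambda>f. a * constant_field G B u f + b * constant_field G C u f)"
    unfolding cartan_comb[OF c] cartan_constant_field[OF assms(1)] cartan_constant_field[OF assms(2)]
      cartan_constant_field[OF g2_algebra_comb[OF assms]] ..
qed

lemma fundamental_curve:
  assumes B: "B \<in> p_algebra"
  shows "smooth_at std_atlas AG (\<lambda>t. act G u (matrix_exp (t *\<^sub>R B))) 0"
proof (rule smooth_act[OF smooth_atlas_std smooth_at_const_manifold[OF smooth_atlas_std atlases(2)]])
  show "smooth_at std_atlas std_atlas (\<lambda>t. matrix_exp (t *\<^sub>R B)) 0"
    unfolding smooth_at_std_std using smooth_on_matrix_exp by blast
  show "matrix_exp (q *\<^sub>R B) \<in> P_group" for q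
    by (rule matrix_exp_in_P_group[OF p_algebra_scaleR[OF B]])
qed

lemma fundamental_in_tangent_space:
  assumes B: "B \<in> p_algebra"
  shows "fundamental_vector AG (act G) B u \<in> TG u"
  unfolding fundamental_vector_def tangent_space_def using fundamental_curve[OF B, of u]
  by (auto simp: matrix_exp_0 act_one intro!: exI[of _ "\<lambda>t. act G u (matrix_exp (t *\<^sub>R B))"])

lemma tangent_eq_fundamental:
  assumes "X \<in> TG u" "cartan G u X \<in> p_algebra"
  shows "X = fundamental_vector AG (act G) (cartan G u X) u"
  by (rule cartan_inj[OF assms(1) fundamental_in_tangent_space[OF assms(2)]])
     (simp add: cartan_fundamental[OF assms(2)])

lemma velocity_const: "velocity A (\<lambda>t. c) = (\<lambda>f. 0)"
  by (simp add: velocity_def fun_eq_iff o_def)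

text \<open>Such a vector is a fundamental vector, that is, the velocity of a curve in a fibre.\<close>

lemma projD_p_algebra:
  assumes X: "X \<in> TG u" "cartan G u X \<in> p_algebra"
  shows "projD u X = (\<lambda>f. 0)"
proof -
  let ?B = "cartan G u X"
  let ?c = "\<lambda>t. act G u (matrix_exp (t *\<^sub>R ?B))"
  have c0: "?c 0 = u" by (simp add: matrix_exp_0 act_one)
  have "X = velocity AG ?c"
    by (subst tangent_eq_fundamental[OF X]) (simp add: fundamental_vector_def)
  then have "projD u X = velocity AM (\<lambda>t. proj G (?c t))"
    using pushforward_velocity(1)[OF atlases(2,1) smooth_proj fundamental_curve[OF X(2)] c0] by simp
  also have "(\<lambda>t. proj G (?c t)) = (\<lambda>t. proj G u)"
    by (simp add: proj_act matrix_exp_in_P_group[OF p_algebra_scaleR[OF X(2)]])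
  finally show ?thesis by (simp add: velocity_const)
qed

lemma quotD_g2_plus:
  assumes X: "X \<in> TG u" "cartan G u X \<in> g2_plus"
  shows "quotD u X = (\<lambda>f. 0)"
proof -
  let ?B = "cartan G u X"
  let ?c = "\<lambda>t. act G u (matrix_exp (t *\<^sub>R ?B))"
  have p: "?B \<in> p_algebra" using X(2) g2_plus_parts by blast
  have c0: "?c 0 = u" by (simp add: matrix_exp_0 act_one)
  have "X = velocity AG ?c"
    by (subst tangent_eq_fundamental[OF X(1) p]) (simp add: fundamental_vector_def)
  then have "quotD u X = velocity (atlasG0 G) (\<lambda>t. quot G (?c t))"
    using pushforward_velocity(1)[OF atlases(2,3) smooth_quot fundamental_curve[OF p] c0] by simp
  also have "(\<lambda>t. quot G (?c t)) = (\<lambda>t. quot G u)"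
    using g2_plus_scaleR[OF X(2)] by (simp add: quot_act P_plus_def)
  finally show ?thesis by (simp add: velocity_const)
qed

text \<open>A local section through another point of the fibre is moved to \<open>u\<close> by the action; the differential of
  this translated section splits the projection.\<close>

lemma projD_surj:
  assumes \<xi>: "\<xi> \<in> TM (proj G u)"
  obtains X where "X \<in> TG u" "projD u X = \<xi>"
proof -
  let ?x = "proj G u"
  have "\<forall>x. \<exists>N \<sigma> \<psi>. open N \<and> x \<in> N \<and>
        (\<forall>y\<in>N. proj G (\<sigma> y) = y \<and> smooth_at AM AG \<sigma> y) \<and>
        (\<forall>u. proj G u \<in> N \<longrightarrow> \<psi> u \<in> P_group \<and> smooth_at AG std_atlas \<psi> u \<and> act G (\<sigma> (proj G u)) (\<psi> u) = u) \<and>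
        (\<forall>y\<in>N. \<forall>h\<in>P_group. \<psi> (act G (\<sigma> y) h) = h)"
    using principal unfolding principal_bundle_def by - (elim conjE, assumption)
  from spec[OF this, of ?x] obtain N \<sigma> \<psi> where N: "open N" "?x \<in> N"
    and *: "\<forall>y\<in>N. proj G (\<sigma> y) = y \<and> smooth_at AM AG \<sigma> y"
       "\<forall>u. proj G u \<in> N \<longrightarrow> \<psi> u \<in> P_group \<and> smooth_at AG std_atlas \<psi> u \<and> act G (\<sigma> (proj G u)) (\<psi> u) = u"
    by (elim exE conjE)
  have \<sigma>: "proj G (\<sigma> y) = y" "smooth_at AM AG \<sigma> y" if "y \<in> N" for y
    using bspec[OF *(1) that] by simp_all
  define s where "s y = act G (\<sigma> y) (\<psi> u)" for y
  have g: "\<psi> u \<in> P_group" and su: "s ?x = u" using spec[OF *(2), of u] N by (auto simp: s_def)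
  have s: "smooth_at AM AG s ?x"
    unfolding s_def by (intro smooth_act atlases smooth_at_const g \<sigma>(2)[OF N(2)])
  have ps: "proj G (s y) = y" if "y \<in> N" for y
    using that \<sigma> g by (simp add: s_def proj_act)
  have X: "pushforward AG s ?x \<xi> \<in> TG u"
    using pushforward_in_tangent_space[OF atlases(1,2) s \<xi>] su by simp
  have "projD u (pushforward AG s ?x \<xi>) = pushforward AM (\<lambda>y. proj G (s y)) ?x \<xi>"
    using pushforward_compose[OF atlases(2,1) smooth_proj, of s ?x \<xi>] su by simp
  also have "\<dots> = pushforward AM (\<lambda>y. y) ?x \<xi>"
    by (rule pushforward_local[OF atlases(1) \<xi> N]) (rule ps)
  also have "\<dots> = \<xi>" by (rule pushforward_id[OF \<xi>])
  finally show ?thesis using that X by blast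
qed

text \<open>Here \<open>P\<close> parametrises a complement of the candidate for the kernel, and \<open>F\<close> is a projection. A
  surjective linear map between spaces of the same dimension is injective, so the differential of \<open>F\<close>
  is injective on the complement.\<close>

lemma kernel_by_dimension:
  fixes P :: "'f::euclidean_space \<Rightarrow> mat7" and B :: "('n::{t2_space,second_countable_topology}, 'e::euclidean_space) atlas"
  assumes dim: "DIM('f) = DIM('e)" and B: "smooth_atlas B" and F: "smooth_at AG B F u"
    and P: "linear P" "\<And>a. P a \<in> g2_algebra"
    and surj: "\<And>\<xi>. \<xi> \<in> tangent_space B (F u) \<Longrightarrow> \<exists>a. pushforward B F u (constant_field G (P a) u) = \<xi>"
    and zero: "pushforward B F u (constant_field G (P a) u) = (\<lambda>f. 0)"
  shows "a = 0"
proof -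
  obtain L :: "'n tv \<Rightarrow> 'e" where L: "bij_betw L (tangent_space B (F u)) UNIV"
    "\<And>X Y a b. X \<in> tangent_space B (F u) \<Longrightarrow> Y \<in> tangent_space B (F u) \<Longrightarrow> L (\<lambda>f. a * X f + b * Y f) = a *\<^sub>R L X + b *\<^sub>R L Y"
    by (rule tangent_coordinates[OF B, where p = "F u"]) (rule that)
  define T where "T a = L (pushforward B F u (constant_field G (P a) u))" for a
  have t: "pushforward B F u (constant_field G (P a) u) \<in> tangent_space B (F u)" for a
    by (rule pushforward_in_tangent_space[OF atlases(2) B F constant_field_in_tangent_space[OF P(2)]])
  have comb: "T (x *\<^sub>R a + y *\<^sub>R b) = x *\<^sub>R T a + y *\<^sub>R T b" for x y a b
    unfolding T_def linear_add[OF P(1)] linear_scale[OF P(1)] constant_field_comb[OF P(2) P(2)] pushforward_comb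
    by (rule L(2)[OF t t])
  have lin: "linear T"
    using comb[of 1 _ 1] comb[of _ _ 0 0] by (intro linearI) auto
  have "surj T"
    unfolding surj_def
  proof
    fix z
    have "z \<in> L ` tangent_space B (F u)" using L(1) by (simp add: bij_betw_def)
    then obtain \<xi> where \<xi>: "\<xi> \<in> tangent_space B (F u)" "z = L \<xi>" by blast
    then show "\<exists>a. z = T a" unfolding T_def using surj[OF \<xi>(1)] by blast
  qed
  then have "inj T" using linear_surjective_imp_injective[OF lin] dim by simp
  moreover have "T a = 0 *\<^sub>R T a" unfolding T_def zero using L(2)[OF tangent_zero[OF B] tangent_zero[OF B], of 0 0] by simp
  ultimately show ?thesis using linear_0[OF lin] by (metis injD scale_zero_left)
qed

end

section \<open>Vertical vectors and constant vector fields\<close>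

lemma parts_comb:
  "part_A (a *\<^sub>R M + b *\<^sub>R N) = a *\<^sub>R part_A M + b *\<^sub>R part_A N"
  "part_X (a *\<^sub>R M + b *\<^sub>R N) = a *\<^sub>R part_X M + b *\<^sub>R part_X N"
  "part_r (a *\<^sub>R M + b *\<^sub>R N) = a * part_r M + b * part_r N"
  "part_Y (a *\<^sub>R M + b *\<^sub>R N) = a *\<^sub>R part_Y M + b *\<^sub>R part_Y N"
  by (simp_all add: part_A_def part_X_def part_r_def part_Y_def vec_eq_iff forall_2 algebra_simps)

context canonical_235_geometry begin

lemma projD_eqI:
  assumes X: "X \<in> TG u" and Y: "Y \<in> TG u"
    and e: "part_X (cartan G u X) = part_X (cartan G u Y)" "part_r (cartan G u X) = part_r (cartan G u Y)"
      "part_Y (cartan G u X) = part_Y (cartan G u Y)"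
  shows "projD u X = projD u Y"
proof -
  have t: "(\<lambda>f. 1 * X f + (-1) * Y f) \<in> TG u" by (rule tangent_comb[OF atlases(2) X Y])
  have "cartan G u (\<lambda>f. 1 * X f + (-1) * Y f) \<in> p_algebra"
    unfolding p_algebra_parts cartan_comb[OF X Y] parts_comb
    using e g2_algebra_comb[OF cartan_in_algebra[OF X] cartan_in_algebra[OF Y], of 1 "-1"] by simp
  from projD_p_algebra[OF t this]
  have "1 * projD u X f + (-1) * projD u Y f = 0" for f unfolding pushforward_comb by (rule fun_cong)
  then show ?thesis by (simp add: fun_eq_iff)
qed

lemma quotD_eqI:
  assumes X: "X \<in> TG u" and Y: "Y \<in> TG u"
    and e: "part_X (cartan G u X) = part_X (cartan G u Y)" "part_r (cartan G u X) = part_r (cartan G u Y)"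
      "part_Y (cartan G u X) = part_Y (cartan G u Y)" "part_A (cartan G u X) = part_A (cartan G u Y)"
  shows "quotD u X = quotD u Y"
proof -
  have t: "(\<lambda>f. 1 * X f + (-1) * Y f) \<in> TG u" by (rule tangent_comb[OF atlases(2) X Y])
  have "cartan G u (\<lambda>f. 1 * X f + (-1) * Y f) \<in> g2_plus"
    unfolding g2_plus_parts p_algebra_parts cartan_comb[OF X Y] parts_comb
    using e g2_algebra_comb[OF cartan_in_algebra[OF X] cartan_in_algebra[OF Y], of 1 "-1"] by simp
  from quotD_g2_plus[OF t this]
  have "1 * quotD u X f + (-1) * quotD u Y f = 0" for f unfolding pushforward_comb by (rule fun_cong)
  then show ?thesis by (simp add: fun_eq_iff)
qed

text \<open>The negative part of the Lie algebra and the base both have dimension 5.\<close>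

lemma projD_kernel:
  assumes X: "X \<in> TG u" and zero: "projD u X = (\<lambda>f. 0)"
  shows "cartan G u X \<in> p_algebra"
proof -
  define P where "P = (\<lambda>(x, r, y). g2_mat 0 x r y 0 0 0)"
  have P: "linear P"
    by (rule linearI) (use g2_mat_comb[where a=1 and b=1 and A=0 and Z=0 and s=0 and W=0 and A'=0 and Z'=0 and s'=0 and W'=0]
        g2_mat_comb[where b=0 and A=0 and Z=0 and s=0 and W=0 and A'=0 and Z'=0 and s'=0 and W'=0] in \<open>auto simp: P_def\<close>)
  have Pg: "P a \<in> g2_algebra" for a by (simp add: P_def split: prod.split)
  let ?c = "\<lambda>X. (part_X (cartan G u X), part_r (cartan G u X), part_Y (cartan G u X))"
  have eq: "projD u (constant_field G (P (?c X)) u) = projD u X" if "X \<in> TG u" for X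
    by (rule projD_eqI[OF constant_field_in_tangent_space[OF Pg] that])
       (simp_all only: cartan_constant_field[OF Pg], simp_all add: P_def)
  have "?c X = 0"
  proof (rule kernel_by_dimension[OF _ atlases(1) smooth_proj P Pg])
    show "DIM((real^2) \<times> real \<times> (real^2)) = DIM(real^5)" by simp
    show "\<exists>a. projD u (constant_field G (P a) u) = \<xi>" if \<xi>: "\<xi> \<in> TM (proj G u)" for \<xi>
    proof -
      obtain Y where Y: "Y \<in> TG u" "projD u Y = \<xi>" using projD_surj[OF \<xi>] .
      show ?thesis by (rule exI[of _ "?c Y"]) (simp only: eq[OF Y(1)] Y(2))
    qed
    show "projD u (constant_field G (P (?c X)) u) = (\<lambda>f. 0)" using eq[OF X] zero by simp
  qed
  then show ?thesis unfolding p_algebra_parts using cartan_in_algebra[OF X] by (simp add: zero_prod_def)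
qed

text \<open>The nonpositive part of the Lie algebra and the quotient by \<open>P\<^sub>+\<close> both have dimension 9.\<close>

lemma quotD_kernel:
  assumes X: "X \<in> TG u" and zero: "quotD u X = (\<lambda>f. 0)"
  shows "cartan G u X \<in> g2_plus"
proof -
  define P where "P = (\<lambda>(A, x, r, y). g2_mat A x r y 0 0 0)"
  have P: "linear P"
    by (rule linearI) (use g2_mat_comb[where a=1 and b=1 and Z=0 and s=0 and W=0 and Z'=0 and s'=0 and W'=0]
        g2_mat_comb[where b=0 and Z=0 and s=0 and W=0 and A'=0 and Z'=0 and s'=0 and W'=0] in \<open>auto simp: P_def\<close>)
  have Pg: "P a \<in> g2_algebra" for a by (simp add: P_def split: prod.split)
  let ?c = "\<lambda>X. (part_A (cartan G u X), part_X (cartan G u X), part_r (cartan G u X), part_Y (cartan G u X))"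
  have eq: "quotD u (constant_field G (P (?c X)) u) = quotD u X" if "X \<in> TG u" for X
    by (rule quotD_eqI[OF constant_field_in_tangent_space[OF Pg] that])
       (simp_all only: cartan_constant_field[OF Pg], simp_all add: P_def)
  have "?c X = 0"
  proof (rule kernel_by_dimension[OF _ atlases(3) smooth_quot P Pg])
    show "DIM((real^2^2) \<times> (real^2) \<times> real \<times> (real^2)) = DIM(real^9)" by simp
    show "\<exists>a. quotD u (constant_field G (P a) u) = \<xi>" if \<xi>: "\<xi> \<in> TH (quot G u)" for \<xi>
    proof -
      have "\<xi> \<in> quotD u ` TG u" unfolding quotD_surj by (rule \<xi>)
      then obtain Y where Y: "Y \<in> TG u" "\<xi> = quotD u Y" by (elim imageE)
      show ?thesis by (rule exI[of _ "?c Y"]) (simp only: eq[OF Y(1)] Y(2))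
    qed
    show "quotD u (constant_field G (P (?c X)) u) = (\<lambda>f. 0)" using eq[OF X] zero by simp
  qed
  then show ?thesis unfolding g2_plus_parts p_algebra_parts using cartan_in_algebra[OF X] by (simp add: zero_prod_def)
qed

lemma parts_eq_if_projD_eq:
  assumes X: "X \<in> TG u" and Y: "Y \<in> TG u" and e: "projD u X = projD u Y"
  shows "part_X (cartan G u X) = part_X (cartan G u Y)" "part_r (cartan G u X) = part_r (cartan G u Y)"
      "part_Y (cartan G u X) = part_Y (cartan G u Y)"
proof -
  have t: "(\<lambda>f. 1 * X f + (-1) * Y f) \<in> TG u" by (rule tangent_comb[OF atlases(2) X Y])
  have "projD u (\<lambda>f. 1 * X f + (-1) * Y f) = (\<lambda>f. 0)" unfolding pushforward_comb using e by simp
  from projD_kernel[OF t this]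
  show "part_X (cartan G u X) = part_X (cartan G u Y)" "part_r (cartan G u X) = part_r (cartan G u Y)"
      "part_Y (cartan G u X) = part_Y (cartan G u Y)"
    unfolding p_algebra_parts cartan_comb[OF X Y] parts_comb by simp_all
qed

lemma part_A_eq_if_quotD_eq:
  assumes X: "X \<in> TG u" and Y: "Y \<in> TG u" and e: "quotD u X = quotD u Y"
  shows "part_A (cartan G u X) = part_A (cartan G u Y)"
proof -
  have t: "(\<lambda>f. 1 * X f + (-1) * Y f) \<in> TG u" by (rule tangent_comb[OF atlases(2) X Y])
  have "quotD u (\<lambda>f. 1 * X f + (-1) * Y f) = (\<lambda>f. 0)" unfolding pushforward_comb using e by simp
  from quotD_kernel[OF t this]
  show ?thesis unfolding g2_plus_parts cartan_comb[OF X Y] parts_comb by simp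
qed

lemma tangent_lift_spec:
  assumes "\<xi> \<in> TM (proj G u)"
  shows "tangent_lift G u \<xi> \<in> TG u" "projD u (tangent_lift G u \<xi>) = \<xi>"
proof -
  obtain X where "X \<in> TG u" "projD u X = \<xi>" using projD_surj[OF assms] .
  then have "\<exists>X. X \<in> TG u \<and> projD u X = \<xi>" by blast
  from someI_ex[OF this] show "tangent_lift G u \<xi> \<in> TG u" "projD u (tangent_lift G u \<xi>) = \<xi>"
    unfolding tangent_lift_def by simp_all
qed

end

lemma smooth_at_det:
  fixes M :: "'a::{t2_space,second_countable_topology} \<Rightarrow> real^'n^'n"
  assumes A: "smooth_atlas A" and M: "\<And>i j. smooth_at A std_atlas (\<lambda>q. M q $ i $ j) p"
  shows "smooth_at A std_atlas (\<lambda>q. det (M q)) p"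
  unfolding det_def by (intro smooth_at_sum smooth_at_mult smooth_at_prod smooth_at_const A M)

context canonical_235_geometry begin

text \<open>The Cartan connection at a single point identifies the Lie algebra with a tangent space and thus with
  the model space, which spares an explicit basis of 14 matrices.\<close>

lemma g2_algebra_coordinates:
  obtains C :: "mat7 \<Rightarrow> real^14" where "linear C" "\<And>B. B \<in> g2_algebra \<Longrightarrow> C B = 0 \<Longrightarrow> B = 0"
    "inj_on C g2_algebra"
proof -
  fix u0 :: 'g
  obtain L :: "'g tv \<Rightarrow> real^14" where L: "bij_betw L (TG u0) UNIV"
    "\<And>X Y a b. X \<in> TG u0 \<Longrightarrow> Y \<in> TG u0 \<Longrightarrow> L (\<lambda>f. a * X f + b * Y f) = a *\<^sub>R L X + b *\<^sub>R L Y"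
    by (rule tangent_coordinates[OF atlases(2), where p = u0]) (rule that)
  define K where "K v = cartan G u0 (inv_into (TG u0) L v)" for v
  have T: "inv_into (TG u0) L v \<in> TG u0" for v
    using L(1) inv_into_into[of v L "TG u0"] by (simp add: bij_betw_def)
  have LT: "L (inv_into (TG u0) L v) = v" for v
    using L(1) f_inv_into_f[of v L "TG u0"] by (simp add: bij_betw_def)
  have TL: "inv_into (TG u0) L (L X) = X" if "X \<in> TG u0" for X
    using L(1) that by (simp add: bij_betw_def)
  have comb: "K (a *\<^sub>R v + b *\<^sub>R w) = a *\<^sub>R K v + b *\<^sub>R K w" for a b v w
  proof -
    have "inv_into (TG u0) L (a *\<^sub>R v + b *\<^sub>R w) = (\<lambda>f. a * inv_into (TG u0) L v f + b * inv_into (TG u0) L w f)"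
      using TL[OF tangent_comb[OF atlases(2) T T], of a v b w] L(2)[OF T T, of a v b w] by (simp add: LT)
    then show ?thesis unfolding K_def using cartan_comb[OF T T] by simp
  qed
  have lin: "linear K" using comb[of 1 _ 1] comb[of _ _ 0 0] by (intro linearI) auto
  have "inj K"
  proof (rule injI)
    fix v w assume "K v = K w"
    then have "inv_into (TG u0) L v = inv_into (TG u0) L w" unfolding K_def using cartan_inj[OF T T] by blast
    then show "v = w" using LT by metis
  qed
  then obtain C where C: "linear C" "C \<circ> K = id" using linear_injective_left_inverse[OF lin] by blast
  have K: "\<exists>v. B = K v" if B: "B \<in> g2_algebra" for B
    using constant_field_in_tangent_space[OF B, of u0] cartan_constant_field[OF B, of u0] TL
    by (intro exI[of _ "L (constant_field G B u0)"]) (simp add: K_def)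
  have CK: "C (K v) = v" for v using C(2) by (metis comp_apply id_apply)
  have inj: "inj_on C g2_algebra" using K CK by (intro inj_onI) metis
  have "B = 0" if "B \<in> g2_algebra" "C B = 0" for B
    using K[OF that(1)] CK that(2) linear_0[OF lin] by metis
  then show ?thesis using that C(1) inj by blast
qed

text \<open>In terms of coordinate fields \<open>E\<^sub>j\<close>, the constant field of \<open>B\<close> is \<open>\<Sum>\<^sub>j c\<^sub>j E\<^sub>j\<close>, where \<open>c\<close> solves the linear
  system with columns \<open>\<omega>(E\<^sub>j)\<close> and right hand side \<open>B\<close>. The columns are smooth, and by Cramer's rule so is
  the solution.\<close>

lemma smooth_constant_field:
  assumes B: "B \<in> g2_algebra"
  shows "smooth_vector_field_on AG UNIV (constant_field G B)"
proof -
  have "smooth_at AG std_atlas (\<lambda>v. constant_field G B v f) u" if f: "smooth_at AG std_atlas f u" for u f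
  proof -
    obtain U \<phi> where U: "(U, \<phi>) \<in> atlasG G" "u \<in> U" using chart_at[OF atlases(2)] .
    note cU = chart_properties[OF atlases(2) U(1)]
    obtain C :: "mat7 \<Rightarrow> real^14" where C: "linear C" "\<And>B. B \<in> g2_algebra \<Longrightarrow> C B = 0 \<Longrightarrow> B = 0"
      "inj_on C g2_algebra" by (rule g2_algebra_coordinates) (rule that)
    define E where "E j v = chart_vec AG U \<phi> v (axis j 1)" for j v
    have E: "E j v \<in> TG v" if "v \<in> U" for j v
      unfolding E_def by (rule chart_vec_in_tangent_space[OF atlases(2) U(1) that])
    define M :: "'g \<Rightarrow> real^14^14" where "M v = (\<chi> i j. C (cartan G v (E j v)) $ i)" for v
    have comb: "C (cartan G v (\<lambda>f. \<Sum>j\<in>UNIV. c $ j * E j v f)) = M v *v c" if "v \<in> U" for v c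
    proof -
      have "cartan G v (\<lambda>f. \<Sum>j\<in>UNIV. c $ j * E j v f) = (\<Sum>j\<in>UNIV. c $ j *\<^sub>R cartan G v (E j v))"
        by (rule cartan_sum[OF E[OF that]])
      then show ?thesis
        by (simp only: linear_sum[OF C(1)] linear_scale[OF C(1)])
           (simp add: M_def matrix_vector_mult_def vec_eq_iff mult.commute)
    qed
    have zero: "c = 0" if v: "v \<in> U" and c: "M v *v c = 0" for v c
    proof -
      let ?X = "\<lambda>f. \<Sum>j\<in>UNIV. c $ j * E j v f"
      have X: "?X \<in> TG v" by (rule tangent_sum[OF atlases(2) E[OF v]])
      have "cartan G v ?X = 0" using C(2)[OF cartan_in_algebra[OF X]] comb[OF v] c by simp
      moreover have "cartan G v (\<lambda>f. 0) = 0"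
        using cartan_comb[OF tangent_zero[OF atlases(2)] tangent_zero[OF atlases(2)], of v 0 0] by simp
      ultimately have "?X = (\<lambda>f. 0)" using cartan_inj[OF X tangent_zero[OF atlases(2)]] by simp
      then have "(\<Sum>j\<in>UNIV. c $ j * E j v (\<lambda>q. \<phi> q \<bullet> axis i 1)) = 0" for i by (rule fun_cong)
      then have "c $ i = 0" for i
        unfolding E_def coordinate_function(2)[OF atlases(2) U(1) v] by (simp add: inner_axis_axis if_distrib cong: if_cong)
      then show ?thesis by (simp add: vec_eq_iff)
    qed
    have det: "det (M v) \<noteq> 0" if "v \<in> U" for v
      using zero[OF that] invertible_det_nz matrix_left_invertible_ker invertible_left_inverse by metis
    define c where "c v = (\<chi> k. det (\<chi> i j. if j = k then C B $ i else M v $ i $ j) / det (M v))" for v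
    have c: "M v *v c v = C B" if "v \<in> U" for v
      using cramer[OF det[OF that], of "c v" "C B"] unfolding c_def by simp
    have eq: "constant_field G B v f = (\<Sum>j\<in>UNIV. c v $ j * E j v f)" if v: "v \<in> U" for v f
    proof -
      let ?X = "\<lambda>f. \<Sum>j\<in>UNIV. c v $ j * E j v f"
      have X: "?X \<in> TG v" by (rule tangent_sum[OF atlases(2) E[OF v]])
      have "C (cartan G v ?X) = C B" unfolding comb[OF v] by (rule c[OF v])
      then have "cartan G v ?X = B" using C(3) cartan_in_algebra[OF X] B unfolding inj_on_def by blast
      then have "constant_field G B v = ?X" using constant_field_cartan[OF X] by simp
      then show ?thesis by simp
    qed
    have sE: "smooth_vector_field_on AG U (E j)" for j
      unfolding E_def by (rule smooth_coordinate_vector_field[OF atlases(2) U(1)])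
    have sM: "smooth_at AG std_atlas (\<lambda>v. M v $ i $ j) u" for i j
    proof -
      have "smooth_at AG std_atlas (\<lambda>v. cartan G v (E j v)) u"
        using connection sE[of j] U(2) unfolding cartan_connection_def by blast
      moreover have "bounded_linear (\<lambda>N. C N $ i)"
        using bounded_linear_compose[OF bounded_linear_vec_nth C(1)[unfolded linear_conv_bounded_linear]] .
      ultimately have "smooth_at AG std_atlas (\<lambda>v. C (cartan G v (E j v)) $ i) u"
        using smooth_at_linear_comp[OF atlases(2), of "\<lambda>N. C N $ i" "\<lambda>v. cartan G v (E j v)" u] by blast
      then show ?thesis by (simp add: M_def)
    qed
    have sc: "smooth_at AG std_atlas (\<lambda>v. c v $ k) u" for k
    proof -
      have "smooth_at AG std_atlas (\<lambda>v. (\<chi> i j. if j = k then C B $ i else M v $ i $ j) $ i $ j) u" for i j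
        using sM[of i j] smooth_at_const[OF atlases(2), of "C B $ i" u] by (cases "j = k") simp_all
      from smooth_at_divide[OF atlases(2) smooth_at_det[OF atlases(2) this] smooth_at_det[OF atlases(2) sM] det[OF U(2)]]
      show ?thesis by (simp add: c_def)
    qed
    have "smooth_at AG std_atlas (\<lambda>v. E j v f) u" for j
      using sE[of j] U(2) f unfolding smooth_vector_field_on_def by blast
    then have "smooth_at AG std_atlas (\<lambda>v. \<Sum>j\<in>UNIV. c v $ j * E j v f) u"
      by (intro smooth_at_sum smooth_at_mult atlases sc)
    then show ?thesis
      by (rule smooth_at_cong[OF atlases(2) _ cU(1) U(2)]) (rule eq)
  qed
  then show ?thesis
    unfolding smooth_vector_field_on_def using constant_field_in_tangent_space[OF B] by blast
qed

end

section \<open>Lifting sections of the distribution\<close>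

text \<open>The Levi bracket in coordinates, \<open>2 sqrt 2 \<epsilon>\<^sub>\<alpha>\<^sub>\<beta>\<close>.\<close>

definition levi_matrix :: "real^2^2" where
  "levi_matrix = vector [vector [0, 2 * sqrt 2], vector [- 2 * sqrt 2, 0]]"

text \<open>The matrix \<open>K\<close> with \<open>\<Sum>\<^sub>\<gamma> K\<^sub>\<gamma>\<^sub>\<alpha> L\<^sub>\<gamma>\<^sub>\<beta> = \<delta>\<^sub>\<alpha>\<^sub>\<beta>\<close>. The contraction is over the first index of both
  matrices, so it is the transpose of the inverse.\<close>

definition levi_matrix_inv :: "real^2^2" where
  "levi_matrix_inv = vector [vector [0, 1 / (2 * sqrt 2)], vector [- 1 / (2 * sqrt 2), 0]]"

lemma dlow_in_algebra [simp]: "dlow k \<in> g2_algebra"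
  by (simp add: dlow_def)

lemma part_r_lie_mat_dlow: "part_r (lie_mat (dlow k) (dlow l)) = levi_matrix $ k $ l"
proof -
  have "\<forall>k l. part_r (lie_mat (dlow k) (dlow l)) = levi_matrix $ k $ l"
    unfolding forall_2 part_r_def lie_mat_def dlow_def levi_matrix_def g2_mat_def
    by (simp add: matrix_matrix_mult_def sum_7 axis_def)
  then show ?thesis by blast
qed

lemma parts_dlow_sum: "part_X (\<Sum>k\<in>UNIV. c $ k *\<^sub>R dlow k) = c"
  "part_r (\<Sum>k\<in>UNIV. c $ k *\<^sub>R dlow k) = 0" "part_Y (\<Sum>k\<in>UNIV. c $ k *\<^sub>R dlow k) = 0"
  unfolding sum_2 parts_comb by (simp_all add: dlow_def vec_eq_iff forall_2 axis_def)

text \<open>Two linearly independent rows have a nonzero minor: otherwise the rows satisfy the relation whose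
  coefficients are the entries of one column.\<close>

lemma two_times_two_minor:
  fixes g :: "2 \<Rightarrow> 'b \<Rightarrow> real"
  assumes "\<And>c :: real^2. (\<And>b. (\<Sum>k\<in>UNIV. c $ k * g k b) = 0) \<Longrightarrow> c = 0"
  obtains b b' where "g 1 b * g 2 b' - g 1 b' * g 2 b \<noteq> 0"
proof -
  have "\<exists>b b'. g 1 b * g 2 b' - g 1 b' * g 2 b \<noteq> 0"
  proof (rule ccontr)
    assume "\<not> ?thesis"
    then have z: "g 1 b * g 2 b' = g 1 b' * g 2 b" for b b' by auto
    have "g 1 b = 0" for b
    proof -
      have "(vector [- g 2 b, g 1 b] :: real^2) = 0"
        by (rule assms) (simp add: sum_2 z[of b] mult.commute)
      then show ?thesis by (simp add: vec_eq_iff forall_2)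
    qed
    then have "(vector [1, 0] :: real^2) = 0" by (intro assms) (simp add: sum_2)
    then show False by (simp add: vec_eq_iff forall_2)
  qed
  then show ?thesis using that by blast
qed

context canonical_235_geometry begin

abbreviation "E k \<equiv> constant_field G (dlow k)"

lemma E_in_tangent_space: "E k u \<in> TG u"
  by (simp add: constant_field_in_tangent_space)

lemma E_sum_in_tangent_space: "(\<lambda>f. \<Sum>k\<in>UNIV. c k * E k u f) \<in> TG u"
  by (rule tangent_sum[OF atlases(2) E_in_tangent_space])

lemma cartan_E_sum: "cartan G u (\<lambda>f. \<Sum>k\<in>UNIV. c k * E k u f) = (\<Sum>k\<in>UNIV. c k *\<^sub>R dlow k)"
  by (subst cartan_sum[OF E_in_tangent_space]) (simp add: cartan_constant_field)

text \<open>By hypothesis the vector has a lift whose value under the Cartan connection has neither a \<open>g\<^sub>-\<^sub>2\<close> nor a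
  \<open>g\<^sub>-\<^sub>3\<close> part. Its \<open>p\<close> part is vertical and can be dropped.\<close>

lemma distribution_lift:
  assumes "\<zeta> \<in> D (proj G u)"
  shows "\<exists>c :: real^2. projD u (\<lambda>f. \<Sum>k\<in>UNIV. c $ k * E k u f) = \<zeta>"
proof -
  have "D (proj G u) = {projD u X | X. X \<in> TG u \<and> cartan G u X \<in> g2_filtration (-1)}"
    using inducesD unfolding induces_distribution_def by simp
  then obtain X where X: "\<zeta> = projD u X" "X \<in> TG u" "cartan G u X \<in> g2_filtration (-1)" using assms by blast
  then have p: "part_r (cartan G u X) = 0" "part_Y (cartan G u X) = 0" by (auto simp: g2_filtration_def)
  have "projD u (\<lambda>f. \<Sum>k\<in>UNIV. part_X (cartan G u X) $ k * E k u f) = projD u X"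
    by (rule projD_eqI[OF E_sum_in_tangent_space X(2)]) (simp_all add: cartan_E_sum parts_dlow_sum p)
  then show ?thesis using X(1) by blast
qed

text \<open>The coefficients exist pointwise. Evaluating on coordinate functions of the base gives a linear
  system for them with smooth coefficients and smooth right hand side; it has rank two because the \<open>E\<^sub>k\<close>
  project to independent vectors. A nonzero minor yields smooth solutions near \<open>u\<close>.\<close>

lemma local_section_lift:
  assumes \<xi>: "local_section AM D N \<xi>" and u: "proj G u \<in> N"
  obtains a :: "'g \<Rightarrow> real^2" and W where "open W" "u \<in> W" "\<And>k. smooth_at AG std_atlas (\<lambda>v. a v $ k) u"
    "\<And>v. v \<in> W \<Longrightarrow> proj G v \<in> N \<and> projD v (\<lambda>f. \<Sum>k\<in>UNIV. a v $ k * E k v f) = \<xi> (proj G v)"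
proof -
  have vf: "smooth_vector_field_on AM N \<xi>" and inD: "\<And>y. y \<in> N \<Longrightarrow> \<xi> y \<in> D y"
    using \<xi> unfolding local_section_def by auto
  have N: "open N" using vf unfolding smooth_vector_field_on_def by simp
  define a where "a v = (SOME c :: real^2. projD v (\<lambda>f. \<Sum>k\<in>UNIV. c $ k * E k v f) = \<xi> (proj G v))" for v
  have a: "projD v (\<lambda>f. \<Sum>k\<in>UNIV. a v $ k * E k v f) = \<xi> (proj G v)" if "proj G v \<in> N" for v
    unfolding a_def using someI_ex[OF distribution_lift[OF inD[OF that]]] .
  obtain V \<psi> where V: "(V, \<psi>) \<in> atlasM G" "proj G u \<in> V" using chart_at[OF atlases(1)] .
  note cV = chart_properties[OF atlases(1) V(1)]
  define g where "g k b v = E k v (\<lambda>z. \<psi> (proj G z) \<bullet> b)" for k b v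
  define h where "h b v = \<xi> (proj G v) (\<lambda>q. \<psi> q \<bullet> b)" for b v
  have yp: "smooth_at AG std_atlas (\<lambda>z. \<psi> (proj G z) \<bullet> b) u" for b
    by (rule smooth_at_compose[OF atlases(2,1) smooth_atlas_std smooth_proj coordinate_function(1)[OF atlases(1) V]])
  have sg: "smooth_at AG std_atlas (g k b) u" for k b
    using smooth_constant_field[of "dlow k"] yp[of b] unfolding smooth_vector_field_on_def g_def by simp
  have "smooth_at AM std_atlas (\<lambda>y. \<xi> y (\<lambda>q. \<psi> q \<bullet> b)) (proj G u)" for b
    using vf u coordinate_function(1)[OF atlases(1) V] unfolding smooth_vector_field_on_def by blast
  then have sh: "smooth_at AG std_atlas (h b) u" for b
    unfolding h_def using smooth_at_compose[OF atlases(2,1) smooth_atlas_std smooth_proj] by blast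
  have eq: "(\<Sum>k\<in>UNIV. a v $ k * g k b v) = h b v" if v: "proj G v \<in> N" "proj G v \<in> V" for v b
    unfolding h_def a[OF v(1), symmetric] g_def
    by (rule pushforward_apply[symmetric]) (rule coordinate_function(1)[OF atlases(1) V(1) v(2)])
  have indep: "c = 0" if c: "\<And>b. (\<Sum>k\<in>UNIV. c $ k * g k b u) = 0" for c :: "real^2"
  proof -
    let ?X = "\<lambda>f. \<Sum>k\<in>UNIV. c $ k * E k u f"
    have "projD u ?X \<in> TM (proj G u)"
      by (rule pushforward_in_tangent_space[OF atlases(2,1) smooth_proj E_sum_in_tangent_space])
    then obtain v where v: "projD u ?X = chart_vec AM V \<psi> (proj G u) v"
      using tangent_chartE[OF atlases(1) _ V] by blast
    have "v \<bullet> v = projD u ?X (\<lambda>q. \<psi> q \<bullet> v)" unfolding v coordinate_function(2)[OF atlases(1) V] ..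
    also have "\<dots> = (\<Sum>k\<in>UNIV. c $ k * g k v u)"
      unfolding g_def by (rule pushforward_apply) (rule coordinate_function(1)[OF atlases(1) V])
    finally have "v = 0" using c by simp
    then have "projD u ?X = (\<lambda>f. 0)"
      using v chart_vec_linear[OF atlases(1) V, of 0 0 0 0] by simp
    from projD_kernel[OF E_sum_in_tangent_space this] show "c = 0"
      by (simp add: p_algebra_parts cartan_E_sum parts_dlow_sum)
  qed
  obtain b b' where m: "g 1 b u * g 2 b' u - g 1 b' u * g 2 b u \<noteq> 0"
    by (rule two_times_two_minor[of "\<lambda>k b. g k b u", OF indep]) (assumption | rule that)+
  \<comment> \<open>The determinant of the system for \<open>a v\<close>; it stays nonzero near \<open>u\<close>.\<close>
  define m where "m v = g 1 b v * g 2 b' v - g 1 b' v * g 2 b v" for v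
  have sm: "smooth_at AG std_atlas m u"
    unfolding m_def by (intro smooth_at_diff smooth_at_mult atlases sg)
  obtain W1 where W1: "open W1" "u \<in> W1" "m ` W1 \<subseteq> - {0}"
  proof (rule smooth_at_continuous_vimage[OF atlases(2) smooth_atlas_std sm])
    show "open (- {0 :: real})" "m u \<in> - {0}" using m by (auto simp: m_def)
  qed (rule that)
  obtain W2 where W2: "open W2" "u \<in> W2" "proj G ` W2 \<subseteq> N \<inter> V"
  proof (rule smooth_at_continuous_vimage[OF atlases(2,1) smooth_proj])
    show "open (N \<inter> V)" "proj G u \<in> N \<inter> V" using N cV(1) u V by auto
  qed (rule that)
  define W where "W = W1 \<inter> W2"
  have W: "open W" "u \<in> W" unfolding W_def using W1 W2 by auto
  have Wp: "proj G v \<in> N" "proj G v \<in> V" "m v \<noteq> 0" if "v \<in> W" for v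
    using that W1(3) W2(3) unfolding W_def by auto
  have a1: "a v $ 1 = (h b v * g 2 b' v - h b' v * g 2 b v) / m v" if "v \<in> W" for v
    using Wp(3)[OF that] eq[OF Wp(1,2)[OF that], of b, symmetric] eq[OF Wp(1,2)[OF that], of b', symmetric]
    by (simp add: sum_2 m_def field_simps)
  have a2: "a v $ 2 = (g 1 b v * h b' v - g 1 b' v * h b v) / m v" if "v \<in> W" for v
    using Wp(3)[OF that] eq[OF Wp(1,2)[OF that], of b, symmetric] eq[OF Wp(1,2)[OF that], of b', symmetric]
    by (simp add: sum_2 m_def field_simps)
  have mu: "m u \<noteq> 0" using m by (simp add: m_def)
  have s1: "smooth_at AG std_atlas (\<lambda>v. a v $ 1) u"
    by (rule smooth_at_cong[OF atlases(2) _ W a1]) (intro smooth_at_divide smooth_at_diff smooth_at_mult atlases sg sh sm mu)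
  have s2: "smooth_at AG std_atlas (\<lambda>v. a v $ 2) u"
    by (rule smooth_at_cong[OF atlases(2) _ W a2]) (intro smooth_at_divide smooth_at_diff smooth_at_mult atlases sg sh sm mu)
  have "smooth_at AG std_atlas (\<lambda>v. a v $ k) u" for k
    using s1 s2 exhaust_2[of k] by auto
  then show ?thesis using that[OF W] Wp(1) a by blast
qed

end

section \<open>The value of the Levi bracket\<close>

lemma lie_bracket_apply:
  "smooth_at A std_atlas f p \<Longrightarrow> lie_bracket A X Y p f = X p (\<lambda>y. Y y f) - Y p (\<lambda>y. X y f)"
  by (simp add: lie_bracket_def)

lemma g2_mat_in_filtration: "g2_mat 0 c 0 0 0 0 0 \<in> g2_filtration (-1)"
  unfolding g2_filtration_def by simp blast

context canonical_235_geometry begin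

text \<open>Derivatives along sections of the distribution are derivatives of pulled back functions along
  the lifts; the product rule then applies to the coefficients of the second lift.\<close>

lemma iterated_derivative_lift:
  assumes vf: "smooth_vector_field_on AM N \<eta>" and u: "proj G u \<in> N"
    and \<xi>: "projD u (\<lambda>f. \<Sum>k\<in>UNIV. c k * E k u f) = \<xi>"
    and W: "open W" "u \<in> W" and b: "\<And>l. smooth_at AG std_atlas (\<lambda>v. b v $ l) u"
    and \<eta>: "\<And>v. v \<in> W \<Longrightarrow> projD v (\<lambda>f. \<Sum>l\<in>UNIV. b v $ l * E l v f) = \<eta> (proj G v)"
    and f: "smooth_at AM std_atlas f (proj G u)"
  defines "F \<equiv> \<lambda>v. f (proj G v)"
  shows "\<xi> (\<lambda>y. \<eta> y f) = (\<Sum>k\<in>UNIV. c k * (\<Sum>l\<in>UNIV. E k u (\<lambda>v. b v $ l) * E l u F + b u $ l * E k u (\<lambda>v. E l v F)))"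
proof -
  obtain N' where N': "open N'" "proj G u \<in> N'" "\<And>q. q \<in> N' \<Longrightarrow> smooth_at AM std_atlas f q"
    by (rule smooth_at_neighbourhood[OF f]) (rule that)
  obtain W' where W': "open W'" "u \<in> W'" "proj G ` W' \<subseteq> N'"
    using smooth_at_continuous_vimage[OF atlases(2,1) smooth_proj N'(1,2)] .
  have F: "smooth_at AG std_atlas F u"
    unfolding F_def by (rule smooth_at_compose[OF atlases(2,1) smooth_atlas_std smooth_proj f])
  have sE: "smooth_at AG std_atlas (\<lambda>v. E l v F) u" for l
    using smooth_constant_field[of "dlow l"] F unfolding smooth_vector_field_on_def by simp
  have s: "smooth_at AM std_atlas (\<lambda>y. \<eta> y f) (proj G u)"
    using vf u f unfolding smooth_vector_field_on_def by blast
  have eq: "\<eta> (proj G v) f = (\<Sum>l\<in>UNIV. b v $ l * E l v F)" if v: "v \<in> W \<inter> W'" for v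
  proof -
    have sf: "smooth_at AM std_atlas f (proj G v)" using v W'(3) N'(3) by blast
    have vW: "v \<in> W" using v by simp
    show ?thesis unfolding \<eta>[OF vW, symmetric] F_def by (rule pushforward_apply[where F = "proj G", OF sf])
  qed
  have Ek: "E k u (\<lambda>v. \<eta> (proj G v) f) = (\<Sum>l\<in>UNIV. E k u (\<lambda>v. b v $ l) * E l u F + b u $ l * E k u (\<lambda>v. E l v F))" for k
  proof -
    have "E k u (\<lambda>v. \<eta> (proj G v) f) = E k u (\<lambda>v. \<Sum>l\<in>UNIV. b v $ l * E l v F)"
      by (rule tangent_local[OF atlases(2) E_in_tangent_space, of "W \<inter> W'"]) (use W W' eq in auto)
    also have "\<dots> = (\<Sum>l\<in>UNIV. E k u (\<lambda>v. b v $ l * E l v F))"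
      by (rule tangent_sum_fun[OF atlases(2) E_in_tangent_space]) (intro smooth_at_mult atlases b sE)
    also have "\<dots> = (\<Sum>l\<in>UNIV. E k u (\<lambda>v. b v $ l) * E l u F + b u $ l * E k u (\<lambda>v. E l v F))"
      by (intro sum.cong refl tangent_mult[OF atlases(2) E_in_tangent_space] b sE)
    finally show ?thesis .
  qed
  have "\<xi> (\<lambda>y. \<eta> y f) = (\<Sum>k\<in>UNIV. c k * E k u (\<lambda>v. \<eta> (proj G v) f))"
    unfolding \<xi>[symmetric] by (rule pushforward_apply[where F = "proj G", OF s])
  then show ?thesis by (simp only: Ek)
qed

lemma bracket_E_in_tangent_space: "lie_bracket AG (E k) (E l) u \<in> TG u"
  by (rule lie_bracket_in_tangent_space[OF atlases(2) smooth_constant_field smooth_constant_field]) simp_all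

text \<open>The curvature of two elements of degree at least -1 has degree at least -1 by regularity, so in degree
  -2 the bracket of the constant fields is the constant field of the bracket.\<close>

lemma part_r_bracket_E: "part_r (cartan G u (lie_bracket AG (E k) (E l) u)) = levi_matrix $ k $ l"
proof -
  have d: "dlow k \<in> g2_filtration (-1)" for k unfolding dlow_def by (rule g2_mat_in_filtration)
  have "curvature G u (dlow k) (dlow l) \<in> g2_filtration (-1 + -1 + 1)"
    by (rule regular[unfolded regular_geometry_def, rule_format]) (simp_all add: d)
  then have "part_r (curvature G u (dlow k) (dlow l)) = 0" by (auto simp: g2_filtration_def)
  moreover have "cartan G u (lie_bracket AG (E k) (E l) u) = 1 *\<^sub>R lie_mat (dlow k) (dlow l) + (-1) *\<^sub>R curvature G u (dlow k) (dlow l)"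
    by (simp add: curvature_def)
  ultimately show ?thesis by (simp only: parts_comb part_r_lie_mat_dlow)
qed

text \<open>\<open>Q\<close> is the bracket of the two lifts, expanded by the Leibniz rule. The terms in which the coefficients
  are differentiated are multiples of \<open>E\<^sub>l\<close> and do not contribute to the \<open>g\<^sub>-\<^sub>2\<close> part.\<close>

lemma part_r_cartan_bracket:
  assumes \<xi>: "local_section AM D N \<xi>" and \<eta>: "local_section AM D N \<eta>" and u: "proj G u \<in> N"
  obtains Q c d where "Q \<in> TG u" "projD u Q = lie_bracket AM \<xi> \<eta> (proj G u)"
    "projD u (\<lambda>f. \<Sum>k\<in>UNIV. c $ k * E k u f) = \<xi> (proj G u)"
    "projD u (\<lambda>f. \<Sum>k\<in>UNIV. d $ k * E k u f) = \<eta> (proj G u)"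
    "part_r (cartan G u Q) = (\<Sum>k\<in>UNIV. \<Sum>l\<in>UNIV. c $ k * d $ l * levi_matrix $ k $ l)"
proof -
  have vf: "smooth_vector_field_on AM N \<xi>" "smooth_vector_field_on AM N \<eta>"
    using \<xi> \<eta> unfolding local_section_def by auto
  obtain a :: "'g \<Rightarrow> real^2" and W where W: "open W" "u \<in> W" and a: "\<And>k. smooth_at AG std_atlas (\<lambda>v. a v $ k) u"
    and aW: "\<And>v. v \<in> W \<Longrightarrow> proj G v \<in> N \<and> projD v (\<lambda>f. \<Sum>k\<in>UNIV. a v $ k * E k v f) = \<xi> (proj G v)"
    by (rule local_section_lift[OF \<xi> u]) (rule that)
  obtain b :: "'g \<Rightarrow> real^2" and W' where W': "open W'" "u \<in> W'" and b: "\<And>k. smooth_at AG std_atlas (\<lambda>v. b v $ k) u"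
    and bW: "\<And>v. v \<in> W' \<Longrightarrow> proj G v \<in> N \<and> projD v (\<lambda>f. \<Sum>k\<in>UNIV. b v $ k * E k v f) = \<eta> (proj G v)"
    by (rule local_section_lift[OF \<eta> u]) (rule that)
  note aW' = conjunct2[OF aW] and bW' = conjunct2[OF bW]
  let ?B = "\<lambda>k l. lie_bracket AG (E k) (E l) u"
  \<comment> \<open>The coefficients that arise from differentiating \<open>a\<close> and \<open>b\<close>.\<close>
  define \<gamma> where "\<gamma> l = (\<Sum>k\<in>UNIV. a u $ k * E k u (\<lambda>v. b v $ l) - b u $ k * E k u (\<lambda>v. a v $ l))" for l
  define Q1 where "Q1 = (\<lambda>f. \<Sum>k\<in>UNIV. a u $ k * (\<Sum>l\<in>UNIV. b u $ l * ?B k l f))"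
  define Q2 where "Q2 = (\<lambda>f. \<Sum>l\<in>UNIV. \<gamma> l * E l u f)"
  define Q where "Q = (\<lambda>f. 1 * Q1 f + 1 * Q2 f)"
  have T0: "(\<lambda>f. \<Sum>l\<in>UNIV. b u $ l * ?B k l f) \<in> TG u" for k
    by (rule tangent_sum[OF atlases(2) bracket_E_in_tangent_space])
  have T1: "Q1 \<in> TG u" unfolding Q1_def by (rule tangent_sum[OF atlases(2) T0])
  have T2: "Q2 \<in> TG u" unfolding Q2_def by (rule E_sum_in_tangent_space)
  have Q: "Q \<in> TG u" unfolding Q_def by (rule tangent_comb[OF atlases(2) T1 T2])
  have "projD u Q = lie_bracket AM \<xi> \<eta> (proj G u)"
  proof
    fix f
    show "projD u Q f = lie_bracket AM \<xi> \<eta> (proj G u) f"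
    proof (cases "smooth_at AM std_atlas f (proj G u)")
      case True
      let ?F = "\<lambda>v. f (proj G v)"
      have F: "smooth_at AG std_atlas ?F u"
        by (rule smooth_at_compose[OF atlases(2,1) smooth_atlas_std smooth_proj True])
      have 1: "\<xi> (proj G u) (\<lambda>y. \<eta> y f) = (\<Sum>k\<in>UNIV. a u $ k * (\<Sum>l\<in>UNIV. E k u (\<lambda>v. b v $ l) * E l u ?F + b u $ l * E k u (\<lambda>v. E l v ?F)))"
        by (rule iterated_derivative_lift[OF vf(2) u aW'[OF W(2)] W' b bW' True])
      have 2: "\<eta> (proj G u) (\<lambda>y. \<xi> y f) = (\<Sum>k\<in>UNIV. b u $ k * (\<Sum>l\<in>UNIV. E k u (\<lambda>v. a v $ l) * E l u ?F + a u $ l * E k u (\<lambda>v. E l v ?F)))"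
        by (rule iterated_derivative_lift[OF vf(1) u bW'[OF W'(2)] W a aW' True])
      have "projD u Q f = Q ?F" by (rule pushforward_apply[where F = "proj G", OF True])
      also have "\<dots> = lie_bracket AM \<xi> \<eta> (proj G u) f"
        unfolding lie_bracket_apply[OF True] 1 2 Q_def Q1_def Q2_def \<gamma>_def lie_bracket_apply[OF F] sum_2
        by (simp add: algebra_simps)
      finally show ?thesis .
    qed (simp add: pushforward_def lie_bracket_def)
  qed
  moreover have "part_r (cartan G u Q) = (\<Sum>k\<in>UNIV. \<Sum>l\<in>UNIV. a u $ k * b u $ l * levi_matrix $ k $ l)"
  proof -
    have "cartan G u Q = 1 *\<^sub>R cartan G u Q1 + 1 *\<^sub>R cartan G u Q2"
      unfolding Q_def by (rule cartan_comb[OF T1 T2])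
    moreover have "cartan G u Q1 = (\<Sum>k\<in>UNIV. a u $ k *\<^sub>R (\<Sum>l\<in>UNIV. b u $ l *\<^sub>R cartan G u (?B k l)))"
      unfolding Q1_def by (subst cartan_sum[OF T0]) (subst cartan_sum[OF bracket_E_in_tangent_space], rule refl)
    moreover have "part_r (cartan G u Q2) = 0"
      using parts_dlow_sum(2)[of "vec_lambda \<gamma>"] by (simp add: Q2_def cartan_E_sum)
    ultimately show ?thesis
      by (simp only: parts_comb sum_2 part_r_bracket_E) (simp add: algebra_simps)
  qed
  ultimately show ?thesis using that[OF Q _ aW'[OF W(2)] bW'[OF W'(2)]] by blast
qed

text \<open>The coordinate is defined with a chosen lift; another lift differs from it by a vertical vector.\<close>

lemma gr1_coord_eq:
  assumes "u = (SOME u. quot G u = w)" "X \<in> TG u" "projD u X = \<xi>"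
  shows "gr1_coord G w \<xi> = part_X (cartan G u X)"
proof -
  have "\<xi> \<in> TM (proj G u)" using pushforward_in_tangent_space[OF atlases(2,1) smooth_proj assms(2)] assms(3) by simp
  from tangent_lift_spec[OF this] parts_eq_if_projD_eq(1)[OF _ assms(2)] assms(3)
  show ?thesis unfolding gr1_coord_def assms(1)[symmetric] Let_def by simp
qed

lemma gr2_coord_eq:
  assumes "u = (SOME u. quot G u = w)" "X \<in> TG u" "projD u X = \<xi>"
  shows "gr2_coord G w \<xi> = part_r (cartan G u X)"
proof -
  have "\<xi> \<in> TM (proj G u)" using pushforward_in_tangent_space[OF atlases(2,1) smooth_proj assms(2)] assms(3) by simp
  from tangent_lift_spec[OF this] parts_eq_if_projD_eq(2)[OF _ assms(2)] assms(3)
  show ?thesis unfolding gr2_coord_def assms(1)[symmetric] Let_def by simp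
qed

text \<open>A vector is extended by keeping its coefficients in a local frame constant.\<close>

lemma local_section_through:
  assumes D: "subbundle AM 2 D" and \<zeta>: "\<zeta> \<in> D x"
  obtains N \<xi> where "x \<in> N" "local_section AM D N \<xi>" "\<xi> x = \<zeta>"
proof -
  from spec[OF D[unfolded subbundle_def], of x] obtain N X where N: "x \<in> N"
    and X: "\<forall>i<2. local_section AM D N (X i)"
    and basis: "\<forall>y\<in>N. tv_basis 2 (\<lambda>i. X i y) (D y)"
    by (elim exE conjE)
  have Dy: "D y = {tv_comb 2 c (\<lambda>i. X i y) | c. True}" if "y \<in> N" for y
    using bspec[OF basis that] unfolding tv_basis_def by (rule conjunct1)
  obtain c where c: "\<zeta> = tv_comb 2 c (\<lambda>i. X i x)" using \<zeta> unfolding Dy[OF N] by (elim CollectE exE conjE)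
  let ?\<xi> = "\<lambda>y. tv_comb 2 c (\<lambda>i. X i y)"
  have vf: "smooth_vector_field_on AM N (X i)" if "i < 2" for i using X that unfolding local_section_def by simp
  have oN: "open N" using vf[of 0] unfolding smooth_vector_field_on_def by simp
  have "?\<xi> y \<in> D y" if "y \<in> N" for y unfolding Dy[OF that] by blast
  moreover have "?\<xi> y \<in> TM y" if y: "y \<in> N" for y
    unfolding tv_comb_def by (rule tangent_sum[OF atlases(1)]) (use vf y in \<open>auto simp: smooth_vector_field_on_def\<close>)
  moreover have "smooth_at AM std_atlas (\<lambda>z. ?\<xi> z f) y" if y: "y \<in> N" and f: "smooth_at AM std_atlas f y" for y f
    unfolding tv_comb_def
    by (intro smooth_at_sum smooth_at_mult smooth_at_const atlases)
       (use vf y f in \<open>auto simp: smooth_vector_field_on_def\<close>)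
  ultimately have "local_section AM D N ?\<xi>"
    unfolding local_section_def smooth_vector_field_on_def using oN by blast
  then show ?thesis using that[OF N] c by blast
qed

lemma local_section_restrict:
  "local_section AM D N \<xi> \<Longrightarrow> open N' \<Longrightarrow> N' \<subseteq> N \<Longrightarrow> local_section AM D N' \<xi>"
  unfolding local_section_def smooth_vector_field_on_def by blast

lemma levi_eq:
  assumes D: "subbundle AM 2 D"
  shows "levi G D w = levi_matrix"
proof -
  define u where "u = (SOME u. quot G u = w)"
  have "\<exists>u. quot G u = w" using surj_quot by (metis surjD)
  then have "quot G u = w" unfolding u_def by (rule someI_ex)
  then have p: "proj0 G w = proj G u" using proj0_quot by blast
  have gr1: "gr1_coord G w (projD u (\<lambda>f. \<Sum>k\<in>UNIV. c $ k * E k u f)) = c" for c :: "real^2"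
    using gr1_coord_eq[OF u_def E_sum_in_tangent_space refl, of "\<lambda>k. c $ k"] by (simp add: cartan_E_sum parts_dlow_sum)
  have "(THE r. \<exists>N \<xi> \<eta>. proj0 G w \<in> N \<and>
     local_section AM D N \<xi> \<and> local_section AM D N \<eta> \<and>
     gr1_coord G w (\<xi> (proj0 G w)) = axis \<alpha> 1 \<and> gr1_coord G w (\<eta> (proj0 G w)) = axis \<beta> 1 \<and>
     r = gr2_coord G w (lie_bracket AM \<xi> \<eta> (proj0 G w))) = levi_matrix $ \<alpha> $ \<beta>" (is "(THE r. ?P r) = _") for \<alpha> \<beta>
  proof -
    have val: "gr2_coord G w (lie_bracket AM \<xi> \<eta> (proj G u)) = levi_matrix $ \<alpha> $ \<beta>"
      if N: "proj G u \<in> N" and s: "local_section AM D N \<xi>" "local_section AM D N \<eta>"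
        and g: "gr1_coord G w (\<xi> (proj G u)) = axis \<alpha> 1" "gr1_coord G w (\<eta> (proj G u)) = axis \<beta> 1" for N \<xi> \<eta>
    proof -
      obtain Q c d where Q: "Q \<in> TG u" "projD u Q = lie_bracket AM \<xi> \<eta> (proj G u)"
        and c: "projD u (\<lambda>f. \<Sum>k\<in>UNIV. c $ k * E k u f) = \<xi> (proj G u)"
        and d: "projD u (\<lambda>f. \<Sum>k\<in>UNIV. d $ k * E k u f) = \<eta> (proj G u)"
        and r: "part_r (cartan G u Q) = (\<Sum>k\<in>UNIV. \<Sum>l\<in>UNIV. c $ k * d $ l * levi_matrix $ k $ l)"
        using part_r_cartan_bracket[OF s N] .
      have "c = axis \<alpha> 1" "d = axis \<beta> 1" using gr1[of c] gr1[of d] g c d by simp_all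
      moreover have "(\<Sum>k\<in>UNIV. \<Sum>l\<in>UNIV. (axis \<alpha> 1 :: real^2) $ k * (axis \<beta> 1 :: real^2) $ l * levi_matrix $ k $ l) = levi_matrix $ \<alpha> $ \<beta>"
        using exhaust_2[of \<alpha>] exhaust_2[of \<beta>] by (auto simp: sum_2 axis_def)
      ultimately show ?thesis using gr2_coord_eq[OF u_def Q] r by simp
    qed
    have "projD u (\<lambda>f. \<Sum>k\<in>UNIV. c $ k * E k u f) \<in> D (proj G u)" for c :: "real^2"
    proof -
      have "cartan G u (\<lambda>f. \<Sum>k\<in>UNIV. c $ k * E k u f) \<in> g2_filtration (-1)"
      proof -
        have "cartan G u (\<lambda>f. \<Sum>k\<in>UNIV. c $ k * E k u f) = g2_mat 0 c 0 0 0 0 0"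
        proof -
          have "c $ 1 *\<^sub>R axis 1 1 + c $ 2 *\<^sub>R axis 2 1 = c" by (simp add: vec_eq_iff forall_2 axis_def)
          then show ?thesis unfolding cartan_E_sum unfolding sum_2 dlow_def g2_mat_comb by simp
        qed
        then show ?thesis using g2_mat_in_filtration by simp
      qed
      then show ?thesis using inducesD E_sum_in_tangent_space unfolding induces_distribution_def by blast
    qed
    note inD = this
    obtain N \<xi> where \<xi>: "proj G u \<in> N" "local_section AM D N \<xi>"
       "\<xi> (proj G u) = projD u (\<lambda>f. \<Sum>k\<in>UNIV. (axis \<alpha> 1 :: real^2) $ k * E k u f)"
      using local_section_through[OF D inD] .
    obtain N' \<eta> where \<eta>: "proj G u \<in> N'" "local_section AM D N' \<eta>"
       "\<eta> (proj G u) = projD u (\<lambda>f. \<Sum>k\<in>UNIV. (axis \<beta> 1 :: real^2) $ k * E k u f)"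
      using local_section_through[OF D inD] .
    have "open (N \<inter> N')" using \<xi>(2) \<eta>(2) unfolding local_section_def smooth_vector_field_on_def by auto
    then have s: "local_section AM D (N \<inter> N') \<xi>" "local_section AM D (N \<inter> N') \<eta>"
      using local_section_restrict \<xi>(2) \<eta>(2) by (metis inf_le1, metis inf_le2)
    have g: "gr1_coord G w (\<xi> (proj G u)) = axis \<alpha> 1" "gr1_coord G w (\<eta> (proj G u)) = axis \<beta> 1"
      unfolding \<xi>(3) \<eta>(3) gr1 by (rule refl)+
    have N: "proj G u \<in> N \<inter> N'" using \<xi>(1) \<eta>(1) by simp
    show ?thesis
    proof (rule the_equality)
      show "?P (levi_matrix $ \<alpha> $ \<beta>)"
        unfolding p using N s g val[OF N s g, symmetric] by blast
      show "r = levi_matrix $ \<alpha> $ \<beta>" if "?P r" for r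
        using that val unfolding p by blast
    qed
  qed
  then show ?thesis unfolding levi_def by (simp add: vec_eq_iff)
qed

lemma levi_inv_eq:
  assumes D: "subbundle AM 2 D"
  shows "levi_inv G D w = levi_matrix_inv"
  unfolding levi_inv_def levi_eq[OF D]
proof (rule the_equality)
  show "\<forall>\<alpha> \<beta>. (\<Sum>\<gamma>\<in>UNIV. levi_matrix_inv $ \<gamma> $ \<alpha> * levi_matrix $ \<gamma> $ \<beta>) = (if \<alpha> = \<beta> then 1 else 0)"
    by (simp add: forall_2 sum_2 levi_matrix_def levi_matrix_inv_def)
  show "K = levi_matrix_inv" if "\<forall>\<alpha> \<beta>. (\<Sum>\<gamma>\<in>UNIV. K $ \<gamma> $ \<alpha> * levi_matrix $ \<gamma> $ \<beta>) = (if \<alpha> = \<beta> then 1 else 0)" for K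
    using that by (simp add: forall_2 sum_2 levi_matrix_def levi_matrix_inv_def vec_eq_iff field_simps)
qed

end

section \<open>Weyl structures and the tractor connection\<close>

lemma proj_minus_zero_decomposition:
  assumes M: "M \<in> g2_algebra" and "proj_minus M = g2_mat 0 x r y 0 0 0" "proj_zero M = 0"
  shows "M = g2_mat 0 x r y (part_Z M) (part_s M) (part_W M)"
proof -
  have "part_X M = x" "part_r M = r" "part_Y M = y"
    using assms(2) unfolding proj_minus_def g2_mat_eq_iff by simp_all
  moreover have "part_A M = 0"
    using assms(3) unfolding proj_zero_def g2_mat_0[symmetric] g2_mat_eq_iff by simp
  ultimately show ?thesis using g2_mat_parts[OF M] by simp
qed

lemma g2_grade_eq_g2_mat:
  "M \<in> g2_grade 1 \<Longrightarrow> M = g2_mat 0 0 0 0 (part_Z M) 0 0"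
  "M \<in> g2_grade 2 \<Longrightarrow> M = g2_mat 0 0 0 0 0 (part_s M) 0"
  "M \<in> g2_grade 3 \<Longrightarrow> M = g2_mat 0 0 0 0 0 0 (part_W M)"
  by (auto simp: g2_grade_def)

lemma minus_g2_mat: "- g2_mat 0 0 0 0 Z s W = g2_mat 0 0 0 0 (- Z) (- s) (- W)"
  using g2_mat_comb[of "-1" 0 0 0 0 Z s W 0 0 0 0 0 0 0 0] by simp

context canonical_235_geometry begin

lemma tractor_act:
  "tractor_section G t \<Longrightarrow> B \<in> p_algebra \<Longrightarrow> t (act G u (matrix_exp B)) = matrix_exp (- B) *v t u"
  unfolding tractor_section_def using matrix_exp_in_P_group[of B] by (simp add: matrix_inv_matrix_exp)

lemma smooth_tractor_component:
  assumes "tractor_section G t" shows "smooth_at AG std_atlas (\<lambda>v. t v $ i) u"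
proof (rule smooth_at_linear_comp[OF atlases(2) bounded_linear_vec_nth])
  show "smooth_at AG std_atlas t u" using assms unfolding tractor_section_def smooth_map_def by blast
qed

text \<open>Equivariance gives \<open>t (u exp (\<tau> B)) = exp (-\<tau> B) (t u)\<close> along the curve with velocity \<open>X\<close>.\<close>

lemma tractor_derivative_vertical:
  assumes t: "tractor_section G t" and X: "X \<in> TG u" "cartan G u X \<in> p_algebra"
  shows "X (\<lambda>v. t v $ i) = - (cartan G u X *v t u) $ i"
proof -
  let ?B = "cartan G u X"
  let ?c = "\<lambda>\<tau>. act G u (matrix_exp (\<tau> *\<^sub>R ?B))"
  have "((\<lambda>\<tau>. matrix_exp (\<tau> *\<^sub>R (- ?B))) has_vector_derivative - ?B) (at 0)"
    using matrix_exp_has_vector_derivative[of "- ?B" 0] by (simp add: matrix_exp_0)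
  moreover have "bounded_linear (\<lambda>N :: mat7. (N *v t u) $ i)"
    by (rule bounded_linear_compose[OF bounded_linear_vec_nth bounded_bilinear.bounded_linear_left[OF bounded_bilinear_matrix_vector_mult]])
  ultimately have "((\<lambda>\<tau>. (matrix_exp (\<tau> *\<^sub>R (- ?B)) *v t u) $ i) has_vector_derivative (- ?B *v t u) $ i) (at 0)"
    by (rule bounded_linear.has_vector_derivative[rotated])
  then have "deriv (\<lambda>\<tau>. (matrix_exp (\<tau> *\<^sub>R (- ?B)) *v t u) $ i) 0 = (- ?B *v t u) $ i"
    by (intro DERIV_imp_deriv) (simp add: has_real_derivative_iff_has_vector_derivative)
  moreover have "t (?c \<tau>) = matrix_exp (\<tau> *\<^sub>R (- ?B)) *v t u" for \<tau>
    using tractor_act[OF t p_algebra_scaleR[OF X(2)]] by simp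
  moreover have "X (\<lambda>v. t v $ i) = deriv (\<lambda>\<tau>. t (?c \<tau>) $ i) 0"
  proof -
    have "X (\<lambda>v. t v $ i) = velocity AG ?c (\<lambda>v. t v $ i)"
      by (subst tangent_eq_fundamental[OF X]) (simp add: fundamental_vector_def)
    then show ?thesis using smooth_tractor_component[OF t] by (simp add: velocity_def o_def)
  qed
  ultimately show ?thesis
    by (simp add: bounded_bilinear.minus_left[OF bounded_bilinear_matrix_vector_mult])
qed

text \<open>Two lifts differ by a vertical vector, for which the derivative of \<open>t\<close> and the algebraic term cancel.\<close>

lemma tractor_nabla_any_lift:
  assumes t: "tractor_section G t" and X: "X \<in> TG u"
  shows "tractor_nabla G (projD u X) t u $ i = X (\<lambda>v. t v $ i) + (cartan G u X *v t u) $ i"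
proof -
  let ?Y = "tangent_lift G u (projD u X)"
  have "projD u X \<in> TM (proj G u)" by (rule pushforward_in_tangent_space[OF atlases(2,1) smooth_proj X])
  note Y = tangent_lift_spec[OF this]
  have Z: "(\<lambda>f. 1 * ?Y f + (-1) * X f) \<in> TG u" by (rule tangent_comb[OF atlases(2) Y(1) X])
  have c: "cartan G u (\<lambda>f. 1 * ?Y f + (-1) * X f) = 1 *\<^sub>R cartan G u ?Y + (-1) *\<^sub>R cartan G u X"
    by (rule cartan_comb[OF Y(1) X])
  have "projD u (\<lambda>f. 1 * ?Y f + (-1) * X f) = (\<lambda>f. 0)" unfolding pushforward_comb using Y(2) by simp
  from tractor_derivative_vertical[OF t Z projD_kernel[OF Z this], of i]
  have "?Y (\<lambda>v. t v $ i) + (cartan G u ?Y *v t u) $ i = X (\<lambda>v. t v $ i) + (cartan G u X *v t u) $ i"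
    unfolding c by (simp add: bounded_bilinear.diff_left[OF bounded_bilinear_matrix_vector_mult])
  then show ?thesis by (simp add: tractor_nabla_def Let_def)
qed

text \<open>The projection of the \<open>G\<^sub>0\<close>-bundle is smooth because it is the composition of \<open>s\<close> with the projection of
  the large bundle.\<close>

lemma weyl_structure_facts:
  assumes s: "weyl_structure G s"
  shows "smooth_at (atlasG0 G) AG s w" "quot G (s w) = w" "proj0 G w = proj G (s w)"
    "smooth_at (atlasG0 G) AM (proj0 G) w"
proof -
  show 1: "smooth_at (atlasG0 G) AG s w" for w using s unfolding weyl_structure_def smooth_map_def by blast
  show 2: "quot G (s w) = w" for w using s unfolding weyl_structure_def by blast
  show 3: "proj0 G w = proj G (s w)" for w using proj0_quot[of "s w"] unfolding 2 .
  have "proj0 G = (\<lambda>w. proj G (s w))" using 3 by blast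
  then show "smooth_at (atlasG0 G) AM (proj0 G) w"
    using smooth_at_compose[OF atlases(3,2,1) 1[of w] smooth_proj] by simp
qed

lemma pushforward_weyl_structure:
  assumes s: "weyl_structure G s" and \<eta>: "\<eta> \<in> TH w"
  shows "pushforward AG s w \<eta> \<in> TG (s w)" "quotD (s w) (pushforward AG s w \<eta>) = \<eta>"
    "projD (s w) (pushforward AG s w \<eta>) = pushforward AM (proj0 G) w \<eta>"
proof -
  note s' = weyl_structure_facts[OF s]
  show "pushforward AG s w \<eta> \<in> TG (s w)" by (rule pushforward_in_tangent_space[OF atlases(3,2) s'(1) \<eta>])
  have "quotD (s w) (pushforward AG s w \<eta>) = pushforward (atlasG0 G) (\<lambda>w. quot G (s w)) w \<eta>"
    by (rule pushforward_compose[OF atlases(2,3) smooth_quot])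
  then show "quotD (s w) (pushforward AG s w \<eta>) = \<eta>" using pushforward_id[OF \<eta>] by (simp add: s'(2))
  have "projD (s w) (pushforward AG s w \<eta>) = pushforward AM (\<lambda>w. proj G (s w)) w \<eta>"
    by (rule pushforward_compose[OF atlases(2,1) smooth_proj])
  then show "projD (s w) (pushforward AG s w \<eta>) = pushforward AM (proj0 G) w \<eta>"
    by (simp add: s'(3)[symmetric])
qed

text \<open>Start with a lift \<open>X'\<close> to the large bundle on which the Cartan connection has values in \<open>g\<^sub>-\<close>, and let
  \<open>\<eta>\<close> be its image in the \<open>G\<^sub>0\<close>-bundle. The vectors \<open>X'\<close> and \<open>s\<^sub>* \<eta>\<close> have the same image \<open>\<eta>\<close>, so they differ by a
  vector with values in \<open>g\<^sub>+\<close>; in particular \<open>\<omega>(s\<^sub>* \<eta>)\<close> has no \<open>g\<^sub>0\<close> part.\<close>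

lemma weyl_lift_spec:
  assumes s: "weyl_structure G s" and \<xi>: "\<xi> \<in> TM (proj0 G w)"
  shows "weyl_lift G s w \<xi> \<in> TH w" "pushforward AM (proj0 G) w (weyl_lift G s w \<xi>) = \<xi>"
    "proj_zero (pullback_cartan G s w (weyl_lift G s w \<xi>)) = 0"
proof -
  note s' = weyl_structure_facts[OF s]
  let ?u = "s w"
  have \<xi>': "\<xi> \<in> TM (proj G ?u)" using \<xi> unfolding s'(3)[symmetric] .
  obtain X where X: "X \<in> TG ?u" "projD ?u X = \<xi>" using projD_surj[OF \<xi>'] .
  \<comment> \<open>Dropping the \<open>p\<close> part does not change the projection to the base.\<close>
  define X' where "X' = constant_field G (proj_minus (cartan G ?u X)) ?u"
  have pm: "proj_minus (cartan G ?u X) \<in> g2_algebra" by (simp add: proj_minus_def)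
  have X': "X' \<in> TG ?u" unfolding X'_def by (rule constant_field_in_tangent_space[OF pm])
  have cX': "cartan G ?u X' = proj_minus (cartan G ?u X)" unfolding X'_def by (rule cartan_constant_field[OF pm])
  have pX': "projD ?u X' = \<xi>"
    unfolding X(2)[symmetric] by (rule projD_eqI[OF X' X(1)]) (simp_all add: cX' proj_minus_def)
  define \<eta> where "\<eta> = quotD ?u X'"
  have \<eta>: "\<eta> \<in> TH w" using pushforward_in_tangent_space[OF atlases(2,3) smooth_quot X'] by (simp add: \<eta>_def s'(2))
  have "pushforward AM (proj0 G) w \<eta> = pushforward AM (\<lambda>v. proj0 G (quot G v)) ?u X'"
    using pushforward_compose[OF atlases(3,1), of "proj0 G" "quot G" ?u X'] s'(4) by (simp add: \<eta>_def s'(2))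
  then have p\<eta>: "pushforward AM (proj0 G) w \<eta> = \<xi>" using pX' by (simp add: proj0_quot)
  note p = pushforward_weyl_structure[OF s \<eta>]
  have "part_A (cartan G ?u (pushforward AG s w \<eta>)) = part_A (cartan G ?u X')"
    by (rule part_A_eq_if_quotD_eq[OF p(1) X']) (unfold p(2), rule \<eta>_def)
  then have "proj_zero (pullback_cartan G s w \<eta>) = 0"
    unfolding pullback_cartan_def proj_zero_def cX' by (simp add: proj_minus_def g2_mat_0)
  then have "\<exists>\<eta>. \<eta> \<in> TH w \<and> pushforward AM (proj0 G) w \<eta> = \<xi> \<and> proj_zero (pullback_cartan G s w \<eta>) = 0"
    using \<eta> p\<eta> by blast
  from someI_ex[OF this]
  show "weyl_lift G s w \<xi> \<in> TH w" "pushforward AM (proj0 G) w (weyl_lift G s w \<xi>) = \<xi>"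
    "proj_zero (pullback_cartan G s w (weyl_lift G s w \<xi>)) = 0"
    unfolding weyl_lift_def by simp_all
qed

text \<open>The vector in question is the projection of the constant field of \<open>B\<close>: its other lift \<open>s\<^sub>* \<eta>\<close> has the same
  \<open>g\<^sub>-\<close> part.\<close>

lemma weyl_frame_spec:
  assumes s: "weyl_structure G s" and B: "B = g2_mat 0 x r y 0 0 0"
  shows "weyl_frame G s w B \<in> TM (proj0 G w)" "proj_minus (weyl_form G s w (weyl_frame G s w B)) = B"
proof -
  note s' = weyl_structure_facts[OF s]
  let ?u = "s w"
  have Bg: "B \<in> g2_algebra" by (simp add: B)
  let ?X = "constant_field G B ?u"
  note X = constant_field_in_tangent_space[OF Bg, of ?u]
  have \<xi>: "projD ?u ?X \<in> TM (proj0 G w)"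
    unfolding s'(3) by (rule pushforward_in_tangent_space[OF atlases(2,1) smooth_proj X])
  note l = weyl_lift_spec[OF s \<xi>]
  note p = pushforward_weyl_structure[OF s l(1)]
  have "projD ?u (pushforward AG s w (weyl_lift G s w (projD ?u ?X))) = projD ?u ?X"
    unfolding p(3) l(2) ..
  from parts_eq_if_projD_eq[OF p(1) X this]
  have "proj_minus (weyl_form G s w (projD ?u ?X)) = B"
    unfolding weyl_form_def pullback_cartan_def proj_minus_def cartan_constant_field[OF Bg] by (simp add: B)
  then have "\<exists>\<xi>. \<xi> \<in> TM (proj0 G w) \<and> proj_minus (weyl_form G s w \<xi>) = B" using \<xi> by blast
  from someI_ex[OF this]
  show "weyl_frame G s w B \<in> TM (proj0 G w)" "proj_minus (weyl_form G s w (weyl_frame G s w B)) = B"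
    unfolding weyl_frame_def by simp_all
qed

text \<open>The tractor connection is computed with the lift \<open>s\<^sub>* \<eta>\<close> of the horizontal lift \<open>\<eta>\<close>.\<close>

lemma tractor_nabla_dir_eq:
  assumes s: "weyl_structure G s" and t: "tractor_section G t" and B: "B = g2_mat 0 x r y 0 0 0"
  shows "tractor_nabla_dir G s B t w $ i = nabla_dir G s B (\<lambda>w. t (s w) $ i) w
    + (g2_mat 0 x r y (rho_Z G s w B) (rho_s G s w B) (rho_W G s w B) *v t (s w)) $ i"
proof -
  let ?\<xi> = "weyl_frame G s w B"
  note f = weyl_frame_spec[OF s B, of w]
  note l = weyl_lift_spec[OF s f(1)]
  note p = pushforward_weyl_structure[OF s l(1)]
  let ?X = "pushforward AG s w (weyl_lift G s w ?\<xi>)"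
  have "projD (s w) ?X = ?\<xi>" unfolding p(3) l(2) ..
  then have "tractor_nabla_dir G s B t w $ i = ?X (\<lambda>v. t v $ i) + (cartan G (s w) ?X *v t (s w)) $ i"
    unfolding tractor_nabla_dir_def using tractor_nabla_any_lift[OF t p(1)] by simp
  moreover have "?X (\<lambda>v. t v $ i) = nabla_dir G s B (\<lambda>w. t (s w) $ i) w"
    unfolding nabla_dir_def weyl_nabla_def by (rule pushforward_apply) (rule smooth_tractor_component[OF t])
  moreover have "cartan G (s w) ?X = weyl_form G s w ?\<xi>" by (simp add: weyl_form_def pullback_cartan_def)
  moreover have "weyl_form G s w ?\<xi> = g2_mat 0 x r y (rho_Z G s w B) (rho_s G s w B) (rho_W G s w B)"
    unfolding rho_Z_def rho_s_def rho_W_def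
  proof (rule proj_minus_zero_decomposition)
    show "weyl_form G s w ?\<xi> \<in> g2_algebra"
      unfolding weyl_form_def pullback_cartan_def by (rule cartan_in_algebra[OF p(1)])
    show "proj_minus (weyl_form G s w ?\<xi>) = g2_mat 0 x r y 0 0 0" using f(2) B by simp
    show "proj_zero (weyl_form G s w ?\<xi>) = 0" unfolding weyl_form_def by (rule l(3))
  qed
  ultimately show ?thesis by simp
qed

lemma tractor_change_of_weyl_structure:
  assumes t: "tractor_section G t"
    and \<Upsilon>: "\<Upsilon>1 \<in> g2_grade 1" "\<Upsilon>2 \<in> g2_grade 2" "\<Upsilon>3 \<in> g2_grade 3"
  shows "t (act G (act G (act G u (matrix_exp \<Upsilon>1)) (matrix_exp \<Upsilon>2)) (matrix_exp \<Upsilon>3)) =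
    matrix_exp (g2_mat 0 0 0 0 0 0 (- part_W \<Upsilon>3)) *v (matrix_exp (g2_mat 0 0 0 0 0 (- part_s \<Upsilon>2) 0) *v
     (matrix_exp (g2_mat 0 0 0 0 (- part_Z \<Upsilon>1) 0 0) *v t u))"
proof -
  note g = g2_grade_eq_g2_mat(1)[OF \<Upsilon>(1)] g2_grade_eq_g2_mat(2)[OF \<Upsilon>(2)] g2_grade_eq_g2_mat(3)[OF \<Upsilon>(3)]
  have m: "- \<Upsilon>1 = g2_mat 0 0 0 0 (- part_Z \<Upsilon>1) 0 0" "- \<Upsilon>2 = g2_mat 0 0 0 0 0 (- part_s \<Upsilon>2) 0"
     "- \<Upsilon>3 = g2_mat 0 0 0 0 0 0 (- part_W \<Upsilon>3)"
    by (subst g, simp add: minus_g2_mat)+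
  have p: "\<Upsilon>1 \<in> p_algebra" "\<Upsilon>2 \<in> p_algebra" "\<Upsilon>3 \<in> p_algebra"
    unfolding p_algebra_iff by (subst g, blast)+
  show ?thesis unfolding tractor_act[OF t p(3)] tractor_act[OF t p(2)] tractor_act[OF t p(1)] m ..
qed

end

section \<open>Formulas in components\<close>

text \<open>As in \<open>g2_algebra_derivation\<close>, all occurrences of \<open>sqrt 2\<close>, including those in the inverse Levi matrix,
  are expressed by \<open>q\<close> with \<open>q\<^sup>2 = 1/2\<close>.\<close>

lemma splitting_change_components:
  fixes v :: "real^7" and U1 U3 :: "real^2" and U2 :: real
  defines "v' \<equiv> matrix_exp (g2_mat 0 0 0 0 0 0 (- U3)) *v (matrix_exp (g2_mat 0 0 0 0 0 (- U2) 0) *v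
     (matrix_exp (g2_mat 0 0 0 0 (- U1) 0 0) *v v))"
    and "K \<equiv> levi_matrix_inv" and "\<phi> \<equiv> t_phi v" and "\<upsilon> \<equiv> t_ups v" and "\<tau> \<equiv> t_tau v" and "\<sigma> \<equiv> t_sig v"
  shows "t_chi v' = t_chi v - (\<Sum>\<alpha>\<in>UNIV. \<phi>$\<alpha> * U1$\<alpha>) - \<upsilon> * U2 - (\<Sum>\<alpha>\<in>UNIV. \<tau>$\<alpha> * U3$\<alpha>)
           + 4 * U2 * (\<Sum>\<alpha>\<in>UNIV. \<Sum>\<beta>\<in>UNIV. K$\<alpha>$\<beta> * U1$\<alpha> * \<tau>$\<beta>) + 1/2 * \<sigma> * U2 * U2
           - \<sigma> * (\<Sum>\<alpha>\<in>UNIV. U1$\<alpha> * U3$\<alpha>)" (is ?chi)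
    and "\<forall>\<alpha>. t_phi v' $ \<alpha> = \<phi>$\<alpha> - 4 * \<upsilon> * (\<Sum>\<beta>\<in>UNIV. K$\<beta>$\<alpha> * U1$\<beta>)
           - 2 * U2 * (\<Sum>\<beta>\<in>UNIV. K$\<beta>$\<alpha> * \<tau>$\<beta>)
           + 8 * (\<Sum>\<gamma>\<in>UNIV. \<Sum>\<zeta>\<in>UNIV. K$\<gamma>$\<zeta> * U1$\<gamma> * \<tau>$\<zeta>) * (\<Sum>\<beta>\<in>UNIV. K$\<beta>$\<alpha> * U1$\<beta>)
           + \<sigma> * U3$\<alpha> - 2 * \<sigma> * U2 * (\<Sum>\<beta>\<in>UNIV. K$\<beta>$\<alpha> * U1$\<beta>)" (is ?phi)
    and "t_ups v' = \<upsilon> - 4 * (\<Sum>\<alpha>\<in>UNIV. \<Sum>\<beta>\<in>UNIV. K$\<alpha>$\<beta> * U1$\<alpha> * \<tau>$\<beta>) - \<sigma> * U2" (is ?ups)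
    and "\<forall>\<alpha>. t_tau v' $ \<alpha> = \<tau>$\<alpha> + \<sigma> * U1$\<alpha>"
    and "t_sig v' = \<sigma>"
proof -
  define q :: real where "q = sqrt 2 / 2"
  have q: "q * q = 1 / 2" "q * (q * c) = c / 2" for c by (simp_all add: q_def mult.assoc[symmetric])
  have sq: "sqrt 2 = 2 * q" by (simp add: q_def)
  have div: "c / sqrt 2 = c * q" "c / (2 * sqrt 2) = c * q / 2" for c by (simp_all add: q_def field_simps)
  note defs = v'_def K_def \<phi>_def \<upsilon>_def \<tau>_def \<sigma>_def t_chi_def t_phi_def t_ups_def t_tau_def t_sig_def
    levi_matrix_inv_def matrix_exp_grade_1 matrix_exp_grade_2 matrix_exp_grade_3 Let_def sum_2 forall_2
  show ?chi ?phi ?ups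
    unfolding defs div unfolding sq by (simp_all add: algebra_simps q)
  show "\<forall>\<alpha>. t_tau v' $ \<alpha> = \<tau>$\<alpha> + \<sigma> * U1$\<alpha>" "t_sig v' = \<sigma>"
    unfolding defs by (simp_all add: algebra_simps)
qed

theorem proposition5:
  fixes G :: "('m::{t2_space,second_countable_topology}, 'g::{t2_space,second_countable_topology},
               'h::{t2_space,second_countable_topology}) geometry"
    and D :: "'m \<Rightarrow> 'm tv set" and pos :: "'m \<Rightarrow> 'm tv \<Rightarrow> 'm tv \<Rightarrow> bool"
  assumes "oriented_distribution_235 (atlasM G) D pos"
    and "canonical_geometry G D pos"
  shows
  "(\<forall>\<theta> \<theta>' s s' \<Upsilon>1 \<Upsilon>2 \<Upsilon>3 t.
      is_scale (atlasM G) D \<theta> \<and> is_scale (atlasM G) D \<theta>' \<and>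
      weyl_structure_of_scale G \<theta> s \<and> weyl_structure_of_scale G \<theta>' s' \<and>
      gr_cotangent_section G 1 \<Upsilon>1 \<and> gr_cotangent_section G 2 \<Upsilon>2 \<and> gr_cotangent_section G 3 \<Upsilon>3 \<and>
      (\<forall>w. s' w = act G (act G (act G (s w) (matrix_exp (\<Upsilon>1 w))) (matrix_exp (\<Upsilon>2 w))) (matrix_exp (\<Upsilon>3 w))) \<and>
      tractor_section G t \<longrightarrow>
      (\<forall>w. let
         U1 = part_Z (\<Upsilon>1 w); U2 = part_s (\<Upsilon>2 w); U3 = part_W (\<Upsilon>3 w); K = levi_inv G D w;
         ch = t_chi (t (s w)); \<phi> = t_phi (t (s w)); \<upsilon> = t_ups (t (s w));
         \<tau> = t_tau (t (s w)); \<sigma> = t_sig (t (s w))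
       in
         t_chi (t (s' w)) = ch - (\<Sum>\<alpha>\<in>UNIV. \<phi>$\<alpha> * U1$\<alpha>) - \<upsilon> * U2 - (\<Sum>\<alpha>\<in>UNIV. \<tau>$\<alpha> * U3$\<alpha>)
           + 4 * U2 * (\<Sum>\<alpha>\<in>UNIV. \<Sum>\<beta>\<in>UNIV. K$\<alpha>$\<beta> * U1$\<alpha> * \<tau>$\<beta>) + 1/2 * \<sigma> * U2 * U2
           - \<sigma> * (\<Sum>\<alpha>\<in>UNIV. U1$\<alpha> * U3$\<alpha>) \<and>
         (\<forall>\<alpha>. t_phi (t (s' w)) $ \<alpha> = \<phi>$\<alpha> - 4 * \<upsilon> * (\<Sum>\<beta>\<in>UNIV. K$\<beta>$\<alpha> * U1$\<beta>)
           - 2 * U2 * (\<Sum>\<beta>\<in>UNIV. K$\<beta>$\<alpha> * \<tau>$\<beta>)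
           + 8 * (\<Sum>\<gamma>\<in>UNIV. \<Sum>\<zeta>\<in>UNIV. K$\<gamma>$\<zeta> * U1$\<gamma> * \<tau>$\<zeta>) * (\<Sum>\<beta>\<in>UNIV. K$\<beta>$\<alpha> * U1$\<beta>)
           + \<sigma> * U3$\<alpha> - 2 * \<sigma> * U2 * (\<Sum>\<beta>\<in>UNIV. K$\<beta>$\<alpha> * U1$\<beta>)) \<and>
         t_ups (t (s' w)) = \<upsilon> - 4 * (\<Sum>\<alpha>\<in>UNIV. \<Sum>\<beta>\<in>UNIV. K$\<alpha>$\<beta> * U1$\<alpha> * \<tau>$\<beta>) - \<sigma> * U2 \<and>
         (\<forall>\<alpha>. t_tau (t (s' w)) $ \<alpha> = \<tau>$\<alpha> + \<sigma> * U1$\<alpha>) \<and>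
         t_sig (t (s' w)) = \<sigma>))
   \<and>
   (\<forall>\<theta> s t.
      is_scale (atlasM G) D \<theta> \<and> weyl_structure_of_scale G \<theta> s \<and> tractor_section G t \<longrightarrow>
      (\<forall>w. let
         L = levi G D w; K = levi_inv G D w;
         P1 = rho_Z G s w; P2 = rho_s G s w; P3 = rho_W G s w;
         fchi = (\<lambda>w. t_chi (t (s w))); fphi = (\<lambda>\<alpha> w. t_phi (t (s w)) $ \<alpha>);
         fups = (\<lambda>w. t_ups (t (s w))); ftau = (\<lambda>\<alpha> w. t_tau (t (s w)) $ \<alpha>);
         fsig = (\<lambda>w. t_sig (t (s w)));
         ch = t_chi (t (s w)); \<phi> = t_phi (t (s w)); \<upsilon> = t_ups (t (s w));
         \<tau> = t_tau (t (s w)); \<sigma> = t_sig (t (s w))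
       in
         (\<forall>\<beta>. let V = tractor_nabla_dir G s (dlow \<beta>) t w; d = dlow \<beta> in
            t_chi V = nabla_dir G s d fchi w + (\<Sum>\<zeta>\<in>UNIV. P1 d$\<zeta> * \<phi>$\<zeta>) + P2 d * \<upsilon>
              + (\<Sum>\<zeta>\<in>UNIV. P3 d$\<zeta> * \<tau>$\<zeta>) \<and>
            (\<forall>\<alpha>. t_phi V $ \<alpha> = nabla_dir G s d (fphi \<alpha>) w + ch * (if \<alpha> = \<beta> then 1 else 0)
              + 4 * \<upsilon> * (\<Sum>\<gamma>\<in>UNIV. K$\<gamma>$\<alpha> * P1 d$\<gamma>) + 2 * P2 d * (\<Sum>\<gamma>\<in>UNIV. K$\<gamma>$\<alpha> * \<tau>$\<gamma>)
              - \<sigma> * P3 d$\<alpha>) \<and>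
            t_ups V = nabla_dir G s d fups w + 1/2 * (\<Sum>\<gamma>\<in>UNIV. L$\<beta>$\<gamma> * \<phi>$\<gamma>)
              + 4 * (\<Sum>\<gamma>\<in>UNIV. \<Sum>\<zeta>\<in>UNIV. K$\<gamma>$\<zeta> * P1 d$\<gamma> * \<tau>$\<zeta>) + \<sigma> * P2 d \<and>
            (\<forall>\<alpha>. t_tau V $ \<alpha> = nabla_dir G s d (ftau \<alpha>) w + 1/2 * \<upsilon> * L$\<beta>$\<alpha> - \<sigma> * P1 d$\<alpha>) \<and>
            t_sig V = nabla_dir G s d fsig w - \<tau>$\<beta>) \<and>
         (let V = tractor_nabla_dir G s ddia t w; d = ddia in
            t_chi V = nabla_dir G s d fchi w + (\<Sum>\<gamma>\<in>UNIV. P1 d$\<gamma> * \<phi>$\<gamma>) + P2 d * \<upsilon>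
              + (\<Sum>\<gamma>\<in>UNIV. P3 d$\<gamma> * \<tau>$\<gamma>) \<and>
            (\<forall>\<alpha>. t_phi V $ \<alpha> = nabla_dir G s d (fphi \<alpha>) w
              + 4 * \<upsilon> * (\<Sum>\<gamma>\<in>UNIV. K$\<gamma>$\<alpha> * P1 d$\<gamma>) + 2 * P2 d * (\<Sum>\<gamma>\<in>UNIV. K$\<gamma>$\<alpha> * \<tau>$\<gamma>)
              - \<sigma> * P3 d$\<alpha>) \<and>
            t_ups V = nabla_dir G s d fups w + ch
              + 4 * (\<Sum>\<gamma>\<in>UNIV. \<Sum>\<zeta>\<in>UNIV. K$\<gamma>$\<zeta> * P1 d$\<gamma> * \<tau>$\<zeta>) + \<sigma> * P2 d \<and>
            (\<forall>\<alpha>. t_tau V $ \<alpha> = nabla_dir G s d (ftau \<alpha>) w - 1/4 * (\<Sum>\<gamma>\<in>UNIV. L$\<gamma>$\<alpha> * \<phi>$\<gamma>)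
              - \<sigma> * P1 d$\<alpha>) \<and>
            t_sig V = nabla_dir G s d fsig w + \<upsilon>) \<and>
         (\<forall>\<beta>. let V = tractor_nabla_dir G s (dup \<beta>) t w; d = dup \<beta> in
            t_chi V = nabla_dir G s d fchi w + (\<Sum>\<gamma>\<in>UNIV. P1 d$\<gamma> * \<phi>$\<gamma>) + P2 d * \<upsilon>
              + (\<Sum>\<gamma>\<in>UNIV. P3 d$\<gamma> * \<tau>$\<gamma>) \<and>
            (\<forall>\<alpha>. t_phi V $ \<alpha> = nabla_dir G s d (fphi \<alpha>) w
              + 4 * \<upsilon> * (\<Sum>\<gamma>\<in>UNIV. K$\<gamma>$\<alpha> * P1 d$\<gamma>) + 2 * P2 d * (\<Sum>\<gamma>\<in>UNIV. K$\<gamma>$\<alpha> * \<tau>$\<gamma>)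
              - \<sigma> * P3 d$\<alpha>) \<and>
            t_ups V = nabla_dir G s d fups w
              + 4 * (\<Sum>\<gamma>\<in>UNIV. \<Sum>\<zeta>\<in>UNIV. K$\<gamma>$\<zeta> * P1 d$\<gamma> * \<tau>$\<zeta>) + \<sigma> * P2 d \<and>
            (\<forall>\<alpha>. t_tau V $ \<alpha> = nabla_dir G s d (ftau \<alpha>) w + ch * (if \<alpha> = \<beta> then 1 else 0)
              - \<sigma> * P1 d$\<alpha>) \<and>
            t_sig V = nabla_dir G s d fsig w - \<phi>$\<beta>)))"
proof -
  interpret canonical_235_geometry G D pos by unfold_locales (rule assms(2))
  have D: "subbundle (atlasM G) 2 D"
    using assms(1) unfolding oriented_distribution_235_def distribution_235_def by blast
  note levi = levi_eq[OF D] and levi_inv = levi_inv_eq[OF D]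
  show ?thesis
  proof ((rule conjI; intro allI impI), goal_cases)
    case *: (1 \<theta> \<theta>' s s' \<Upsilon>1 \<Upsilon>2 \<Upsilon>3 t w)
    then have t: "tractor_section G t" by blast
    have \<Upsilon>: "\<Upsilon>1 w \<in> g2_grade 1" "\<Upsilon>2 w \<in> g2_grade 2" "\<Upsilon>3 w \<in> g2_grade 3"
      using * unfolding gr_cotangent_section_def by blast+
    have s': "s' w = act G (act G (act G (s w) (matrix_exp (\<Upsilon>1 w))) (matrix_exp (\<Upsilon>2 w))) (matrix_exp (\<Upsilon>3 w))"
      using * by blast
    note eq = tractor_change_of_weyl_structure[OF t \<Upsilon>, of "s w", folded s']
    show ?case
      unfolding Let_def levi_inv eq by (intro conjI splitting_change_components)
  next
    case *: (2 \<theta> s t w)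
    then have t: "tractor_section G t" by blast
    have ws: "weyl_structure G s" using * unfolding weyl_structure_of_scale_def by blast
    note nabla = tractor_nabla_dir_eq[OF ws t dlow_def] tractor_nabla_dir_eq[OF ws t ddia_def]
      tractor_nabla_dir_eq[OF ws t dup_def]
    have div: "c / sqrt 2 = c * sqrt 2 / 2" "c / (2 * sqrt 2) = c * sqrt 2 / 4" for c
      by (simp_all add: field_simps)
    show ?case
      unfolding Let_def levi_inv levi forall_2 sum_2 t_chi_def t_phi_def t_ups_def t_tau_def t_sig_def
        levi_matrix_def levi_matrix_inv_def vector_2 nabla g2_mat_vector_mult vector_7 div
      by (simp add: axis_def algebra_simps trace_def)
  qed
qed

end
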